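(* Let $\mathcal U$ and $\mathcal X$ be complex Hilbert spaces, let $A\in\mathcal B(\mathcal X)$, $B\in\mathcal B(\mathcal U,\mathcal X)$, $C\in\mathcal B(\mathcal X,\mathcal U)$, $D\in\mathcal B(\mathcal U)$, and consider the $\mathcal B(\mathcal U)$-valued function $$G(z)=I+F(z),\qquad F(z)=D+zC(I-zA)^{-1}B,\qquad \|F\|_{\infty,\mathbb T}<1 .$$ Assume that $A$ is dichotomous and that $I+D$ is invertible. Then $A^\times:=A-B(I+D)^{-1}C$ is also dichotomous. Let $(\mathcal X_-,\mathcal X_+)$ and $(\mathcal X_-^\times,\mathcal X_+^\times)$ be the dichotomous pairs of $A$ and $A^\times$, respectively. Then $$\mathcal X=\mathcal X_-\dotplus\mathcal X_+^\times .$$ Write $\Pi_r$ for the projection in $\mathcal X$ onto $\mathcal X_+^\times$ along $\mathcal X_-$. Take any factorization $I+D=D_1D_2$ with $D_1,D_2\in\mathcal B(\mathcal U)$ invertible. Then $G(z)=V_-(z)V_+(z)$, where $$\begin{aligned} V_-(z)&:=D_1+zC(I-zA)^{-1}(I-\Pi_r)BD_2^{-1},\\ V_+(z)&:=D_2+zD_1^{-1}C\Pi_r(I-zA)^{-1}B,\qquad z\in\rho(A)^{-1}\cup\{0\},\end{aligned}$$ with inverses given by $$\begin{aligned} V_-(z)^{-1}&=D_1^{-1}-zD_1^{-1}C(I-\Pi_r)(I-zA^\times)^{-1}BD_2^{-1}D_1^{-1},\\ V_+(z)^{-1}&=D_2^{-1}-zD_2^{-1}D_1^{-1}C(I-zA^\times)^{-1}\Pi_rBD_2^{-1},\qquad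 z\in\rho(A^\times)^{-1}\cup\{0\}.\end{aligned}$$ The functions $V_+(z)$ and $V_+(z)^{-1}$ extend analytically to functions on a neighborhood of the closed unit disc $\overline{\mathbb D}$, while $V_-(z)$ and $V_-(z)^{-1}$ extend analytically to functions on a neighborhood of $\overline{\mathbb E}$.
   Context: $\mathcal B(\mathcal X,\mathcal Y)$ denotes the bounded linear operators from $\mathcal X$ to $\mathcal Y$, and $\mathcal B(\mathcal X)=\mathcal B(\mathcal X,\mathcal X)$. An operator is invertible when it has a bounded inverse. $\mathbb T$ is the complex unit circle, $\mathbb D$ the open unit disc, $\mathbb E:=\mathbb C\setminus\overline{\mathbb D}$, and $\overline{\mathbb E}$ its closure (the closed complement of $\mathbb D$). $\sigma(A)$ and $\rho(A)$ are the spectrum and resolvent set; $\rho(A)^{-1}\cup\{0\}$ denotes the set of all $z\in\mathbb C$ such that $I-zA$ is invertible. $\|F\|_{\infty,\mathbb T}:=\max_{z\in\mathbb T}\|F(z)\|$. An operator $A\in\mathcal B(\mathcal X)$ is dichotomous if $\sigma(A)\cap\mathbb T=\emptyset$. Its dichotomous pair $(\mathcal X_-,\mathcal X_+)$ consists of the spectral subspaces of $A$ corresponding to $\mathbb E$ and $\mathbb D$, respectively: $\mathcal X_+=\operatorname{Im}P_+$ and $\mathcal X_-=\operatorname{Ker}P_+$ with $P_+=\frac1{2\pi i}\int_{\mathbb T}(zI-A)^{-1}\,dz$ (counterclockwise). Equivalently, $\mathcal X=\mathcal X_-\dotplus\mathcal X_+$, both subspaces are closed and $A$-invariant, $\sigma(A|_{\mathcal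 X_-})\subset\mathbb E$ and $\sigma(A|_{\mathcal X_+})\subset\mathbb D$. The symbol $\dotplus$ denotes a (not necessarily orthogonal) direct sum of closed subspaces. The functions $V_\pm$ are defined on $\rho(A)^{-1}\cup\{0\}$, where the factorization $G=V_-V_+$ holds. The formulas for the inverses give the inverse operators of $V_\pm(z)$ at points $z$ in $(\rho(A)^{-1}\cup\{0\})\cap(\rho(A^\times)^{-1}\cup\{0\})$, and they define the functions denoted $V_\pm(z)^{-1}$ on the whole of $\rho(A^\times)^{-1}\cup\{0\}$. *)

theory Defs
  imports "HOL-Analysis.Analysis"
begin

section \<open>Complex Hilbert spaces\<close>

class complex_vector = real_vector +
  fixes scaleC :: "complex \<Rightarrow> 'a \<Rightarrow> 'a" (infixr \<open>*\<^sub>C\<close> 75)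
  assumes scaleC_add_right: "a *\<^sub>C (x + y) = a *\<^sub>C x + a *\<^sub>C y"
    and scaleC_add_left: "(a + b) *\<^sub>C x = a *\<^sub>C x + b *\<^sub>C x"
    and scaleC_scaleC: "a *\<^sub>C b *\<^sub>C x = (a * b) *\<^sub>C x"
    and scaleC_one: "1 *\<^sub>C x = x"
    and scaleR_scaleC: "r *\<^sub>R x = complex_of_real r *\<^sub>C x"

class complex_normed_vector = complex_vector + real_normed_vector +
  assumes norm_scaleC: "norm (a *\<^sub>C x) = cmod a * norm x"

text \<open>The inner product is linear in the second argument; positive definiteness is contained in
  the last axiom.\<close>

class complex_inner = complex_normed_vector +
  fixes cinner :: "'a \<Rightarrow> 'a \<Rightarrow> complex"
  assumes cinner_commute: "cinner x y = cnj (cinner y x)"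
    and cinner_add_right: "cinner x (y + z) = cinner x y + cinner x z"
    and cinner_scaleC_right: "cinner x (a *\<^sub>C y) = a * cinner x y"
    and cinner_self: "cinner x x = complex_of_real ((norm x)\<^sup>2)"

class chilbert_space = complex_inner + banach

instantiation complex :: chilbert_space
begin

definition scaleC_complex :: "complex \<Rightarrow> complex \<Rightarrow> complex"
  where "scaleC_complex a x = a * x"

definition cinner_complex :: "complex \<Rightarrow> complex \<Rightarrow> complex"
  where "cinner_complex x y = cnj x * y"

instance proof
  fix x y z a b :: complex and r :: real
  show "a *\<^sub>C (x + y) = a *\<^sub>C x + a *\<^sub>C y" "(a + b) *\<^sub>C x = a *\<^sub>C x + b *\<^sub>C x"
    "a *\<^sub>C b *\<^sub>C x = (a * b) *\<^sub>C x" "1 *\<^sub>C x = x"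
    "norm (a *\<^sub>C x) = cmod a * norm x"
    by (simp_all add: scaleC_complex_def distrib_left distrib_right mult.assoc norm_mult)
  show "r *\<^sub>R x = complex_of_real r *\<^sub>C x"
    by (simp add: scaleC_complex_def scaleR_conv_of_real)
  show "cinner x y = cnj (cinner y x)" "cinner x (y + z) = cinner x y + cinner x z"
    "cinner x (a *\<^sub>C y) = a * cinner x y"
    by (simp_all add: cinner_complex_def scaleC_complex_def distrib_left)
  show "cinner x x = complex_of_real ((norm x)\<^sup>2)"
    by (simp only: cinner_complex_def complex_norm_square mult.commute)
qed

end

lemma scaleC_zero_right [simp]: "a *\<^sub>C (0 :: 'a::complex_vector) = 0"
  using scaleC_add_right[of a 0 "0 :: 'a"] by simp

lemma scaleC_minus_right: "a *\<^sub>C (- x) = - (a *\<^sub>C (x :: 'a::complex_vector))"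
proof -
  have "a *\<^sub>C x + a *\<^sub>C (- x) = 0"
    unfolding scaleC_add_right[symmetric] by simp
  then show ?thesis
    by (rule minus_unique[symmetric])
qed

lemma scaleC_diff_right: "a *\<^sub>C (x - y) = a *\<^sub>C x - a *\<^sub>C (y :: 'a::complex_vector)"
  using scaleC_add_right[of a x "- y"] unfolding scaleC_minus_right by simp

lemma bounded_linear_scaleC: "bounded_linear (\<lambda>x :: 'a::complex_normed_vector. c *\<^sub>C x)"
proof (rule bounded_linear_intro)
  show "c *\<^sub>C (r *\<^sub>R x) = r *\<^sub>R (c *\<^sub>C x)" for r and x :: 'a
    by (simp add: scaleR_scaleC scaleC_scaleC mult.commute)
  show "norm (c *\<^sub>C x) \<le> norm x * cmod c" for x :: 'a
    by (simp add: norm_scaleC mult.commute)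
qed (rule scaleC_add_right)


section \<open>Bounded complex-linear operators\<close>

typedef (overloaded) ('a, 'b) cblinfun (\<open>(_ \<Rightarrow>\<^sub>C\<^sub>L /_)\<close> [22, 21] 21) =
  "{f :: 'a::complex_normed_vector \<Rightarrow>\<^sub>L 'b::complex_normed_vector.
      \<forall>c x. blinfun_apply f (c *\<^sub>C x) = c *\<^sub>C blinfun_apply f x}"
  morphisms blinfun_of_cblinfun CBlinfun
  by (rule exI[of _ 0]) simp

text \<open>Scaling on the ambient space of real-linear operators, to be lifted to \<^typ>\<open>('a, 'b) cblinfun\<close>.\<close>

definition scaleC_blinfun ::
    "complex \<Rightarrow> 'a::complex_normed_vector \<Rightarrow>\<^sub>L 'b::complex_normed_vector \<Rightarrow> 'a \<Rightarrow>\<^sub>L 'b"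
  where "scaleC_blinfun c f = Blinfun (\<lambda>x. c *\<^sub>C blinfun_apply f x)"

lemma scaleC_blinfun_apply [simp]: "blinfun_apply (scaleC_blinfun c f) x = c *\<^sub>C blinfun_apply f x"
  unfolding scaleC_blinfun_def
  by (simp add: bounded_linear_Blinfun_apply bounded_linear_compose[OF bounded_linear_scaleC]
      blinfun.bounded_linear_right)

setup_lifting type_definition_cblinfun

lift_definition cblinfun_apply ::
  "'a::complex_normed_vector \<Rightarrow>\<^sub>C\<^sub>L 'b::complex_normed_vector \<Rightarrow> 'a \<Rightarrow> 'b" (infixr \<open>*\<^sub>V\<close> 70)
  is blinfun_apply .

instantiation cblinfun :: (complex_normed_vector, complex_normed_vector) complex_normed_vector
begin

lift_definition zero_cblinfun :: "'a \<Rightarrow>\<^sub>C\<^sub>L 'b" is 0 by simp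

lift_definition plus_cblinfun :: "'a \<Rightarrow>\<^sub>C\<^sub>L 'b \<Rightarrow> 'a \<Rightarrow>\<^sub>C\<^sub>L 'b \<Rightarrow> 'a \<Rightarrow>\<^sub>C\<^sub>L 'b" is "(+)"
  by (simp add: blinfun.add_left scaleC_add_right)

lift_definition uminus_cblinfun :: "'a \<Rightarrow>\<^sub>C\<^sub>L 'b \<Rightarrow> 'a \<Rightarrow>\<^sub>C\<^sub>L 'b" is uminus
  by (simp add: blinfun.minus_left scaleC_minus_right)

lift_definition minus_cblinfun :: "'a \<Rightarrow>\<^sub>C\<^sub>L 'b \<Rightarrow> 'a \<Rightarrow>\<^sub>C\<^sub>L 'b \<Rightarrow> 'a \<Rightarrow>\<^sub>C\<^sub>L 'b" is "(-)"
  by (simp add: blinfun.diff_left scaleC_diff_right)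

lift_definition scaleR_cblinfun :: "real \<Rightarrow> 'a \<Rightarrow>\<^sub>C\<^sub>L 'b \<Rightarrow> 'a \<Rightarrow>\<^sub>C\<^sub>L 'b" is scaleR
  by (simp add: blinfun.scaleR_left scaleR_scaleC scaleC_scaleC mult.commute)

lift_definition scaleC_cblinfun :: "complex \<Rightarrow> 'a \<Rightarrow>\<^sub>C\<^sub>L 'b \<Rightarrow> 'a \<Rightarrow>\<^sub>C\<^sub>L 'b" is scaleC_blinfun
  by (simp add: scaleC_scaleC mult.commute)

lift_definition norm_cblinfun :: "'a \<Rightarrow>\<^sub>C\<^sub>L 'b \<Rightarrow> real" is norm .

definition dist_cblinfun :: "'a \<Rightarrow>\<^sub>C\<^sub>L 'b \<Rightarrow> 'a \<Rightarrow>\<^sub>C\<^sub>L 'b \<Rightarrow> real"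
  where "dist_cblinfun S T = norm (S - T)"

definition sgn_cblinfun :: "'a \<Rightarrow>\<^sub>C\<^sub>L 'b \<Rightarrow> 'a \<Rightarrow>\<^sub>C\<^sub>L 'b"
  where "sgn_cblinfun T = inverse (norm T) *\<^sub>R T"

definition uniformity_cblinfun :: "(('a \<Rightarrow>\<^sub>C\<^sub>L 'b) \<times> ('a \<Rightarrow>\<^sub>C\<^sub>L 'b)) filter"
  where "uniformity_cblinfun = (INF e\<in>{0<..}. principal {(x, y). dist x y < e})"

definition open_cblinfun :: "('a \<Rightarrow>\<^sub>C\<^sub>L 'b) set \<Rightarrow> bool"
  where "open_cblinfun S = (\<forall>x\<in>S. \<forall>\<^sub>F (x', y) in uniformity. x' = x \<longrightarrow> y \<in> S)"

instance
proof
  fix S T U :: "'a \<Rightarrow>\<^sub>C\<^sub>L 'b" and r s :: real and a b :: complex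
  show "S + T + U = S + (T + U)" by transfer (rule add.assoc)
  show "S + T = T + S" by transfer (rule add.commute)
  show "0 + T = T" by transfer simp
  show "- T + T = 0" by transfer simp
  show "S - T = S + - T" by transfer simp
  show "r *\<^sub>R (S + T) = r *\<^sub>R S + r *\<^sub>R T" by transfer (rule scaleR_add_right)
  show "(r + s) *\<^sub>R T = r *\<^sub>R T + s *\<^sub>R T" by transfer (rule scaleR_add_left)
  show "r *\<^sub>R s *\<^sub>R T = (r * s) *\<^sub>R T" by transfer simp
  show "1 *\<^sub>R T = T" by transfer simp
  show "a *\<^sub>C (S + T) = a *\<^sub>C S + a *\<^sub>C T"
    by transfer (auto intro!: blinfun_eqI simp: blinfun.add_left scaleC_add_right)
  show "(a + b) *\<^sub>C T = a *\<^sub>C T + b *\<^sub>C T"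
    by transfer (auto intro!: blinfun_eqI simp: blinfun.add_left scaleC_add_left)
  show "a *\<^sub>C b *\<^sub>C T = (a * b) *\<^sub>C T"
    by transfer (auto intro!: blinfun_eqI simp: scaleC_scaleC)
  show "1 *\<^sub>C T = T"
    by transfer (auto intro!: blinfun_eqI simp: scaleC_one)
  show "r *\<^sub>R T = complex_of_real r *\<^sub>C T"
    by transfer (auto intro!: blinfun_eqI simp: blinfun.scaleR_left scaleR_scaleC)
  show "dist S T = norm (S - T)" by (rule dist_cblinfun_def)
  show "sgn T = inverse (norm T) *\<^sub>R T" by (rule sgn_cblinfun_def)
  show "uniformity = (INF e\<in>{0<..}. principal {(x, y :: 'a \<Rightarrow>\<^sub>C\<^sub>L 'b). dist x y < e})"
    by (rule uniformity_cblinfun_def)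
  show "open X = (\<forall>x\<in>X. \<forall>\<^sub>F (x', y) in uniformity. x' = x \<longrightarrow> y \<in> X)"
    for X :: "('a \<Rightarrow>\<^sub>C\<^sub>L 'b) set"
    by (rule open_cblinfun_def)
  show "norm T = 0 \<longleftrightarrow> T = 0" by transfer simp
  show "norm (S + T) \<le> norm S + norm T" by transfer (rule norm_triangle_ineq)
  show "norm (r *\<^sub>R T) = \<bar>r\<bar> * norm T" by transfer simp
  show "norm (a *\<^sub>C T) = cmod a * norm T"
  proof transfer
    fix a and f :: "'a \<Rightarrow>\<^sub>L 'b"
    have le: "norm (scaleC_blinfun c g) \<le> cmod c * norm g"
      for c and g :: "'a \<Rightarrow>\<^sub>L 'b"
      by (rule norm_blinfun_bound)
        (simp_all add: norm_scaleC mult.assoc mult_left_mono norm_blinfun)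
    let ?g = "scaleC_blinfun a f"
    have "norm f \<le> norm ?g / cmod a" if "a \<noteq> 0"
    proof (rule norm_blinfun_bound)
      show "norm (blinfun_apply f x) \<le> norm ?g / cmod a * norm x" for x
        using norm_blinfun[of ?g x] that
        by (simp add: norm_scaleC field_simps)
    qed simp
    then show "norm ?g = cmod a * norm f"
      using le[of a f] by (cases "a = 0") (auto simp: field_simps)
  qed
qed

end

lift_definition id_cblinfun :: "'a::complex_normed_vector \<Rightarrow>\<^sub>C\<^sub>L 'a" is id_blinfun
  by simp

lift_definition cblinfun_compose ::
  "'b::complex_normed_vector \<Rightarrow>\<^sub>C\<^sub>L 'c::complex_normed_vector \<Rightarrow>
   'a::complex_normed_vector \<Rightarrow>\<^sub>C\<^sub>L 'b \<Rightarrow> 'a \<Rightarrow>\<^sub>C\<^sub>L 'c" (infixl \<open>o\<^sub>C\<^sub>L\<close> 67)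
  is blinfun_compose
  by simp

lemma cblinfun_eqI: "(\<And>x. S *\<^sub>V x = T *\<^sub>V x) \<Longrightarrow> S = T"
  by transfer (rule blinfun_eqI)

lemma cblinfun_apply_simps [simp]:
  "(S + T) *\<^sub>V x = S *\<^sub>V x + T *\<^sub>V x"
  "(S - T) *\<^sub>V x = S *\<^sub>V x - T *\<^sub>V x"
  "(- T) *\<^sub>V x = - (T *\<^sub>V x)"
  "0 *\<^sub>V x = 0"
  "(c *\<^sub>C T) *\<^sub>V x = c *\<^sub>C (T *\<^sub>V x)"
  "id_cblinfun *\<^sub>V x = x"
  "(P o\<^sub>C\<^sub>L T) *\<^sub>V x = P *\<^sub>V (T *\<^sub>V x)"
  by (transfer; simp add: blinfun.add_left blinfun.diff_left blinfun.minus_left)+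

definition invertible_cblinfun ::
    "'a::complex_normed_vector \<Rightarrow>\<^sub>C\<^sub>L 'b::complex_normed_vector \<Rightarrow> bool"
  where "invertible_cblinfun T \<longleftrightarrow> (\<exists>S. S o\<^sub>C\<^sub>L T = id_cblinfun \<and> T o\<^sub>C\<^sub>L S = id_cblinfun)"

text \<open>Meaningful only for invertible operators.\<close>

definition inverse_cblinfun ::
    "'a::complex_normed_vector \<Rightarrow>\<^sub>C\<^sub>L 'b::complex_normed_vector \<Rightarrow> 'b \<Rightarrow>\<^sub>C\<^sub>L 'a"
  where "inverse_cblinfun T = (THE S. S o\<^sub>C\<^sub>L T = id_cblinfun \<and> T o\<^sub>C\<^sub>L S = id_cblinfun)"

lemma inverse_cblinfun_eqI:
  assumes "S o\<^sub>C\<^sub>L T = id_cblinfun" and "T o\<^sub>C\<^sub>L S = id_cblinfun"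
  shows "inverse_cblinfun T = S"
  unfolding inverse_cblinfun_def
proof (rule the_equality)
  fix S'
  assume S': "S' o\<^sub>C\<^sub>L T = id_cblinfun \<and> T o\<^sub>C\<^sub>L S' = id_cblinfun"
  show "S' = S"
  proof (rule cblinfun_eqI)
    fix x
    have "S' *\<^sub>V x = (S' o\<^sub>C\<^sub>L T) *\<^sub>V (S *\<^sub>V x)"
      using arg_cong[OF assms(2), of "\<lambda>U. U *\<^sub>V x"] by simp
    then show "S' *\<^sub>V x = S *\<^sub>V x"
      using S' by simp
  qed
qed (use assms in simp)


section \<open>Spectrum and dichotomy\<close>

definition spectrum :: "'a::complex_normed_vector \<Rightarrow>\<^sub>C\<^sub>L 'a \<Rightarrow> complex set"
  where "spectrum A = {z. \<not> invertible_cblinfun (z *\<^sub>C id_cblinfun - A)}"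

definition dichotomous :: "'a::complex_normed_vector \<Rightarrow>\<^sub>C\<^sub>L 'a \<Rightarrow> bool"
  where "dichotomous A \<longleftrightarrow> spectrum A \<inter> sphere 0 1 = {}"

text \<open>The set \<open>\<rho>(A)\<^sup>-\<^sup>1 \<union> {0}\<close>.\<close>

definition inv_resolvent_set0 :: "'a::complex_normed_vector \<Rightarrow>\<^sub>C\<^sub>L 'a \<Rightarrow> complex set"
  where "inv_resolvent_set0 A = {z. invertible_cblinfun (id_cblinfun - z *\<^sub>C A)}"

text \<open>The contour integral \<open>(1 / (2 \<pi> \<i>)) \<integral> (z I - A)\<^sup>-\<^sup>1 dz\<close> over the counterclockwise unit circle,
  written out in the parametrization \<open>z = cis t\<close>, \<open>dz = \<i> * cis t dt\<close>; the library's
  contour integral is restricted to complex-valued integrands.\<close>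

definition spectral_projection :: "'a::complex_normed_vector \<Rightarrow>\<^sub>C\<^sub>L 'a \<Rightarrow> 'a \<Rightarrow>\<^sub>C\<^sub>L 'a"
  where "spectral_projection A =
    (1 / (2 * of_real pi * \<i>)) *\<^sub>C
      integral {0..2 * pi} (\<lambda>t. (\<i> * cis t) *\<^sub>C inverse_cblinfun (cis t *\<^sub>C id_cblinfun - A))"

text \<open>The two members of the dichotomous pair of a dichotomous operator \<open>A\<close>.\<close>

definition dich_plus :: "'a::complex_normed_vector \<Rightarrow>\<^sub>C\<^sub>L 'a \<Rightarrow> 'a set"
  where "dich_plus A = range (\<lambda>x. spectral_projection A *\<^sub>V x)"

definition dich_minus :: "'a::complex_normed_vector \<Rightarrow>\<^sub>C\<^sub>L 'a \<Rightarrow> 'a set"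
  where "dich_minus A = {x. spectral_projection A *\<^sub>V x = 0}"


section \<open>Direct sums and projections\<close>

definition closed_csubspace :: "'a::complex_normed_vector set \<Rightarrow> bool"
  where "closed_csubspace M \<longleftrightarrow>
    closed M \<and> 0 \<in> M \<and> (\<forall>x\<in>M. \<forall>y\<in>M. x + y \<in> M) \<and> (\<forall>c. \<forall>x\<in>M. c *\<^sub>C x \<in> M)"

text \<open>The whole space is the (not necessarily orthogonal) direct sum of \<open>M\<close> and \<open>N\<close>.\<close>

definition direct_sum_decomp :: "'a::complex_normed_vector set \<Rightarrow> 'a set \<Rightarrow> bool"
  where "direct_sum_decomp M N \<longleftrightarrow>
    closed_csubspace M \<and> closed_csubspace N \<and> M \<inter> N = {0} \<and> (\<forall>x. \<exists>m\<in>M. \<exists>n\<in>N. x = m + n)"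

definition is_projection_onto_along ::
    "'a::complex_normed_vector \<Rightarrow>\<^sub>C\<^sub>L 'a \<Rightarrow> 'a set \<Rightarrow> 'a set \<Rightarrow> bool"
  where "is_projection_onto_along P M N \<longleftrightarrow>
    P o\<^sub>C\<^sub>L P = P \<and> range (\<lambda>x. P *\<^sub>V x) = M \<and> {x. P *\<^sub>V x = 0} = N"


section \<open>Vector-valued functions of a complex variable\<close>

text \<open>For continuous \<open>F\<close> the supremum is the maximum over the circle.\<close>

definition circle_norm :: "(complex \<Rightarrow> 'b::complex_normed_vector) \<Rightarrow> real"
  where "circle_norm F = (SUP z\<in>sphere 0 1. norm (F z))"

definition vanalytic_on :: "(complex \<Rightarrow> 'b::complex_normed_vector) \<Rightarrow> complex set \<Rightarrow> bool"
  where "vanalytic_on f S \<longleftrightarrow>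
    (\<forall>z\<in>S. \<exists>D. ((\<lambda>w. inverse (w - z) *\<^sub>C (f w - f z)) \<longlongrightarrow> D) (at z))"

text \<open>\<open>f\<close>, given on \<open>W\<close>, extends analytically to a neighborhood of \<open>K\<close>.\<close>

definition extends_analytically ::
    "(complex \<Rightarrow> 'b::complex_normed_vector) \<Rightarrow> complex set \<Rightarrow> complex set \<Rightarrow> bool"
  where "extends_analytically f W K \<longleftrightarrow>
    (\<exists>S h. open S \<and> K \<subseteq> S \<and> vanalytic_on h S \<and> (\<forall>z\<in>S \<inter> W. h z = f z))"

end

theory Submission
  imports Defs
begin

text \<open>Everything is done in the time domain. The Fourier coefficients \<open>R n\<close> of
  \<open>t \<mapsto> (I - e\<^sup>-\<^sup>i\<^sup>t A)\<^sup>-\<^sup>1\<close> satisfy \<open>R n - A R (n - 1) = \<delta>\<close>, so \<open>R 0\<close> is the spectral projection,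
  \<open>R n = A\<^sup>n P\<close> for \<open>n \<ge> 0\<close>, and bounded orbits of \<open>A\<close> start in its stable subspace. Bessel's
  inequality makes both halves of \<open>R\<close> square summable semigroups, hence norm summable.

  Since \<open>\<parallel>F\<parallel> < 1\<close> on the circle, the Toeplitz operator \<open>T\<close> of \<open>F\<close> is a strict contraction for square
  sums and \<open>g + T g = \<phi>\<close> is uniquely solvable. For \<open>\<phi> n = C (R n x)\<close> the solution \<open>g\<close> is an input
  for which the bounded state sequence \<open>h\<close> of \<open>h (n + 1) = A h n - B g n\<close> satisfies \<open>C h n = (I + D) g n\<close>,
  that is, \<open>h\<close> is an orbit of the associate operator. Thus \<open>h 0\<close> is the component of \<open>x\<close> in its stable
  subspace along the unstable subspace of \<open>A\<close>, with a norm bound, so the projection is bounded without an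
  appeal to the closed graph theorem. Uniqueness for \<open>\<phi> = 0\<close> gives the trivial intersection.\<close>

text \<open>Nothing is deformed to another contour: the resolvent is controlled on the circle alone.
  What Cauchy's theorem would provide comes from the recursion for \<open>R\<close>, which moves
  powers of \<open>A\<close> from one factor of a product to the other, together with decay at
  infinity, which kills what remains. Two norms must be kept apart. The bound on \<open>F\<close>
  makes the Toeplitz operator contract square sums, but gives no contraction for suprema, while
  orbits and series are handled with suprema. Norm summability of \<open>R\<close> bridges the gap:
  it gives the operator a finite, possibly large, gain on bounded sequences, enough to pass to the
  limit in a series whose terms already decay geometrically. The factorization then needs only
  algebra. The kernel of the projection \<Pi> onto the stable subspace of \<open>Ax\<close> is
  invariant under \<open>I - z A\<close> and its range under \<open>I - z Ax\<close>, so quadratic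
  terms in the products collapse to linear ones. As \<Pi> has the same kernel as the spectral
  projection of \<open>A\<close> and the same range as that of \<open>Ax\<close>, each factor and
  each inverse sees just the half of a resolvent that extends across the required region.\<close>

lemmas scaleC_simps = scaleC_add_right scaleC_add_left scaleC_diff_right scaleC_minus_right
  scaleC_scaleC scaleC_one

lemma scaleC_zero_left [simp]: "0 *\<^sub>C (x :: 'a::complex_vector) = 0"
  using scaleC_add_left[of 0 0 x] by simp

lemma scaleC_minus_left: "(- a) *\<^sub>C (x :: 'a::complex_vector) = - (a *\<^sub>C x)"
  using scaleC_add_left[of a "- a" x] by (simp add: eq_neg_iff_add_eq_0 add.commute)

lemma scaleC_diff_left: "(a - b) *\<^sub>C (x :: 'a::complex_vector) = a *\<^sub>C x - b *\<^sub>C x"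
  using scaleC_add_left[of a "- b" x] by (simp add: scaleC_minus_left)

lemma scaleC_sum_right:
  "c *\<^sub>C (\<Sum>i\<in>I. f i) = (\<Sum>i\<in>I. c *\<^sub>C (f i :: 'a::complex_normed_vector))"
  by (rule bounded_linear.linear[OF bounded_linear_scaleC, THEN linear_sum])

lemma bounded_bilinear_scaleC:
  "bounded_bilinear ((*\<^sub>C) :: complex \<Rightarrow> 'a::complex_normed_vector \<Rightarrow> 'a)"
proof
  fix r :: real and a :: complex and x :: 'a
  show "(r *\<^sub>R a) *\<^sub>C x = r *\<^sub>R (a *\<^sub>C x)" "a *\<^sub>C (r *\<^sub>R x) = r *\<^sub>R (a *\<^sub>C x)"
    by (simp_all add: scaleR_scaleC scaleC_scaleC scaleR_conv_of_real scaleC_complex_def mult.commute)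
  show "\<exists>K. \<forall>a (b :: 'a). norm (a *\<^sub>C b) \<le> norm a * norm b * K"
    by (rule exI[of _ 1]) (simp add: norm_scaleC)
qed (simp_all add: scaleC_simps)

lemmas tendsto_scaleC [tendsto_intros] = bounded_bilinear.tendsto[OF bounded_bilinear_scaleC]
lemmas continuous_on_scaleC [continuous_intros] =
  bounded_bilinear.continuous_on[OF bounded_bilinear_scaleC]

section \<open>The Banach space of operators\<close>

lemma cblinfun_apply_scaleC_right [simp]: "T *\<^sub>V (c *\<^sub>C x) = c *\<^sub>C (T *\<^sub>V x)"
  by transfer simp

lemma norm_cblinfun: "norm (T *\<^sub>V x) \<le> norm T * norm x"
  by transfer (rule norm_blinfun)

lemma norm_cblinfun_bound: "0 \<le> b \<Longrightarrow> (\<And>x. norm (T *\<^sub>V x) \<le> b * norm x) \<Longrightarrow> norm T \<le> b"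
  by transfer (rule norm_blinfun_bound)

lemma bounded_bilinear_cblinfun_apply:
  "bounded_bilinear ((*\<^sub>V) :: ('a::complex_normed_vector \<Rightarrow>\<^sub>C\<^sub>L 'b::complex_normed_vector) \<Rightarrow> 'a \<Rightarrow> 'b)"
proof
  fix S T :: "'a \<Rightarrow>\<^sub>C\<^sub>L 'b" and x y :: 'a and r :: real
  show "T *\<^sub>V (x + y) = T *\<^sub>V x + T *\<^sub>V y" by transfer (simp add: blinfun.add_right)
  show "(r *\<^sub>R T) *\<^sub>V x = r *\<^sub>R (T *\<^sub>V x)" "T *\<^sub>V (r *\<^sub>R x) = r *\<^sub>R (T *\<^sub>V x)"
    by (simp_all add: scaleR_scaleC)
  show "\<exists>K. \<forall>T (x :: 'a). norm (T *\<^sub>V x :: 'b) \<le> norm T * norm x * K"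
    by (rule exI[of _ 1]) (simp add: norm_cblinfun)
qed simp

lemmas cblinfun_add_right = bounded_bilinear.add_right[OF bounded_bilinear_cblinfun_apply]
  and cblinfun_diff_right = bounded_bilinear.diff_right[OF bounded_bilinear_cblinfun_apply]
  and cblinfun_minus_right = bounded_bilinear.minus_right[OF bounded_bilinear_cblinfun_apply]
  and cblinfun_zero_right [simp] = bounded_bilinear.zero_right[OF bounded_bilinear_cblinfun_apply]
  and cblinfun_sum_right = bounded_bilinear.sum_right[OF bounded_bilinear_cblinfun_apply]
  and bounded_linear_cblinfun_right = bounded_bilinear.bounded_linear_right[OF bounded_bilinear_cblinfun_apply]
  and bounded_linear_cblinfun_left = bounded_bilinear.bounded_linear_left[OF bounded_bilinear_cblinfun_apply]
  and tendsto_cblinfun_apply [tendsto_intros] = bounded_bilinear.tendsto[OF bounded_bilinear_cblinfun_apply]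
  and continuous_on_cblinfun_apply [continuous_intros] =
    bounded_bilinear.continuous_on[OF bounded_bilinear_cblinfun_apply]

lemma norm_cblinfun_compose: "norm (S o\<^sub>C\<^sub>L T) \<le> norm S * norm T"
  by transfer (rule norm_blinfun_compose)

lemma bounded_bilinear_cblinfun_compose:
  "bounded_bilinear ((o\<^sub>C\<^sub>L) :: ('b::complex_normed_vector \<Rightarrow>\<^sub>C\<^sub>L 'c::complex_normed_vector) \<Rightarrow>
    ('a::complex_normed_vector \<Rightarrow>\<^sub>C\<^sub>L 'b) \<Rightarrow> 'a \<Rightarrow>\<^sub>C\<^sub>L 'c)"
proof
  fix S S' :: "'b \<Rightarrow>\<^sub>C\<^sub>L 'c" and T T' :: "'a \<Rightarrow>\<^sub>C\<^sub>L 'b" and r :: real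
  show "(S + S') o\<^sub>C\<^sub>L T = S o\<^sub>C\<^sub>L T + S' o\<^sub>C\<^sub>L T" "S o\<^sub>C\<^sub>L (T + T') = S o\<^sub>C\<^sub>L T + S o\<^sub>C\<^sub>L T'"
    by (rule cblinfun_eqI, simp add: cblinfun_add_right)+
  show "(r *\<^sub>R S) o\<^sub>C\<^sub>L T = r *\<^sub>R (S o\<^sub>C\<^sub>L T)" "S o\<^sub>C\<^sub>L (r *\<^sub>R T) = r *\<^sub>R (S o\<^sub>C\<^sub>L T)"
    by (rule cblinfun_eqI, simp add: scaleR_scaleC)+
  show "\<exists>K. \<forall>S (T :: 'a \<Rightarrow>\<^sub>C\<^sub>L 'b). norm (S o\<^sub>C\<^sub>L T :: 'a \<Rightarrow>\<^sub>C\<^sub>L 'c) \<le> norm S * norm T * K"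
    by (rule exI[of _ 1]) (simp add: norm_cblinfun_compose)
qed

lemmas compose_add_left = bounded_bilinear.add_left[OF bounded_bilinear_cblinfun_compose]
  and compose_add_right = bounded_bilinear.add_right[OF bounded_bilinear_cblinfun_compose]
  and compose_diff_left = bounded_bilinear.diff_left[OF bounded_bilinear_cblinfun_compose]
  and compose_diff_right = bounded_bilinear.diff_right[OF bounded_bilinear_cblinfun_compose]
  and compose_minus_left = bounded_bilinear.minus_left[OF bounded_bilinear_cblinfun_compose]
  and compose_minus_right = bounded_bilinear.minus_right[OF bounded_bilinear_cblinfun_compose]
  and compose_zero_left [simp] = bounded_bilinear.zero_left[OF bounded_bilinear_cblinfun_compose]
  and compose_zero_right [simp] = bounded_bilinear.zero_right[OF bounded_bilinear_cblinfun_compose]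
  and bounded_linear_compose_right = bounded_bilinear.bounded_linear_right[OF bounded_bilinear_cblinfun_compose]
  and bounded_linear_compose_left = bounded_bilinear.bounded_linear_left[OF bounded_bilinear_cblinfun_compose]
  and tendsto_cblinfun_compose [tendsto_intros] = bounded_bilinear.tendsto[OF bounded_bilinear_cblinfun_compose]
  and continuous_on_cblinfun_compose [continuous_intros] =
    bounded_bilinear.continuous_on[OF bounded_bilinear_cblinfun_compose]

lemma compose_scaleC_left [simp]: "(c *\<^sub>C S) o\<^sub>C\<^sub>L T = c *\<^sub>C (S o\<^sub>C\<^sub>L T)"
  by (rule cblinfun_eqI) simp

lemma compose_scaleC_right [simp]: "S o\<^sub>C\<^sub>L (c *\<^sub>C T) = c *\<^sub>C (S o\<^sub>C\<^sub>L T)"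
  by (rule cblinfun_eqI) simp

lemma compose_id_left [simp]: "id_cblinfun o\<^sub>C\<^sub>L T = T"
  by (rule cblinfun_eqI) simp

lemma compose_id_right [simp]: "T o\<^sub>C\<^sub>L id_cblinfun = T"
  by (rule cblinfun_eqI) simp

lemma compose_assoc: "(S o\<^sub>C\<^sub>L T) o\<^sub>C\<^sub>L U = S o\<^sub>C\<^sub>L (T o\<^sub>C\<^sub>L U)"
  by (rule cblinfun_eqI) simp

lemmas compose_distribs = compose_add_left compose_add_right compose_diff_left compose_diff_right
  compose_minus_left compose_minus_right

text \<open>Complex linearity survives pointwise limits, so these operators form a closed subspace
  of the complete space of real-linear ones. Completeness is what makes operator-valued integrals
  and fixed points available.\<close>

instance cblinfun :: (complex_normed_vector, "{complex_normed_vector,banach}") banach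
proof
  fix X :: "nat \<Rightarrow> 'a \<Rightarrow>\<^sub>C\<^sub>L 'b"
  assume "Cauchy X"
  have norm_diff: "norm (blinfun_of_cblinfun S - blinfun_of_cblinfun T) = norm (S - T)"
    for S T :: "'a \<Rightarrow>\<^sub>C\<^sub>L 'b"
    by transfer simp
  have "Cauchy (\<lambda>n. blinfun_of_cblinfun (X n))"
    using \<open>Cauchy X\<close> by (simp add: Cauchy_def dist_norm norm_diff)
  then obtain L where L: "(\<lambda>n. blinfun_of_cblinfun (X n)) \<longlonglongrightarrow> L"
    using Cauchy_convergent convergent_def by blast
  have app: "(\<lambda>n. X n *\<^sub>V x) \<longlonglongrightarrow> blinfun_apply L x" for x
    using blinfun.tendsto[OF L tendsto_const[of x]] by (simp add: cblinfun_apply.rep_eq)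
  have "blinfun_apply L (c *\<^sub>C x) = c *\<^sub>C blinfun_apply L x" for c x
    using LIMSEQ_unique[OF app[of "c *\<^sub>C x"]] tendsto_scaleC[OF tendsto_const app, of c x] by simp
  then obtain T where T: "blinfun_of_cblinfun T = L"
    using CBlinfun_inverse[of L] by auto
  have "X \<longlonglongrightarrow> T"
    using L unfolding T[symmetric] by (simp add: LIMSEQ_iff norm_diff)
  then show "convergent X"
    by (auto simp: convergent_def)
qed

section \<open>Invertible operators\<close>

lemma invertible_cblinfunI: "S o\<^sub>C\<^sub>L T = id_cblinfun \<Longrightarrow> T o\<^sub>C\<^sub>L S = id_cblinfun \<Longrightarrow> invertible_cblinfun T"
  unfolding invertible_cblinfun_def by blast

lemma inverse_cblinfun:
  assumes "invertible_cblinfun T"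
  shows "inverse_cblinfun T o\<^sub>C\<^sub>L T = id_cblinfun" "T o\<^sub>C\<^sub>L inverse_cblinfun T = id_cblinfun"
  using assms inverse_cblinfun_eqI unfolding invertible_cblinfun_def by metis+

lemma left_right_inverse_eq:
  assumes "S o\<^sub>C\<^sub>L T = id_cblinfun" and "T o\<^sub>C\<^sub>L U = id_cblinfun"
  shows "S = U"
  using compose_assoc[of S T U] assms by simp

lemma invertible_cblinfunI':
  assumes "S o\<^sub>C\<^sub>L T = id_cblinfun" and "T o\<^sub>C\<^sub>L U = id_cblinfun"
  shows "invertible_cblinfun T"
  using assms left_right_inverse_eq[OF assms] by (auto intro: invertible_cblinfunI)

lemma inverse_cancel:
  assumes "invertible_cblinfun T"
  shows "inverse_cblinfun T o\<^sub>C\<^sub>L (T o\<^sub>C\<^sub>L U) = U" "T o\<^sub>C\<^sub>L (inverse_cblinfun T o\<^sub>C\<^sub>L V) = V"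
    "inverse_cblinfun T *\<^sub>V (T *\<^sub>V x) = x" "T *\<^sub>V (inverse_cblinfun T *\<^sub>V y) = y"
  using inverse_cblinfun[OF assms]
  by (simp_all add: compose_assoc[symmetric] cblinfun_apply_simps(7)[symmetric]
      del: cblinfun_apply_simps(7))

lemma inverse_commute:
  assumes "invertible_cblinfun T" and "S o\<^sub>C\<^sub>L T = T o\<^sub>C\<^sub>L S"
  shows "S o\<^sub>C\<^sub>L inverse_cblinfun T = inverse_cblinfun T o\<^sub>C\<^sub>L S"
proof -
  have "inverse_cblinfun T o\<^sub>C\<^sub>L (T o\<^sub>C\<^sub>L S) o\<^sub>C\<^sub>L inverse_cblinfun T
      = inverse_cblinfun T o\<^sub>C\<^sub>L (S o\<^sub>C\<^sub>L T) o\<^sub>C\<^sub>L inverse_cblinfun T"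
    by (simp add: assms(2))
  then show ?thesis
    by (simp add: compose_assoc inverse_cancel[OF assms(1)] inverse_cblinfun[OF assms(1)])
qed

text \<open>A one-sided inverse of \<open>S\<close> is read off from each order of the product;
  commutation supplies the second order. It is applied to a truncated geometric series.\<close>

lemma invertible_commuting_factor:
  assumes "invertible_cblinfun (S o\<^sub>C\<^sub>L T)" and "S o\<^sub>C\<^sub>L T = T o\<^sub>C\<^sub>L S"
  shows "invertible_cblinfun S"
proof (rule invertible_cblinfunI')
  show "(inverse_cblinfun (S o\<^sub>C\<^sub>L T) o\<^sub>C\<^sub>L T) o\<^sub>C\<^sub>L S = id_cblinfun"
    using inverse_cblinfun(1)[OF assms(1)] by (simp only: compose_assoc assms(2))
  show "S o\<^sub>C\<^sub>L (T o\<^sub>C\<^sub>L inverse_cblinfun (S o\<^sub>C\<^sub>L T)) = id_cblinfun"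
    using inverse_cblinfun(2)[OF assms(1)] by (simp add: compose_assoc)
qed

lemma invertible_compose:
  assumes "invertible_cblinfun S" and "invertible_cblinfun T"
  shows "invertible_cblinfun (S o\<^sub>C\<^sub>L T)"
    "inverse_cblinfun (S o\<^sub>C\<^sub>L T) = inverse_cblinfun T o\<^sub>C\<^sub>L inverse_cblinfun S"
proof -
  have "(inverse_cblinfun T o\<^sub>C\<^sub>L inverse_cblinfun S) o\<^sub>C\<^sub>L (S o\<^sub>C\<^sub>L T) = id_cblinfun"
    "(S o\<^sub>C\<^sub>L T) o\<^sub>C\<^sub>L (inverse_cblinfun T o\<^sub>C\<^sub>L inverse_cblinfun S) = id_cblinfun"
    by (simp_all add: compose_assoc inverse_cancel assms inverse_cblinfun)
  then show "invertible_cblinfun (S o\<^sub>C\<^sub>L T)"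
    "inverse_cblinfun (S o\<^sub>C\<^sub>L T) = inverse_cblinfun T o\<^sub>C\<^sub>L inverse_cblinfun S"
    by (auto intro: invertible_cblinfunI inverse_cblinfun_eqI)
qed

lemma invertible_scaleC:
  assumes "c \<noteq> 0"
  shows "invertible_cblinfun (c *\<^sub>C T) \<longleftrightarrow> invertible_cblinfun T"
proof -
  have scale: "invertible_cblinfun (a *\<^sub>C T)"
    if "invertible_cblinfun T" "a \<noteq> 0" for a and T :: "'a \<Rightarrow>\<^sub>C\<^sub>L 'b"
    using that by (intro invertible_cblinfunI[of "inverse a *\<^sub>C inverse_cblinfun T"])
      (simp_all add: inverse_cblinfun scaleC_scaleC scaleC_one)
  show ?thesis
    using scale[of T c] scale[of "c *\<^sub>C T" "inverse c"] assms
    by (auto simp: scaleC_scaleC scaleC_one)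
qed

lemma inverse_scaleC:
  assumes "c \<noteq> 0" and "invertible_cblinfun T"
  shows "inverse_cblinfun (c *\<^sub>C T) = inverse c *\<^sub>C inverse_cblinfun T"
  using assms by (intro inverse_cblinfun_eqI) (simp_all add: inverse_cblinfun scaleC_scaleC scaleC_one)

text \<open>Sylvester's identity: \<open>I - X (I + Y X)\<^sup>-\<^sup>1 Y\<close> is the inverse of \<open>I + X Y\<close>.\<close>

lemma invertible_id_plus_swap:
  assumes "invertible_cblinfun (id_cblinfun + Y o\<^sub>C\<^sub>L X)"
  shows "invertible_cblinfun (id_cblinfun + X o\<^sub>C\<^sub>L Y)"
proof -
  define S where "S = inverse_cblinfun (id_cblinfun + Y o\<^sub>C\<^sub>L X)"
  have S: "S + S o\<^sub>C\<^sub>L (Y o\<^sub>C\<^sub>L X) = id_cblinfun" "S + Y o\<^sub>C\<^sub>L (X o\<^sub>C\<^sub>L S) = id_cblinfun"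
    using inverse_cblinfun[OF assms] by (simp_all add: S_def compose_distribs compose_assoc)
  have "X o\<^sub>C\<^sub>L ((S + S o\<^sub>C\<^sub>L (Y o\<^sub>C\<^sub>L X)) o\<^sub>C\<^sub>L Y) = X o\<^sub>C\<^sub>L Y"
    "X o\<^sub>C\<^sub>L ((S + Y o\<^sub>C\<^sub>L (X o\<^sub>C\<^sub>L S)) o\<^sub>C\<^sub>L Y) = X o\<^sub>C\<^sub>L Y"
    by (simp_all only: S compose_id_left)
  then show ?thesis
    by (intro invertible_cblinfunI[of "id_cblinfun - X o\<^sub>C\<^sub>L S o\<^sub>C\<^sub>L Y"])
      (simp_all add: compose_distribs compose_assoc algebra_simps)
qed

text \<open>A right and a left inverse are the fixed points of the contractions \<open>X\<close> to
  \<open>I + T X\<close> and \<open>Y\<close> to \<open>I + Y T\<close>.\<close>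

lemma invertible_id_minus:
  fixes T :: "'a::{complex_normed_vector,banach} \<Rightarrow>\<^sub>C\<^sub>L 'a"
  assumes "norm T < 1"
  shows "invertible_cblinfun (id_cblinfun - T)"
proof -
  have "\<exists>!X. id_cblinfun + T o\<^sub>C\<^sub>L X = X"
    using assms by (intro banach_fix_type[of "norm T"])
      (simp_all add: dist_norm compose_diff_right[symmetric] norm_cblinfun_compose)
  then obtain X where "id_cblinfun + T o\<^sub>C\<^sub>L X = X" by blast
  then have X: "(id_cblinfun - T) o\<^sub>C\<^sub>L X = id_cblinfun"
    by (simp add: compose_diff_left algebra_simps)
  have "\<exists>!Y. id_cblinfun + Y o\<^sub>C\<^sub>L T = Y"
    using assms norm_cblinfun_compose[of _ T] by (intro banach_fix_type[of "norm T"])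
      (auto simp: dist_norm compose_diff_left[symmetric] mult.commute[of "norm T"])
  then obtain Y where "id_cblinfun + Y o\<^sub>C\<^sub>L T = Y" by blast
  then have "Y o\<^sub>C\<^sub>L (id_cblinfun - T) = id_cblinfun"
    by (simp add: compose_diff_right algebra_simps)
  then show ?thesis
    using X by (rule invertible_cblinfunI')
qed

lemma inverse_diff:
  assumes "invertible_cblinfun S" and "invertible_cblinfun T"
  shows "inverse_cblinfun T - inverse_cblinfun S = inverse_cblinfun T o\<^sub>C\<^sub>L ((S - T) o\<^sub>C\<^sub>L inverse_cblinfun S)"
  by (simp add: compose_distribs inverse_cblinfun[OF assms(1)] inverse_cancel[OF assms(2)])

text \<open>\<open>T = (I - (S - T) S^-1) S\<close>, and the first factor is a small perturbation of
  the identity. With the threshold 1/2, half of the norm of \<open>T^-1\<close> is absorbed in the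
  identity \<open>T^-1 - S^-1 = T^-1 (S - T) S^-1\<close>, whence the factor 2.\<close>

lemma invertible_perturb:
  fixes S T :: "'a::{complex_normed_vector,banach} \<Rightarrow>\<^sub>C\<^sub>L 'a"
  assumes S: "invertible_cblinfun S" and "norm (S - T) * norm (inverse_cblinfun S) \<le> 1/2"
  shows "invertible_cblinfun T" "norm (inverse_cblinfun T) \<le> 2 * norm (inverse_cblinfun S)"
    "norm (inverse_cblinfun T - inverse_cblinfun S) \<le> 2 * (norm (inverse_cblinfun S))\<^sup>2 * norm (S - T)"
proof -
  let ?S' = "inverse_cblinfun S" and ?T' = "inverse_cblinfun T"
  have le: "norm ((S - T) o\<^sub>C\<^sub>L ?S') \<le> 1/2"
    using assms(2) norm_cblinfun_compose[of "S - T" ?S'] by linarith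
  then have "invertible_cblinfun ((id_cblinfun - (S - T) o\<^sub>C\<^sub>L ?S') o\<^sub>C\<^sub>L S)"
    using S by (intro invertible_compose(1) invertible_id_minus) auto
  also have "(id_cblinfun - (S - T) o\<^sub>C\<^sub>L ?S') o\<^sub>C\<^sub>L S = T"
    by (simp add: compose_distribs compose_assoc inverse_cblinfun[OF S])
  finally show T: "invertible_cblinfun T" .
  note diff = inverse_diff[OF S T]
  have "norm (?T' - ?S') \<le> norm ?T' * (1/2)"
    unfolding diff by (intro order_trans[OF norm_cblinfun_compose] mult_left_mono le) simp
  then show T2: "norm ?T' \<le> 2 * norm ?S'"
    using norm_triangle_sub[of ?T' ?S'] by simp
  have "norm (?T' - ?S') \<le> (2 * norm ?S') * (norm (S - T) * norm ?S')"
    unfolding diff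
    by (intro order_trans[OF norm_cblinfun_compose] mult_mono T2 norm_cblinfun_compose) simp_all
  then show "norm (?T' - ?S') \<le> 2 * (norm ?S')\<^sup>2 * norm (S - T)"
    by (simp add: power2_eq_square mult_ac)
qed

lemma
  fixes T :: "'a::topological_space \<Rightarrow> 'b::{complex_normed_vector,banach} \<Rightarrow>\<^sub>C\<^sub>L 'b"
  assumes S: "invertible_cblinfun S" and lim: "(T \<longlongrightarrow> S) F"
  shows eventually_invertible: "\<forall>\<^sub>F x in F. invertible_cblinfun (T x)"
    and tendsto_inverse_cblinfun: "((\<lambda>x. inverse_cblinfun (T x)) \<longlongrightarrow> inverse_cblinfun S) F"
proof -
  have "((\<lambda>x. norm (S - T x) * norm (inverse_cblinfun S)) \<longlongrightarrow> norm (S - S) * norm (inverse_cblinfun S)) F"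
    by (intro tendsto_intros lim)
  then have ev: "\<forall>\<^sub>F x in F. norm (S - T x) * norm (inverse_cblinfun S) < 1/2"
    by (rule order_tendstoD) simp
  then show "\<forall>\<^sub>F x in F. invertible_cblinfun (T x)"
    by eventually_elim (auto intro: invertible_perturb(1)[OF S])
  have bound: "\<forall>\<^sub>F x in F. norm (inverse_cblinfun (T x) - inverse_cblinfun S)
      \<le> 2 * (norm (inverse_cblinfun S))\<^sup>2 * norm (S - T x)"
    using ev by eventually_elim (simp add: invertible_perturb(3)[OF S])
  have "((\<lambda>x. 2 * (norm (inverse_cblinfun S))\<^sup>2 * norm (S - T x)) \<longlongrightarrow>
      2 * (norm (inverse_cblinfun S))\<^sup>2 * norm (S - S)) F"
    by (intro tendsto_intros lim)
  then have "((\<lambda>x. inverse_cblinfun (T x) - inverse_cblinfun S) \<longlongrightarrow> 0) F"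
    by (intro Lim_null_comparison[OF bound]) simp
  then show "((\<lambda>x. inverse_cblinfun (T x)) \<longlongrightarrow> inverse_cblinfun S) F"
    by (rule LIM_zero_cancel)
qed

lemma continuous_on_inverse_cblinfun [continuous_intros]:
  fixes T :: "'a::topological_space \<Rightarrow> 'b::{complex_normed_vector,banach} \<Rightarrow>\<^sub>C\<^sub>L 'b"
  assumes "continuous_on X T" and "\<And>x. x \<in> X \<Longrightarrow> invertible_cblinfun (T x)"
  shows "continuous_on X (\<lambda>x. inverse_cblinfun (T x))"
  using assms by (auto simp: continuous_on_def intro: tendsto_inverse_cblinfun)

section \<open>Analytic functions\<close>

lemma vanalytic_on_imp_tendsto:
  assumes "vanalytic_on f S" and "z \<in> S"
  shows "(f \<longlongrightarrow> f z) (at z)"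
proof -
  obtain D where D: "((\<lambda>w. inverse (w - z) *\<^sub>C (f w - f z)) \<longlongrightarrow> D) (at z)"
    using assms unfolding vanalytic_on_def by blast
  have "((\<lambda>w. (w - z) *\<^sub>C (inverse (w - z) *\<^sub>C (f w - f z))) \<longlongrightarrow> (z - z) *\<^sub>C D) (at z)"
    by (intro tendsto_intros D)
  moreover have "\<forall>\<^sub>F w in at z. (w - z) *\<^sub>C (inverse (w - z) *\<^sub>C (f w - f z)) = f w - f z"
    using eventually_neq_at_within[of z] by eventually_elim (simp add: scaleC_scaleC scaleC_one)
  ultimately have "((\<lambda>w. f w - f z) \<longlongrightarrow> (z - z) *\<^sub>C D) (at z)"
    by (rule Lim_transform_eventually)
  then show ?thesis
    by (rule LIM_zero_cancel[OF tendsto_eq_rhs]) simp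
qed

lemma vanalytic_on_scaleC_ident:
  assumes f: "vanalytic_on f S"
  shows "vanalytic_on (\<lambda>z. z *\<^sub>C f z) S"
  unfolding vanalytic_on_def
proof
  fix z assume z: "z \<in> S"
  then obtain D where D: "((\<lambda>w. inverse (w - z) *\<^sub>C (f w - f z)) \<longlongrightarrow> D) (at z)"
    using f unfolding vanalytic_on_def by blast
  have "((\<lambda>w. f w + z *\<^sub>C (inverse (w - z) *\<^sub>C (f w - f z))) \<longlongrightarrow> f z + z *\<^sub>C D) (at z)"
    by (intro tendsto_intros D vanalytic_on_imp_tendsto[OF f z])
  moreover have "\<forall>\<^sub>F w in at z. f w + z *\<^sub>C (inverse (w - z) *\<^sub>C (f w - f z)) =
      inverse (w - z) *\<^sub>C (w *\<^sub>C f w - z *\<^sub>C f z)"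
    using eventually_neq_at_within[of z]
  proof eventually_elim
    case (elim w)
    have "w *\<^sub>C f w - z *\<^sub>C f z = (w - z) *\<^sub>C f w + z *\<^sub>C (f w - f z)"
      by (simp add: scaleC_diff_left scaleC_diff_right)
    then show ?case
      using elim by (simp add: scaleC_add_right scaleC_scaleC scaleC_one mult.commute)
  qed
  ultimately show "\<exists>D. ((\<lambda>w. inverse (w - z) *\<^sub>C (w *\<^sub>C f w - z *\<^sub>C f z)) \<longlongrightarrow> D) (at z)"
    by (intro exI) (rule Lim_transform_eventually)
qed

lemma vanalytic_on_compose:
  assumes "vanalytic_on f S"
  shows "vanalytic_on (\<lambda>z. L o\<^sub>C\<^sub>L f z o\<^sub>C\<^sub>L R) S"
  unfolding vanalytic_on_def
proof
  fix z assume "z \<in> S"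
  then obtain D where D: "((\<lambda>w. inverse (w - z) *\<^sub>C (f w - f z)) \<longlongrightarrow> D) (at z)"
    using assms unfolding vanalytic_on_def by blast
  have "((\<lambda>w. L o\<^sub>C\<^sub>L (inverse (w - z) *\<^sub>C (f w - f z)) o\<^sub>C\<^sub>L R) \<longlongrightarrow> L o\<^sub>C\<^sub>L D o\<^sub>C\<^sub>L R) (at z)"
    by (intro tendsto_intros D)
  then show "\<exists>D. ((\<lambda>w. inverse (w - z) *\<^sub>C (L o\<^sub>C\<^sub>L f w o\<^sub>C\<^sub>L R - L o\<^sub>C\<^sub>L f z o\<^sub>C\<^sub>L R)) \<longlongrightarrow> D) (at z)"
    by (auto simp: compose_distribs)
qed

lemma vanalytic_on_const_add:
  "vanalytic_on f S \<Longrightarrow> vanalytic_on (\<lambda>z. c + f z) S"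
  unfolding vanalytic_on_def by simp

text \<open>With \<open>H z = (M + z N)^-1\<close>, the resolvent identity gives
  \<open>H w - H z = - (w - z) H w N H z\<close>, so the derivative is \<open>- H z N H z\<close>
  once \<open>H\<close> is continuous. The general pencil covers both \<open>I - z R 1\<close> and
  \<open>R (- 1) + z I\<close>, used for the two regions.\<close>

lemma
  fixes M N :: "'a::{complex_normed_vector,banach} \<Rightarrow>\<^sub>C\<^sub>L 'a"
  shows open_invertible_pencil: "open {z. invertible_cblinfun (M + z *\<^sub>C N)}" (is "open ?S")
    and vanalytic_on_inverse_pencil:
      "vanalytic_on (\<lambda>z. inverse_cblinfun (M + z *\<^sub>C N)) {z. invertible_cblinfun (M + z *\<^sub>C N)}"
proof -
  have lim: "((\<lambda>w. M + w *\<^sub>C N) \<longlongrightarrow> M + z *\<^sub>C N) (at z)" for z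
    by (intro tendsto_intros)
  have ev: "\<forall>\<^sub>F w in at z. invertible_cblinfun (M + w *\<^sub>C N)" if "z \<in> ?S" for z
    using that lim by (auto intro: eventually_invertible)
  show "open ?S"
    unfolding open_contains_ball
  proof
    fix z assume z: "z \<in> ?S"
    then obtain d where "d > 0" "\<And>w. w \<noteq> z \<Longrightarrow> dist w z < d \<Longrightarrow> invertible_cblinfun (M + w *\<^sub>C N)"
      using ev[OF z] unfolding eventually_at by auto
    then show "\<exists>e>0. ball z e \<subseteq> ?S"
      using z by (intro exI[of _ d]) (auto simp: dist_commute, metis)
  qed
  show "vanalytic_on (\<lambda>z. inverse_cblinfun (M + z *\<^sub>C N)) ?S"
    unfolding vanalytic_on_def
  proof
    fix z assume z: "z \<in> ?S"
    let ?H = "\<lambda>w. inverse_cblinfun (M + w *\<^sub>C N)"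
    have "((\<lambda>w. - (?H w o\<^sub>C\<^sub>L N o\<^sub>C\<^sub>L ?H z)) \<longlongrightarrow> - (?H z o\<^sub>C\<^sub>L N o\<^sub>C\<^sub>L ?H z)) (at z)"
      using z by (intro tendsto_intros tendsto_inverse_cblinfun lim) simp
    moreover have "\<forall>\<^sub>F w in at z. - (?H w o\<^sub>C\<^sub>L N o\<^sub>C\<^sub>L ?H z) = inverse (w - z) *\<^sub>C (?H w - ?H z)"
      using ev[OF z] eventually_neq_at_within[of z]
    proof eventually_elim
      case (elim w)
      have "?H w - ?H z = ?H w o\<^sub>C\<^sub>L (((M + z *\<^sub>C N) - (M + w *\<^sub>C N)) o\<^sub>C\<^sub>L ?H z)"
        using z elim by (intro inverse_diff) simp_all
      also have "(M + z *\<^sub>C N) - (M + w *\<^sub>C N) = - ((w - z) *\<^sub>C N)"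
        by (simp add: scaleC_diff_left)
      finally show ?case
        using elim by (simp add: compose_minus_left compose_minus_right compose_assoc
            scaleC_minus_right scaleC_scaleC scaleC_one)
    qed
    ultimately show "\<exists>D. ((\<lambda>w. inverse (w - z) *\<^sub>C (?H w - ?H z)) \<longlongrightarrow> D) (at z)"
      by (intro exI) (rule Lim_transform_eventually)
  qed
qed

section \<open>Means over the unit circle\<close>

text \<open>Normalised so that constants are reproduced; the same mean serves real, vector and
  operator valued integrands, which are related by pulling bounded linear maps out of it.\<close>

definition circle_mean :: "(real \<Rightarrow> 'a::real_normed_vector) \<Rightarrow> 'a"
  where "circle_mean f = (1 / (2 * pi)) *\<^sub>R integral {0..2 * pi} f"

lemma circle_mean_linear:
  fixes f :: "real \<Rightarrow> 'a::banach" and L :: "'a \<Rightarrow> 'b::banach"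
  assumes "bounded_linear L" and "continuous_on {0..2 * pi} f"
  shows "circle_mean (\<lambda>t. L (f t)) = L (circle_mean f)"
proof -
  have "integral {0..2 * pi} (L \<circ> f) = L (integral {0..2 * pi} f)"
    using assms by (intro integral_linear integrable_continuous_real)
  then show ?thesis
    unfolding circle_mean_def
    by (simp add: o_def linear_simps(5)[OF assms(1)])
qed

lemma
  fixes f g :: "real \<Rightarrow> 'a::banach"
  assumes "continuous_on {0..2 * pi} f" and "continuous_on {0..2 * pi} g"
  shows circle_mean_add: "circle_mean (\<lambda>t. f t + g t) = circle_mean f + circle_mean g"
    and circle_mean_diff: "circle_mean (\<lambda>t. f t - g t) = circle_mean f - circle_mean g"
  using assms
  by (simp_all add: circle_mean_def integral_add integral_diff integrable_continuous_real
      scaleR_add_right scaleR_diff_right)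

lemma circle_mean_sum:
  fixes f :: "'i \<Rightarrow> real \<Rightarrow> 'a::banach"
  assumes "finite I" and "\<And>i. i \<in> I \<Longrightarrow> continuous_on {0..2 * pi} (f i)"
  shows "circle_mean (\<lambda>t. \<Sum>i\<in>I. f i t) = (\<Sum>i\<in>I. circle_mean (f i))"
  using assms by (simp add: circle_mean_def integral_sum integrable_continuous_real scaleR_sum_right)

lemma circle_mean_cong: "(\<And>t. f t = g t) \<Longrightarrow> circle_mean f = circle_mean g"
  by presburger

lemma norm_circle_mean_le:
  fixes f :: "real \<Rightarrow> 'a::banach"
  assumes "continuous_on {0..2 * pi} f" and "\<And>t. t \<in> {0..2 * pi} \<Longrightarrow> norm (f t) \<le> K"
  shows "norm (circle_mean f) \<le> K"
  using integral_bound[OF _ assms] by (simp add: circle_mean_def field_simps)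

lemma circle_mean_mono:
  fixes f g :: "real \<Rightarrow> real"
  assumes "continuous_on {0..2 * pi} f" "continuous_on {0..2 * pi} g"
    and "\<And>t. t \<in> {0..2 * pi} \<Longrightarrow> f t \<le> g t"
  shows "circle_mean f \<le> circle_mean g"
  using integral_le[of f "{0..2 * pi}" g] assms
  by (simp add: circle_mean_def integrable_continuous_real divide_right_mono)

lemma circle_mean_cis: "circle_mean (\<lambda>t. cis (of_int n * t)) = (if n = 0 then 1 else 0)"
proof (cases "n = 0")
  case False
  have "((\<lambda>t. cis (of_int n * t)) has_integral
      (cis (of_int n * (2 * pi)) / (\<i> * of_int n) - cis (of_int n * 0) / (\<i> * of_int n))) {0..2 * pi}"
  proof (rule fundamental_theorem_of_calculus)
    fix t :: real
    have "((\<lambda>t. cis (of_int n * t)) has_derivative (\<lambda>h. (of_int n * h) *\<^sub>R (\<i> * cis (of_int n * t))))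
        (at t within {0..2 * pi})"
      by (auto intro!: derivative_eq_intros)
    then have "((\<lambda>t. cis (of_int n * t)) has_vector_derivative \<i> * of_int n * cis (of_int n * t))
        (at t within {0..2 * pi})"
      unfolding has_vector_derivative_def
      by (rule has_derivative_eq_rhs) (auto simp: fun_eq_iff scaleR_conv_of_real)
    from has_vector_derivative_divide[OF this, of "\<i> * of_int n"]
    show "((\<lambda>t. cis (of_int n * t) / (\<i> * of_int n)) has_vector_derivative cis (of_int n * t))
        (at t within {0..2 * pi})"
      using False by simp
  qed simp
  moreover have "cis (of_int n * (2 * pi)) = 1"
    using cis_multiple_2pi[of "of_int n"] by (simp add: mult_ac)
  ultimately show ?thesis
    using False by (simp add: circle_mean_def integral_unique)
qed (simp add: circle_mean_def scaleR_conv_of_real)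

lemma continuous_on_cis_mult [continuous_intros]: "continuous_on S (\<lambda>t. cis (a * t))"
  by (intro continuous_intros)

section \<open>Parseval's identity and Bessel's inequality\<close>

lemma cinner_add_left: "cinner (x + y) z = cinner x z + cinner y (z :: 'a::complex_inner)"
  using cinner_commute[of "x + y" z] cinner_commute[of x z] cinner_commute[of y z]
  by (simp add: cinner_add_right)

lemma cinner_scaleC_left: "cinner (a *\<^sub>C x) y = cnj a * cinner x (y :: 'a::complex_inner)"
  using cinner_commute[of "a *\<^sub>C x" y] cinner_commute[of x y] by (simp add: cinner_scaleC_right)

lemma cinner_zero_left [simp]: "cinner 0 (y :: 'a::complex_inner) = 0"
  using cinner_add_left[of 0 0 y] by simp

lemma cinner_zero_right [simp]: "cinner x (0 :: 'a::complex_inner) = 0"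
  using cinner_add_right[of x 0 0] by simp

lemma cinner_sum_left: "cinner (\<Sum>i\<in>I. f i) (y :: 'a::complex_inner) = (\<Sum>i\<in>I. cinner (f i) y)"
  by (induction I rule: infinite_finite_induct) (simp_all add: cinner_add_left)

lemma cinner_sum_right: "cinner (x :: 'a::complex_inner) (\<Sum>i\<in>I. f i) = (\<Sum>i\<in>I. cinner x (f i))"
  by (induction I rule: infinite_finite_induct) (simp_all add: cinner_add_right)

lemma norm_diff_square:
  fixes x y :: "'a::complex_inner"
  shows "(norm (x - y))\<^sup>2 = (norm x)\<^sup>2 - 2 * Re (cinner y x) + (norm y)\<^sup>2"
proof -
  have minus: "x - y = x + (-1) *\<^sub>C y"
    by (simp add: scaleC_minus_left scaleC_one)
  have "cinner (x - y) (x - y) = cinner x x - cinner x y - cinner y x + cinner y y"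
    unfolding minus cinner_add_left cinner_add_right cinner_scaleC_left cinner_scaleC_right by simp
  then have "Re (cinner (x - y) (x - y)) = Re (cinner x x) - 2 * Re (cinner y x) + Re (cinner y y)"
    using cinner_commute[of x y] by simp
  then show ?thesis
    by (simp add: cinner_self)
qed

text \<open>The real part of Cauchy-Schwarz, from the nonnegative squared distance between
  \<open>y\<close> and the multiple of \<open>x\<close> nearest to it on the real line through
  \<open>x\<close>. It makes \<open>Re (cinner x y)\<close> a bounded linear functional of
  \<open>y\<close> that commutes with means.\<close>

lemma abs_Re_cinner_le: "\<bar>Re (cinner x y)\<bar> \<le> norm x * norm (y :: 'a::complex_inner)"
proof (cases "x = 0")
  case False
  define r where "r = Re (cinner x y) / (norm x)\<^sup>2"
  have "0 \<le> (norm (y - complex_of_real r *\<^sub>C x))\<^sup>2" by simp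
  also have "\<dots> = (norm y)\<^sup>2 - 2 * (r * Re (cinner x y)) + r\<^sup>2 * (norm x)\<^sup>2"
    by (simp add: norm_diff_square cinner_scaleC_left norm_scaleC power_mult_distrib)
  also have "\<dots> = (norm y)\<^sup>2 - (Re (cinner x y))\<^sup>2 / (norm x)\<^sup>2"
    using False by (simp add: r_def power2_eq_square)
  finally have "(Re (cinner x y))\<^sup>2 \<le> (norm x * norm y)\<^sup>2"
    using False by (simp add: field_simps power_mult_distrib)
  then show ?thesis
    using power2_le_imp_le[of "\<bar>Re (cinner x y)\<bar>"] by simp
qed simp

lemma bounded_linear_Re_cinner_right: "bounded_linear (\<lambda>y :: 'a::complex_inner. Re (cinner x y))"
  by (rule bounded_linear_intro[where K = "norm x"])
    (use abs_Re_cinner_le[of x] in \<open>auto simp: cinner_add_right scaleR_scaleC cinner_scaleC_right mult.commute\<close>)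

lemma circle_mean_Re_cis_mult:
  "circle_mean (\<lambda>t. Re (cis (of_int n * t) * c)) = (if n = 0 then Re c else 0)"
proof -
  have "bounded_linear (\<lambda>z. Re (z * c))"
    by (intro bounded_linear_compose[OF bounded_linear_Re] bounded_linear_mult_left)
  then show ?thesis
    by (subst circle_mean_linear) (auto simp: circle_mean_cis intro: continuous_intros)
qed

lemma parseval:
  fixes w :: "int \<Rightarrow> 'a::complex_inner"
  assumes "finite J"
  shows "circle_mean (\<lambda>t. (norm (\<Sum>n\<in>J. cis (- of_int n * t) *\<^sub>C w n))\<^sup>2) = (\<Sum>n\<in>J. (norm (w n))\<^sup>2)"
proof -
  have "(norm (\<Sum>n\<in>J. cis (- of_int n * t) *\<^sub>C w n))\<^sup>2
      = (\<Sum>n\<in>J. \<Sum>m\<in>J. Re (cis (of_int (n - m) * t) * cinner (w n) (w m)))" for t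
  proof -
    have "cnj (cis (- of_int n * t)) * cis (- of_int m * t) = cis (of_int (n - m) * t)" for n m :: int
      by (simp add: cis_cnj cis_mult algebra_simps)
    then have "cinner (cis (- of_int n * t) *\<^sub>C w n) (cis (- of_int m * t) *\<^sub>C w m)
        = cis (of_int (n - m) * t) * cinner (w n) (w m)" for n m
      by (simp add: cinner_scaleC_left cinner_scaleC_right mult_ac)
    then have "Re (cinner (\<Sum>n\<in>J. cis (- of_int n * t) *\<^sub>C w n) (\<Sum>n\<in>J. cis (- of_int n * t) *\<^sub>C w n))
        = (\<Sum>n\<in>J. \<Sum>m\<in>J. Re (cis (of_int (n - m) * t) * cinner (w n) (w m)))"
      by (simp only: cinner_sum_left) (simp only: cinner_sum_right Re_sum)
    then show ?thesis
      by (simp only: cinner_self Re_complex_of_real)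
  qed
  then have "circle_mean (\<lambda>t. (norm (\<Sum>n\<in>J. cis (- of_int n * t) *\<^sub>C w n))\<^sup>2)
      = circle_mean (\<lambda>t. \<Sum>n\<in>J. \<Sum>m\<in>J. Re (cis (of_int (n - m) * t) * cinner (w n) (w m)))"
    by (rule circle_mean_cong)
  also have "\<dots> = (\<Sum>n\<in>J. circle_mean (\<lambda>t. \<Sum>m\<in>J. Re (cis (of_int (n - m) * t) * cinner (w n) (w m))))"
    by (intro circle_mean_sum assms continuous_intros)
  also have "\<dots> = (\<Sum>n\<in>J. \<Sum>m\<in>J. circle_mean (\<lambda>t. Re (cis (of_int (n - m) * t) * cinner (w n) (w m))))"
    by (intro sum.cong refl circle_mean_sum assms continuous_intros)
  also have "\<dots> = (\<Sum>n\<in>J. \<Sum>m\<in>J. if m = n then (norm (w n))\<^sup>2 else 0)"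
    unfolding circle_mean_Re_cis_mult by (intro sum.cong refl) (auto simp: cinner_self)
  also have "\<dots> = (\<Sum>n\<in>J. (norm (w n))\<^sup>2)"
    using assms by simp
  finally show ?thesis .
qed

text \<open>Expand the mean of the squared norm of \<open>f - s\<close>, which is nonnegative, for
  the Fourier partial sum \<open>s\<close>. Both the cross term and, by Parseval, the squared norm
  of \<open>s\<close> have mean equal to the sum of the squared coefficients.\<close>

lemma bessel:
  fixes f :: "real \<Rightarrow> 'a::chilbert_space"
  assumes "finite J" and f: "continuous_on {0..2 * pi} f"
  shows "(\<Sum>n\<in>J. (norm (circle_mean (\<lambda>t. cis (of_int n * t) *\<^sub>C f t)))\<^sup>2)
    \<le> circle_mean (\<lambda>t. (norm (f t))\<^sup>2)"
proof -
  define w where "w n = circle_mean (\<lambda>t. cis (of_int n * t) *\<^sub>C f t)" for n :: int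
  define s where "s t = (\<Sum>n\<in>J. cis (- of_int n * t) *\<^sub>C w n)" for t
  have s: "continuous_on {0..2 * pi} s"
    unfolding s_def by (intro continuous_intros)
  have cross: "Re (cinner (s t) (f t)) = (\<Sum>n\<in>J. Re (cinner (w n) (cis (of_int n * t) *\<^sub>C f t)))" for t
    by (simp add: s_def cinner_sum_left cinner_scaleC_left cinner_scaleC_right cis_cnj)
  have cont: "continuous_on {0..2 * pi} (\<lambda>t. Re (cinner (w n) (cis (of_int n * t) *\<^sub>C f t)))" for n
    by (intro bounded_linear.continuous_on[OF bounded_linear_Re_cinner_right] continuous_intros f)
  then have cont': "continuous_on {0..2 * pi} (\<lambda>t. Re (cinner (s t) (f t)))"
    unfolding cross by (intro continuous_on_sum cont)
  have "circle_mean (\<lambda>t. Re (cinner (s t) (f t)))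
      = (\<Sum>n\<in>J. circle_mean (\<lambda>t. Re (cinner (w n) (cis (of_int n * t) *\<^sub>C f t))))"
    unfolding cross by (intro circle_mean_sum assms cont)
  also have "\<dots> = (\<Sum>n\<in>J. Re (cinner (w n) (w n)))"
    unfolding w_def
    by (intro sum.cong refl circle_mean_linear[OF bounded_linear_Re_cinner_right] continuous_intros f)
  finally have mean_cross: "circle_mean (\<lambda>t. Re (cinner (s t) (f t))) = (\<Sum>n\<in>J. (norm (w n))\<^sup>2)"
    by (simp add: cinner_self)
  have "0 \<le> circle_mean (\<lambda>t. (norm (f t - s t))\<^sup>2)"
    using circle_mean_mono[of "\<lambda>_. 0" "\<lambda>t. (norm (f t - s t))\<^sup>2"]
    by (simp add: circle_mean_def continuous_intros f s)
  also have "\<dots> = circle_mean (\<lambda>t. (norm (f t))\<^sup>2 - 2 * Re (cinner (s t) (f t)) + (norm (s t))\<^sup>2)"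
    by (simp only: norm_diff_square)
  also have "\<dots> = circle_mean (\<lambda>t. (norm (f t))\<^sup>2) - circle_mean (\<lambda>t. 2 * Re (cinner (s t) (f t)))
      + circle_mean (\<lambda>t. (norm (s t))\<^sup>2)"
    by (subst circle_mean_add circle_mean_diff; (intro continuous_intros f s cont')?)+ simp
  also have "circle_mean (\<lambda>t. 2 * Re (cinner (s t) (f t))) = 2 * (\<Sum>n\<in>J. (norm (w n))\<^sup>2)"
    unfolding mean_cross[symmetric]
    by (intro circle_mean_linear[OF bounded_linear_mult_right] cont')
  also have "circle_mean (\<lambda>t. (norm (s t))\<^sup>2) = (\<Sum>n\<in>J. (norm (w n))\<^sup>2)"
    unfolding s_def by (rule parseval[OF assms(1)])
  finally show ?thesis
    by (simp add: w_def)
qed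

section \<open>Stable operator semigroups\<close>

text \<open>The index starts at \<open>1\<close>: \<open>T 0\<close> is irrelevant and need not be the identity.\<close>

lemma semigroup_square_summable_imp_summable:
  fixes T :: "nat \<Rightarrow> 'a::complex_normed_vector \<Rightarrow>\<^sub>C\<^sub>L 'a"
  assumes T: "\<And>n m. 1 \<le> n \<Longrightarrow> 1 \<le> m \<Longrightarrow> T (n + m) = T n o\<^sub>C\<^sub>L T m"
    and bound: "\<And>n. norm (T n) \<le> K"
    and square: "\<And>n x. (\<Sum>k\<in>{1..n}. (norm (T k *\<^sub>V x))\<^sup>2) \<le> (K * norm x)\<^sup>2"
  shows "summable (\<lambda>n. norm (T n))"
proof -
  have K: "0 \<le> K"
    using bound[of 0] norm_ge_zero[of "T 0"] by linarith
  \<comment> \<open>Each of the \<open>n\<close> splittings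
    \<open>T (n + 1) = T (n + 1 - k) T k\<close> bounds the same vector by \<open>K\<close> times a
    term of the square sum, so that vector is counted \<open>n\<close> times.\<close>
  have decay: "real n * (norm (T (Suc n) *\<^sub>V x))\<^sup>2 \<le> (K * (K * norm x))\<^sup>2" for n x
  proof -
    have "(norm (T (Suc n) *\<^sub>V x))\<^sup>2 \<le> K\<^sup>2 * (norm (T k *\<^sub>V x))\<^sup>2" if "k \<in> {1..n}" for k
    proof -
      have "T (Suc n) = T (Suc n - k) o\<^sub>C\<^sub>L T k"
        using T[of "Suc n - k" k] that by auto
      then have "norm (T (Suc n) *\<^sub>V x) \<le> norm (T (Suc n - k)) * norm (T k *\<^sub>V x)"
        by (simp add: norm_cblinfun)
      also have "\<dots> \<le> K * norm (T k *\<^sub>V x)"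
        by (intro mult_right_mono bound) simp
      finally show ?thesis
        by (metis norm_ge_zero power_mono power_mult_distrib)
    qed
    then have "(\<Sum>k\<in>{1..n}. (norm (T (Suc n) *\<^sub>V x))\<^sup>2) \<le> (\<Sum>k\<in>{1..n}. K\<^sup>2 * (norm (T k *\<^sub>V x))\<^sup>2)"
      by (rule sum_mono)
    also have "\<dots> \<le> K\<^sup>2 * (K * norm x)\<^sup>2"
      using square[where n = n and x = x]
      by (simp add: sum_distrib_left[symmetric] mult_left_mono)
    finally show ?thesis
      by (simp add: power_mult_distrib)
  qed
  \<comment> \<open>By \<open>decay\<close> the squared norm of \<open>T (n0 + 1) x\<close> is at
    most \<open>(K * K)^2 / n0\<close> times that of \<open>x\<close>; this choice makes the
    quotient less than 1/4.\<close>
  obtain n0 :: nat where n0: "4 * (K * K)\<^sup>2 < real n0"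
    using reals_Archimedean2 by blast
  then have n0_pos: "0 < real n0"
    using zero_le_power2[of "K * K"] by linarith
  define N where "N = Suc n0"
  have N: "norm (T N) \<le> 1/2"
  proof (rule norm_cblinfun_bound)
    fix x
    have "real n0 * (norm (T N *\<^sub>V x))\<^sup>2 \<le> (K * K)\<^sup>2 * (norm x)\<^sup>2"
      using decay[of n0 x] by (simp add: N_def power_mult_distrib mult_ac)
    also have "\<dots> \<le> (real n0 / 4) * (norm x)\<^sup>2"
      using n0 by (intro mult_right_mono) auto
    finally have "(norm (T N *\<^sub>V x))\<^sup>2 \<le> (1/2 * norm x)\<^sup>2"
      using n0_pos by (simp add: power_mult_distrib power2_eq_square)
    then show "norm (T N *\<^sub>V x) \<le> 1/2 * norm x"
      by (rule power2_le_imp_le) simp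
  qed simp
  let ?a = "\<lambda>n. norm (T (Suc n))"
  have step: "?a (n + N) \<le> ?a n / 2" for n
  proof -
    have "T (Suc (n + N)) = T (Suc n) o\<^sub>C\<^sub>L T N"
      using T[of "Suc n" N] by (simp add: N_def)
    then have "?a (n + N) \<le> norm (T (Suc n)) * norm (T N)"
      by (simp add: norm_cblinfun_compose)
    also have "\<dots> \<le> norm (T (Suc n)) * (1/2)"
      by (intro mult_left_mono N) simp
    finally show ?thesis by simp
  qed
  \<comment> \<open>Shifting by \<open>N\<close> halves the terms, so a partial sum \<open>s\<close>
    satisfies \<open>s \<le> s0 + s / 2\<close>, where \<open>s0\<close> is the sum of the first
    \<open>N\<close> terms.\<close>
  have "sum ?a {..<M} \<le> 2 * sum ?a {..<N}" for M
  proof -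
    have "sum ?a {..<M} \<le> sum ?a {..<N + M}"
      by (intro sum_mono2) auto
    also have "\<dots> = sum ?a {..<N} + (\<Sum>n<M. ?a (n + N))"
      by (induction M) (simp_all add: add_ac)
    also have "(\<Sum>n<M. ?a (n + N)) \<le> (\<Sum>n<M. ?a n / 2)"
      by (intro sum_mono step)
    finally show ?thesis
      by (simp add: sum_divide_distrib[symmetric])
  qed
  then have "summable ?a"
    by (intro summableI_nonneg_bounded[of ?a "2 * sum ?a {..<N}"]) auto
  then show ?thesis
    using summable_Suc_iff[of "\<lambda>n. norm (T n)"] by simp
qed

text \<open>The geometric sum \<open>W N\<close>, with the identity in place of \<open>T 0\<close>,
  telescopes: its product with \<open>I - w T 1\<close> in either order is
  \<open>I - w^(N+1) T (N+1)\<close>. For large \<open>N\<close> this is invertible, and the factors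
  commute. The bound on \<open>w\<close> includes the circle itself.\<close>

lemma semigroup_invertible_id_minus:
  fixes T :: "nat \<Rightarrow> 'a::{complex_normed_vector,banach} \<Rightarrow>\<^sub>C\<^sub>L 'a"
  assumes T: "\<And>n m. 1 \<le> n \<Longrightarrow> 1 \<le> m \<Longrightarrow> T (n + m) = T n o\<^sub>C\<^sub>L T m"
    and lim: "(\<lambda>n. norm (T n)) \<longlonglongrightarrow> 0"
    and w: "cmod w \<le> 1"
  shows "invertible_cblinfun (id_cblinfun - w *\<^sub>C T 1)"
proof -
  obtain N where "norm (T (Suc N)) < 1"
    using order_tendstoD(2)[OF LIMSEQ_Suc[OF lim], of 1] by (auto dest: eventually_happens)
  moreover have "cmod (w ^ Suc N) \<le> 1"
    using w power_le_one[of "cmod w"] by (simp add: norm_power del: power_Suc)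
  ultimately have "norm (w ^ Suc N *\<^sub>C T (Suc N)) < 1"
    using mult_right_mono[of "cmod (w ^ Suc N)" 1 "norm (T (Suc N))"]
    by (simp add: norm_scaleC del: power_Suc)
  then have inv: "invertible_cblinfun (id_cblinfun - w ^ Suc N *\<^sub>C T (Suc N))"
    by (rule invertible_id_minus)
  define W where "W N = id_cblinfun + (\<Sum>k\<in>{1..N}. w ^ k *\<^sub>C T k)" for N
  have W_Suc: "W (Suc N) = W N + w ^ Suc N *\<^sub>C T (Suc N)" for N
    by (simp add: W_def add.assoc)
  have "(id_cblinfun - w *\<^sub>C T 1) o\<^sub>C\<^sub>L W N = id_cblinfun - w ^ Suc N *\<^sub>C T (Suc N) \<and>
      W N o\<^sub>C\<^sub>L (id_cblinfun - w *\<^sub>C T 1) = id_cblinfun - w ^ Suc N *\<^sub>C T (Suc N)" for N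
  proof (induction N)
    case (Suc N)
    have "T 1 o\<^sub>C\<^sub>L T (Suc N) = T (Suc (Suc N))" "T (Suc N) o\<^sub>C\<^sub>L T 1 = T (Suc (Suc N))"
      using T[of 1 "Suc N"] T[of "Suc N" 1] by simp_all
    then have
      "(id_cblinfun - w *\<^sub>C T 1) o\<^sub>C\<^sub>L (w ^ Suc N *\<^sub>C T (Suc N))
        = w ^ Suc N *\<^sub>C T (Suc N) - w ^ Suc (Suc N) *\<^sub>C T (Suc (Suc N))"
      "(w ^ Suc N *\<^sub>C T (Suc N)) o\<^sub>C\<^sub>L (id_cblinfun - w *\<^sub>C T 1)
        = w ^ Suc N *\<^sub>C T (Suc N) - w ^ Suc (Suc N) *\<^sub>C T (Suc (Suc N))"
      by (simp_all add: compose_distribs scaleC_simps mult_ac)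
    then show ?case
      using Suc unfolding W_Suc compose_add_left compose_add_right by simp
  qed (simp add: W_def)
  then show ?thesis
    using inv by (metis invertible_commuting_factor)
qed

section \<open>Fourier coefficients of the resolvent\<close>

locale dichotomous_operator =
  fixes A :: "'x::chilbert_space \<Rightarrow>\<^sub>C\<^sub>L 'x"
  assumes dichotomous: "dichotomous A"
begin

text \<open>With \<open>z = cis t\<close> this is \<open>z (z I - A)^-1\<close>, so its plain mean
  is the contour integral that defines the spectral projection.\<close>

definition \<rho> :: "real \<Rightarrow> 'x \<Rightarrow>\<^sub>C\<^sub>L 'x"
  where "\<rho> t = inverse_cblinfun (id_cblinfun - cis (- t) *\<^sub>C A)"

text \<open>The Laurent coefficients of \<open>(I - z A)^-1\<close> on the circle, with
  \<open>z = cis (- t)\<close>. Negative indices carry the part of \<open>A\<close> outside the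
  disc: \<open>R (- 1)\<close> is minus the inverse of \<open>A\<close> on the kernel of the
  spectral projection, and zero on its range.\<close>

definition R :: "int \<Rightarrow> 'x \<Rightarrow>\<^sub>C\<^sub>L 'x"
  where "R n = circle_mean (\<lambda>t. cis (of_int n * t) *\<^sub>C \<rho> t)"

definition K :: real
  where "K = (SUP t\<in>{0..2 * pi}. norm (\<rho> t))"

lemma invertible_on_circle:
  assumes "cmod z = 1"
  shows "invertible_cblinfun (id_cblinfun - z *\<^sub>C A)"
proof -
  have "z \<noteq> 0"
    using assms by auto
  have "inverse z \<notin> spectrum A"
    using assms dichotomous by (auto simp: dichotomous_def norm_inverse)
  then have "invertible_cblinfun (z *\<^sub>C (inverse z *\<^sub>C id_cblinfun - A))"
    using \<open>z \<noteq> 0\<close> by (simp add: invertible_scaleC spectrum_def)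
  moreover have "z *\<^sub>C (inverse z *\<^sub>C id_cblinfun - A) = id_cblinfun - z *\<^sub>C A"
    using \<open>z \<noteq> 0\<close> by (simp add: scaleC_diff_right scaleC_scaleC scaleC_one)
  ultimately show ?thesis by simp
qed

lemma invertible_cis: "invertible_cblinfun (id_cblinfun - cis a *\<^sub>C A)"
  by (rule invertible_on_circle) simp

lemma continuous_on_\<rho> [continuous_intros]: "continuous_on S \<rho>"
  unfolding \<rho>_def by (intro continuous_intros invertible_cis)

lemma norm_\<rho>_le: "t \<in> {0..2 * pi} \<Longrightarrow> norm (\<rho> t) \<le> K"
  unfolding K_def
  by (intro cSUP_upper bounded_imp_bdd_above compact_imp_bounded compact_continuous_image
      continuous_intros) simp_all

lemma K_nonneg: "0 \<le> K"
  using norm_\<rho>_le[of 0] norm_ge_zero[of "\<rho> 0"] by (simp del: norm_ge_zero)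

lemma norm_R_le: "norm (R n) \<le> K"
  unfolding R_def
  by (rule norm_circle_mean_le) (auto intro!: continuous_intros norm_\<rho>_le simp: norm_scaleC)

lemma R_apply: "R n *\<^sub>V x = circle_mean (\<lambda>t. cis (of_int n * t) *\<^sub>C (\<rho> t *\<^sub>V x))"
  unfolding R_def
  by (subst circle_mean_linear[OF bounded_linear_cblinfun_left, symmetric])
    (auto intro!: continuous_intros)

lemma R_square_sum:
  assumes "finite J"
  shows "(\<Sum>n\<in>J. (norm (R n *\<^sub>V x))\<^sup>2) \<le> (K * norm x)\<^sup>2"
proof -
  have "(\<Sum>n\<in>J. (norm (R n *\<^sub>V x))\<^sup>2) \<le> circle_mean (\<lambda>t. (norm (\<rho> t *\<^sub>V x))\<^sup>2)"
    unfolding R_apply by (intro bessel assms continuous_intros)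
  also have "\<dots> \<le> circle_mean (\<lambda>t. (K * norm x)\<^sup>2)"
    by (intro circle_mean_mono continuous_intros power_mono order_trans[OF norm_cblinfun]
        mult_right_mono norm_\<rho>_le) simp_all
  finally show ?thesis
    by (simp add: circle_mean_def)
qed

text \<open>Comparison of Fourier coefficients in \<open>(I - cis (- t) A) \<rho> t = I\<close>; the
  factor \<open>cis (- t)\<close> lowers the index by one.\<close>

lemma R_rec: "R n - A o\<^sub>C\<^sub>L R (n - 1) = (if n = 0 then id_cblinfun else 0)"
proof -
  have "A o\<^sub>C\<^sub>L R (n - 1) = circle_mean (\<lambda>t. A o\<^sub>C\<^sub>L (cis (of_int (n - 1) * t) *\<^sub>C \<rho> t))"
    unfolding R_def
    by (intro circle_mean_linear[OF bounded_linear_compose_right, symmetric] continuous_intros)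
  then have "R n - A o\<^sub>C\<^sub>L R (n - 1)
      = circle_mean (\<lambda>t. cis (of_int n * t) *\<^sub>C \<rho> t - A o\<^sub>C\<^sub>L (cis (of_int (n - 1) * t) *\<^sub>C \<rho> t))"
    unfolding R_def by (subst circle_mean_diff) (auto intro!: continuous_intros)
  also have "\<dots> = circle_mean (\<lambda>t. cis (of_int n * t) *\<^sub>C id_cblinfun)"
  proof (rule circle_mean_cong)
    fix t
    have cis: "cis (of_int (n - 1) * t) = cis (of_int n * t) * cis (- t)"
      by (simp add: cis_mult algebra_simps)
    have "\<rho> t - cis (- t) *\<^sub>C (A o\<^sub>C\<^sub>L \<rho> t) = id_cblinfun"
      using inverse_cblinfun(2)[OF invertible_cis[of "- t"]] by (simp add: \<rho>_def compose_diff_left)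
    then have "cis (of_int n * t) *\<^sub>C (\<rho> t - cis (- t) *\<^sub>C (A o\<^sub>C\<^sub>L \<rho> t)) = cis (of_int n * t) *\<^sub>C id_cblinfun"
      by simp
    then show "cis (of_int n * t) *\<^sub>C \<rho> t - A o\<^sub>C\<^sub>L (cis (of_int (n - 1) * t) *\<^sub>C \<rho> t)
        = cis (of_int n * t) *\<^sub>C id_cblinfun"
      unfolding cis by (simp add: scaleC_diff_right scaleC_scaleC)
  qed
  also have "\<dots> = circle_mean (\<lambda>t. cis (of_int n * t)) *\<^sub>C id_cblinfun"
    by (intro circle_mean_linear[OF bounded_bilinear.bounded_linear_left[OF bounded_bilinear_scaleC]]
        continuous_intros)
  finally show ?thesis
    by (simp add: circle_mean_cis scaleC_one)
qed

lemma R_commute: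
  assumes "T o\<^sub>C\<^sub>L A = A o\<^sub>C\<^sub>L T"
  shows "T o\<^sub>C\<^sub>L R n = R n o\<^sub>C\<^sub>L T"
proof -
  have "T o\<^sub>C\<^sub>L \<rho> t = \<rho> t o\<^sub>C\<^sub>L T" for t
    unfolding \<rho>_def using assms
    by (intro inverse_commute invertible_cis) (simp add: compose_distribs)
  then have "circle_mean (\<lambda>t. T o\<^sub>C\<^sub>L (cis (of_int n * t) *\<^sub>C \<rho> t))
      = circle_mean (\<lambda>t. (cis (of_int n * t) *\<^sub>C \<rho> t) o\<^sub>C\<^sub>L T)"
    by simp
  then show ?thesis
    unfolding R_def
    by (subst (asm) circle_mean_linear[OF bounded_linear_compose_right],
        intro continuous_intros,
        subst (asm) circle_mean_linear[OF bounded_linear_compose_left])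
      (auto intro!: continuous_intros)
qed

section \<open>Product laws: the two halves of the coefficients as one-sided semigroups\<close>

lemma R_commute_A: "R n o\<^sub>C\<^sub>L A = A o\<^sub>C\<^sub>L R n"
  by (rule R_commute[symmetric]) simp

lemma R_commute_R: "R n o\<^sub>C\<^sub>L R m = R m o\<^sub>C\<^sub>L R n"
  by (rule R_commute) (rule R_commute_A)

lemma A_R: "n \<noteq> - 1 \<Longrightarrow> A o\<^sub>C\<^sub>L R n = R (n + 1)" "A o\<^sub>C\<^sub>L R (- 1) = R 0 - id_cblinfun"
  using R_rec[of "n + 1"] R_rec[of 0] by (auto simp: algebra_simps)

lemma R_apply_tendsto_0:
  assumes "inj f"
  shows "(\<lambda>k. R (f k) *\<^sub>V x) \<longlonglongrightarrow> 0"
proof -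
  have "sum (\<lambda>k. (norm (R (f k) *\<^sub>V x))\<^sup>2) {..<n} \<le> (K * norm x)\<^sup>2" for n
    using R_square_sum[of "f ` {..<n}" x] assms
    by (simp add: sum.reindex inj_on_subset[of f UNIV])
  then have "summable (\<lambda>k. (norm (R (f k) *\<^sub>V x))\<^sup>2)"
    by (intro summableI_nonneg_bounded) auto
  then have "(\<lambda>k. (norm (R (f k) *\<^sub>V x))\<^sup>2) \<longlonglongrightarrow> 0"
    by (rule summable_LIMSEQ_zero)
  from tendsto_real_sqrt[OF this] show ?thesis
    by (simp add: tendsto_norm_zero_cancel)
qed

text \<open>Moving powers of \<open>A\<close> across gives
  \<open>R n R m = R (n + k) R (m - k)\<close> for every \<open>k\<close>. The left factors stay
  bounded by \<open>K\<close>, and the right ones tend to zero at each vector because their squares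
  are summable.\<close>

lemma R_mult_orth:
  assumes "0 \<le> n" and "m < 0"
  shows "R n o\<^sub>C\<^sub>L R m = 0" "R m o\<^sub>C\<^sub>L R n = 0"
proof -
  \<comment> \<open>Since \<open>0 \<le> n\<close> and \<open>m < 0\<close>, neither move meets the
    jump of the recursion: the indices to which \<open>A\<close> is applied are
    \<open>n + k \<ge> 0\<close> and \<open>m - k - 1 \<le> - 2\<close>.\<close>
  have shift: "R n o\<^sub>C\<^sub>L R m = R (n + int k) o\<^sub>C\<^sub>L R (m - int k)" for k
  proof (induction k)
    case (Suc k)
    have "R (m - int k) = A o\<^sub>C\<^sub>L R (m - int (Suc k))"
      using assms by (subst A_R) (auto simp: algebra_simps)
    moreover have "R (n + int (Suc k)) = R (n + int k) o\<^sub>C\<^sub>L A"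
      unfolding R_commute_A using assms by (subst A_R) (auto simp: algebra_simps)
    ultimately show ?case
      using Suc by (simp add: compose_assoc)
  qed simp
  have "(R n o\<^sub>C\<^sub>L R m) *\<^sub>V x = 0" for x
  proof -
    have "(\<lambda>k. R (m - int k) *\<^sub>V x) \<longlonglongrightarrow> 0"
      by (intro R_apply_tendsto_0) (auto simp: inj_def)
    then have "(\<lambda>k. K * norm (R (m - int k) *\<^sub>V x)) \<longlonglongrightarrow> 0"
      by (intro tendsto_mult_right_zero tendsto_norm_zero)
    moreover have "norm ((R n o\<^sub>C\<^sub>L R m) *\<^sub>V x) \<le> K * norm (R (m - int k) *\<^sub>V x)" for k
      unfolding shift[of k] cblinfun_apply_simps
      by (intro order_trans[OF norm_cblinfun] mult_right_mono norm_R_le) simp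
    ultimately have "norm ((R n o\<^sub>C\<^sub>L R m) *\<^sub>V x) \<le> 0"
      by (intro LIMSEQ_le_const) auto
    then show ?thesis by simp
  qed
  then show "R n o\<^sub>C\<^sub>L R m = 0"
    by (intro cblinfun_eqI) simp
  then show "R m o\<^sub>C\<^sub>L R n = 0"
    by (simp add: R_commute_R)
qed

text \<open>Idempotence of \<open>R 0\<close> starts the induction: in
  \<open>R 0 = I + A R (- 1)\<close>, multiplication by \<open>R 0\<close> removes the last term by
  orthogonality. All other cases follow by absorbing powers of \<open>A\<close>.\<close>

lemma R_mult_nonneg: "R (int n) o\<^sub>C\<^sub>L R (int m) = R (int (n + m))"
proof (induction m arbitrary: n)
  case 0
  show ?case
  proof (induction n)
    case 0
    have "R 0 = id_cblinfun + A o\<^sub>C\<^sub>L R (- 1)"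
      by (simp add: A_R)
    then have "R 0 o\<^sub>C\<^sub>L R 0 = R 0 o\<^sub>C\<^sub>L (id_cblinfun + A o\<^sub>C\<^sub>L R (- 1))"
      by simp
    also have "\<dots> = R 0 + A o\<^sub>C\<^sub>L (R 0 o\<^sub>C\<^sub>L R (- 1))"
      by (simp only: compose_add_right compose_id_right compose_assoc[symmetric] R_commute_A)
    finally show ?case
      by (simp add: R_mult_orth)
  next
    case (Suc n)
    have "R (int (Suc n)) = A o\<^sub>C\<^sub>L R (int n)"
      by (subst A_R) (auto simp: add.commute)
    then show ?case
      using Suc by (simp add: compose_assoc)
  qed
next
  case (Suc m)
  have "R (int n) o\<^sub>C\<^sub>L R (int (Suc m)) = R (int n) o\<^sub>C\<^sub>L A o\<^sub>C\<^sub>L R (int m)"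
    unfolding compose_assoc by (subst A_R) (auto simp: add.commute)
  also have "R (int n) o\<^sub>C\<^sub>L A = R (int (Suc n))"
    unfolding R_commute_A by (subst A_R) (auto simp: add.commute)
  finally show ?case
    using Suc[of "Suc n"] by simp
qed

text \<open>The sign arises at the jump of the recursion: \<open>R (- 1 - n) R (- 1) = R (- 2 - n) A
  R (- 1) = R (- 2 - n) (R 0 - I)\<close>, where the term with \<open>R 0\<close> vanishes by
  orthogonality.\<close>

lemma R_mult_neg:
  "R (- 1 - int n) o\<^sub>C\<^sub>L R (- 1 - int m) = - R (- 2 - int (n + m))"
proof (induction m arbitrary: n)
  case 0
  have "R (- 1 - int n) o\<^sub>C\<^sub>L R (- 1) = R (- 2 - int n) o\<^sub>C\<^sub>L A o\<^sub>C\<^sub>L R (- 1)"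
    unfolding R_commute_A by (subst A_R) auto
  also have "\<dots> = - R (- 2 - int n)"
    by (simp add: compose_assoc A_R compose_diff_right R_mult_orth)
  finally show ?case by simp
next
  case (Suc m)
  have "R (- 1 - int n) o\<^sub>C\<^sub>L R (- 1 - int (Suc m)) = R (- 1 - int (Suc n)) o\<^sub>C\<^sub>L (A o\<^sub>C\<^sub>L R (- 1 - int (Suc m)))"
    unfolding compose_assoc[symmetric] R_commute_A by (subst A_R) auto
  also have "A o\<^sub>C\<^sub>L R (- 1 - int (Suc m)) = R (- 1 - int m)"
    by (subst A_R) auto
  finally show ?case
    using Suc[of "Suc n"] by simp
qed

text \<open>After the change of sign these are the powers of the inverse of \<open>A\<close> on the
  unstable subspace. At index 0 the expression would be \<open>- R 0\<close>, which belongs to the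
  other half; hence the start at 1.\<close>

lemma semigroup_neg:
  assumes "1 \<le> n" and "1 \<le> m"
  shows "- R (- int (n + m)) = - R (- int n) o\<^sub>C\<^sub>L - R (- int m)"
proof -
  have "R (- 1 - int (n - 1)) o\<^sub>C\<^sub>L R (- 1 - int (m - 1)) = - R (- 2 - int (n - 1 + (m - 1)))"
    by (rule R_mult_neg)
  moreover have "- 1 - int (n - 1) = - int n" "- 1 - int (m - 1) = - int m"
    "- 2 - int (n - 1 + (m - 1)) = - int (n + m)"
    using assms by auto
  ultimately show ?thesis
    by (simp add: compose_minus_left compose_minus_right)
qed

lemma summable_norm_R_nonneg: "summable (\<lambda>n. norm (R (int n)))"
proof (rule semigroup_square_summable_imp_summable)
  show "(\<Sum>k\<in>{1..n}. (norm (R (int k) *\<^sub>V x))\<^sup>2) \<le> (K * norm x)\<^sup>2" for n x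
    using R_square_sum[of "int ` {1..n}" x] by (simp add: sum.reindex)
qed (simp_all add: norm_R_le R_mult_nonneg)

lemma summable_norm_R_neg: "summable (\<lambda>n. norm (R (- int n)))"
proof -
  have "summable (\<lambda>n. norm (- R (- int n)))"
  proof (rule semigroup_square_summable_imp_summable[OF semigroup_neg])
    show "(\<Sum>k\<in>{1..n}. (norm (- R (- int k) *\<^sub>V x))\<^sup>2) \<le> (K * norm x)\<^sup>2" for n x
      using R_square_sum[of "(\<lambda>k. - int k) ` {1..n}" x] by (simp add: sum.reindex inj_on_def)
  qed (simp_all add: norm_R_le)
  then show ?thesis by simp
qed

section \<open>Spectral projection\<close>

abbreviation P :: "'x \<Rightarrow>\<^sub>C\<^sub>L 'x"
  where "P \<equiv> spectral_projection A"

lemma spectral_projection_eq: "P = R 0"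
proof -
  have integrand: "(\<i> * cis t) *\<^sub>C inverse_cblinfun (cis t *\<^sub>C id_cblinfun - A) = \<i> *\<^sub>C \<rho> t" for t
  proof -
    have "cis t *\<^sub>C id_cblinfun - A = cis t *\<^sub>C (id_cblinfun - cis (- t) *\<^sub>C A)"
      by (simp add: scaleC_diff_right scaleC_scaleC cis_mult scaleC_one)
    then have "inverse_cblinfun (cis t *\<^sub>C id_cblinfun - A) = inverse (cis t) *\<^sub>C \<rho> t"
      unfolding \<rho>_def by (simp only:) (rule inverse_scaleC, simp_all add: invertible_cis)
    then show ?thesis
      by (simp add: scaleC_scaleC mult.assoc cis_mult)
  qed
  have "integral {0..2 * pi} (\<lambda>t. \<i> *\<^sub>C \<rho> t) = \<i> *\<^sub>C integral {0..2 * pi} \<rho>"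
    using integral_linear[OF integrable_continuous_real bounded_linear_scaleC, of 0 "2 * pi" \<rho> \<i>]
    by (simp add: o_def continuous_on_\<rho>)
  then show ?thesis
    by (simp add: spectral_projection_def integrand R_def circle_mean_def scaleC_scaleC scaleC_one scaleR_scaleC)
qed

lemma P_idem: "P o\<^sub>C\<^sub>L P = P"
  using R_mult_nonneg[of 0 0] by (simp add: spectral_projection_eq)

lemma P_idem_apply [simp]: "P *\<^sub>V (P *\<^sub>V x) = P *\<^sub>V x"
  using P_idem by (metis cblinfun_apply_simps(7))

lemma R_nonneg_P: "0 \<le> n \<Longrightarrow> R n o\<^sub>C\<^sub>L P = R n"
  using R_mult_nonneg[of "nat n" 0] by (simp add: spectral_projection_eq)

lemma P_R_neg: "n < 0 \<Longrightarrow> P o\<^sub>C\<^sub>L R n = 0"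
  by (simp add: spectral_projection_eq R_mult_orth)

lemma P_commute: "T o\<^sub>C\<^sub>L A = A o\<^sub>C\<^sub>L T \<Longrightarrow> T o\<^sub>C\<^sub>L P = P o\<^sub>C\<^sub>L T"
  unfolding spectral_projection_eq by (rule R_commute)

lemma mem_dich_plus: "x \<in> dich_plus A \<longleftrightarrow> P *\<^sub>V x = x"
  unfolding dich_plus_def by (metis P_idem_apply rangeE rangeI)

lemma mem_dich_minus: "x \<in> dich_minus A \<longleftrightarrow> P *\<^sub>V x = 0"
  unfolding dich_minus_def by simp

lemma closed_csubspace_dich_plus: "closed_csubspace (dich_plus A)"
proof -
  have "continuous_on UNIV (\<lambda>x. P *\<^sub>V x)"
    by (intro continuous_intros)
  then have "closed {x. P *\<^sub>V x = x}"
    by (intro closed_Collect_eq continuous_intros)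
  moreover have "dich_plus A = {x. P *\<^sub>V x = x}"
    using mem_dich_plus by blast
  ultimately show ?thesis
    unfolding closed_csubspace_def by (simp add: cblinfun_add_right)
qed

lemma closed_csubspace_dich_minus: "closed_csubspace (dich_minus A)"
proof -
  have "closed {x. P *\<^sub>V x = 0}"
    by (intro closed_Collect_eq continuous_intros)
  then show ?thesis
    unfolding closed_csubspace_def dich_minus_def by (simp add: cblinfun_add_right)
qed

text \<open>The vector \<open>R (- (n + 1)) h n\<close> does not depend on \<open>n\<close>, as the
  step of the orbit cancels the step of the index. It tends to zero because these coefficients
  vanish in norm; pointwise convergence would not do, since \<open>h n\<close> varies. So
  \<open>R (- 1) h 0 = 0\<close>, and applying \<open>A\<close> gives
  \<open>(P - I) h 0 = 0\<close>.\<close>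

lemma bounded_orbit_in_dich_plus:
  assumes h: "\<And>n. h (Suc n) = A *\<^sub>V h n" and bound: "\<And>n. norm (h n) \<le> M"
  shows "P *\<^sub>V h 0 = h 0"
proof -
  have shift: "R (- int (Suc n)) *\<^sub>V h n = R (- 1) *\<^sub>V h 0" for n
  proof (induction n)
    case (Suc n)
    have "R (- int (Suc (Suc n))) *\<^sub>V h (Suc n) = (A o\<^sub>C\<^sub>L R (- int (Suc (Suc n)))) *\<^sub>V h n"
      unfolding R_commute_A[symmetric] by (simp add: h)
    also have "A o\<^sub>C\<^sub>L R (- int (Suc (Suc n))) = R (- int (Suc n))"
      by (subst A_R) auto
    finally show ?case using Suc by simp
  qed simp
  have "(\<lambda>n. norm (R (- int (Suc n))) * M) \<longlonglongrightarrow> 0"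
    by (intro tendsto_mult_left_zero LIMSEQ_Suc[OF summable_LIMSEQ_zero[OF summable_norm_R_neg]])
  moreover have "norm (R (- 1) *\<^sub>V h 0) \<le> norm (R (- int (Suc n))) * M" for n
    unfolding shift[of n, symmetric]
    by (intro order_trans[OF norm_cblinfun] mult_left_mono bound) simp
  ultimately have "norm (R (- 1) *\<^sub>V h 0) \<le> 0"
    by (intro LIMSEQ_le_const) auto
  then have "(A o\<^sub>C\<^sub>L R (- 1)) *\<^sub>V h 0 = 0"
    by simp
  then show ?thesis
    by (simp add: A_R spectral_projection_eq del: cblinfun_apply_simps(7))
qed

section \<open>Analytic extension of the two parts of the resolvent\<close>

lemma resolvent_commute_P:
  assumes "z \<in> inv_resolvent_set0 A"
  shows "inverse_cblinfun (id_cblinfun - z *\<^sub>C A) o\<^sub>C\<^sub>L P = P o\<^sub>C\<^sub>L inverse_cblinfun (id_cblinfun - z *\<^sub>C A)"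
  using assms P_commute[of A]
  by (intro inverse_commute[symmetric]) (simp_all add: inv_resolvent_set0_def compose_distribs)

text \<open>On the range of \<open>P\<close> the operators \<open>A\<close> and
  \<open>R 1 = A P\<close> agree. Unlike \<open>I - z A\<close>, the pencil \<open>I - z R 1\<close>
  is invertible on the whole closed disc, because the powers of \<open>R 1\<close> decay.\<close>

lemma resolvent_plus_extends:
  obtains S H where "open S" "cball 0 1 \<subseteq> S" "vanalytic_on H S"
    "\<And>z. z \<in> S \<Longrightarrow> z \<in> inv_resolvent_set0 A \<Longrightarrow> inverse_cblinfun (id_cblinfun - z *\<^sub>C A) o\<^sub>C\<^sub>L P = H z"
proof
  define S where "S = {z. invertible_cblinfun (id_cblinfun + z *\<^sub>C - R 1)}"
  define H where "H z = id_cblinfun o\<^sub>C\<^sub>L inverse_cblinfun (id_cblinfun + z *\<^sub>C - R 1) o\<^sub>C\<^sub>L P" for z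
  show "open S"
    unfolding S_def by (rule open_invertible_pencil)
  show "cball 0 1 \<subseteq> S"
    using semigroup_invertible_id_minus[of "\<lambda>n. R (int n)"]
      summable_LIMSEQ_zero[OF summable_norm_R_nonneg]
    by (auto simp: S_def R_mult_nonneg scaleC_minus_right)
  show "vanalytic_on H S"
    unfolding H_def S_def by (intro vanalytic_on_compose vanalytic_on_inverse_pencil)
  fix z assume z: "z \<in> S" "z \<in> inv_resolvent_set0 A"
  let ?X = "id_cblinfun - z *\<^sub>C A" and ?Y = "id_cblinfun + z *\<^sub>C - R 1"
  have X: "invertible_cblinfun ?X" and Y: "invertible_cblinfun ?Y"
    using z by (simp_all add: S_def inv_resolvent_set0_def)
  have XP: "?X o\<^sub>C\<^sub>L P = ?Y o\<^sub>C\<^sub>L P"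
    using A_R(1)[of 0] R_nonneg_P[of 1]
    by (simp add: compose_distribs scaleC_minus_right spectral_projection_eq)
  have PY: "P o\<^sub>C\<^sub>L ?Y = ?Y o\<^sub>C\<^sub>L P"
    by (simp add: compose_distribs scaleC_minus_right spectral_projection_eq R_commute_R[of 0 1])
  have "inverse_cblinfun ?X o\<^sub>C\<^sub>L P = inverse_cblinfun ?X o\<^sub>C\<^sub>L ((P o\<^sub>C\<^sub>L ?Y) o\<^sub>C\<^sub>L inverse_cblinfun ?Y)"
    by (simp only: compose_assoc inverse_cblinfun(2)[OF Y] compose_id_right)
  also have "P o\<^sub>C\<^sub>L ?Y = ?X o\<^sub>C\<^sub>L P"
    by (simp only: XP PY)
  also have "inverse_cblinfun ?X o\<^sub>C\<^sub>L ((?X o\<^sub>C\<^sub>L P) o\<^sub>C\<^sub>L inverse_cblinfun ?Y) = P o\<^sub>C\<^sub>L inverse_cblinfun ?Y"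
    by (simp only: compose_assoc inverse_cancel[OF X])
  also have "\<dots> = H z"
    using inverse_commute[OF Y PY] by (simp add: H_def)
  finally show "inverse_cblinfun ?X o\<^sub>C\<^sub>L P = H z" .
qed

lemma closure_exterior_subset: "closure (- cball (0::complex) 1) \<subseteq> {z. 1 \<le> cmod z}"
  by (intro closure_minimal closed_Collect_le continuous_intros) auto

text \<open>The product \<open>(I - z A) R (- 1)\<close> equals
  \<open>(I - P) (R (- 1) + z I)\<close>, which identifies the resolvent on the kernel of
  \<open>P\<close>. For \<open>z\<close> on or outside the circle the pencil is
  \<open>z (I - (1/z) (- R (- 1)))\<close>, invertible since \<open>- R (- 1)\<close> has decaying
  powers.\<close>

lemma resolvent_minus_extends:
  obtains S H where "open S" "closure (- cball 0 1) \<subseteq> S" "vanalytic_on H S"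
    "\<And>z. z \<in> S \<Longrightarrow> z \<in> inv_resolvent_set0 A \<Longrightarrow>
      inverse_cblinfun (id_cblinfun - z *\<^sub>C A) o\<^sub>C\<^sub>L (id_cblinfun - P) = H z"
proof
  define S where "S = {z. invertible_cblinfun (R (- 1) + z *\<^sub>C id_cblinfun)}"
  define H where "H z = R (- 1) o\<^sub>C\<^sub>L inverse_cblinfun (R (- 1) + z *\<^sub>C id_cblinfun) o\<^sub>C\<^sub>L id_cblinfun" for z
  show "open S"
    unfolding S_def by (rule open_invertible_pencil)
  show "closure (- cball 0 1) \<subseteq> S"
  proof
    fix z :: complex assume "z \<in> closure (- cball 0 1)"
    then have z: "1 \<le> cmod z"
      using closure_exterior_subset by blast
    then have "z \<noteq> 0" by auto
    have lim: "(\<lambda>n. norm (- R (- int n))) \<longlonglongrightarrow> 0"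
      using summable_LIMSEQ_zero[OF summable_norm_R_neg] by simp
    have "invertible_cblinfun (id_cblinfun - inverse z *\<^sub>C - R (- int 1))"
      using z by (intro semigroup_invertible_id_minus[OF semigroup_neg lim])
        (simp_all add: norm_inverse inverse_le_1_iff)
    moreover have "R (- 1) + z *\<^sub>C id_cblinfun = z *\<^sub>C (id_cblinfun - inverse z *\<^sub>C - R (- int 1))"
      using \<open>z \<noteq> 0\<close> by (simp add: scaleC_simps)
    ultimately show "z \<in> S"
      using \<open>z \<noteq> 0\<close> by (simp only: S_def mem_Collect_eq invertible_scaleC not_False_eq_True)
  qed
  show "vanalytic_on H S"
    unfolding H_def S_def by (intro vanalytic_on_compose vanalytic_on_inverse_pencil)
  fix z assume z: "z \<in> S" "z \<in> inv_resolvent_set0 A"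
  let ?X = "id_cblinfun - z *\<^sub>C A" and ?Y = "R (- 1) + z *\<^sub>C id_cblinfun"
  have X: "invertible_cblinfun ?X" and Y: "invertible_cblinfun ?Y"
    using z by (simp_all add: S_def inv_resolvent_set0_def)
  have "?X o\<^sub>C\<^sub>L R (- 1) = (id_cblinfun - P) o\<^sub>C\<^sub>L ?Y"
    by (simp add: compose_distribs spectral_projection_eq scaleC_diff_right A_R(2) R_mult_orth)
  then have "inverse_cblinfun ?X o\<^sub>C\<^sub>L (?X o\<^sub>C\<^sub>L R (- 1)) o\<^sub>C\<^sub>L inverse_cblinfun ?Y
      = inverse_cblinfun ?X o\<^sub>C\<^sub>L ((id_cblinfun - P) o\<^sub>C\<^sub>L ?Y) o\<^sub>C\<^sub>L inverse_cblinfun ?Y"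
    by simp
  then show "inverse_cblinfun ?X o\<^sub>C\<^sub>L (id_cblinfun - P) = H z"
    by (simp add: compose_assoc inverse_cblinfun[OF Y] inverse_cancel[OF X] H_def)
qed

end

section \<open>Toeplitz equations\<close>

context dichotomous_operator
begin

text \<open>An upper bound for the two-sided sum of the norms; \<open>R 0\<close> is counted in both
  series.\<close>

definition L :: real
  where "L = (\<Sum>k. norm (R (int k))) + (\<Sum>k. norm (R (- int k)))"

lemma sum_norm_R_le:
  assumes "finite J"
  shows "(\<Sum>n\<in>J. norm (R n)) \<le> L"
proof -
  have "(\<Sum>n\<in>J \<inter> {0..}. norm (R n)) = (\<Sum>k\<in>nat ` (J \<inter> {0..}). norm (R (int k)))"
    by (subst sum.reindex) (auto simp: inj_on_def)
  also have "\<dots> \<le> (\<Sum>k. norm (R (int k)))"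
    using assms by (intro sum_le_suminf summable_norm_R_nonneg) auto
  finally have nonneg: "(\<Sum>n\<in>J \<inter> {0..}. norm (R n)) \<le> (\<Sum>k. norm (R (int k)))" .
  have "(\<Sum>n\<in>J - {0..}. norm (R n)) = (\<Sum>k\<in>(\<lambda>n. nat (- n)) ` (J - {0..}). norm (R (- int k)))"
    by (subst sum.reindex) (auto simp: inj_on_def)
  also have "\<dots> \<le> (\<Sum>k. norm (R (- int k)))"
    using assms by (intro sum_le_suminf summable_norm_R_neg) auto
  finally show ?thesis
    using nonneg sum.Int_Diff[OF assms, of "\<lambda>n. norm (R n)" "{0..}"] by (simp add: L_def)
qed

lemma sum_norm_R_row_le: "(\<Sum>j<M. norm (R (n - int j))) \<le> L"
  using sum_norm_R_le[of "(\<lambda>j. n - int j) ` {..<M}"] by (simp add: sum.reindex inj_on_def)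

lemma summable_norm_R_row: "summable (\<lambda>j. norm (R (n - int j)))"
  using sum_norm_R_row_le by (intro summableI_nonneg_bounded) auto

end

text \<open>The sequence lies in the ball of radius \<open>E\<close> of the square-summable
  sequences, expressed by partial sums so that the bound passes directly to limits.\<close>

definition square_bounded :: "(nat \<Rightarrow> 'a::real_normed_vector) \<Rightarrow> real \<Rightarrow> bool"
  where "square_bounded e E \<longleftrightarrow> 0 \<le> E \<and> (\<forall>N. (\<Sum>n<N. (norm (e n))\<^sup>2) \<le> E\<^sup>2)"

lemma square_bounded_norm_le:
  assumes "square_bounded e E"
  shows "norm (e n) \<le> E"
proof -
  have "(norm (e n))\<^sup>2 \<le> (\<Sum>k<Suc n. (norm (e k))\<^sup>2)"
    by (rule member_le_sum) auto
  also have "\<dots> \<le> E\<^sup>2"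
    using assms by (simp only: square_bounded_def)
  finally show ?thesis
    by (rule power2_le_imp_le) (use assms in \<open>simp add: square_bounded_def\<close>)
qed

lemma square_bounded_cblinfun:
  assumes "square_bounded e E"
  shows "square_bounded (\<lambda>n. T *\<^sub>V e n) (norm T * E)"
  unfolding square_bounded_def
proof (intro conjI allI)
  show "0 \<le> norm T * E"
    using assms by (simp add: square_bounded_def)
  fix N
  have "(\<Sum>n<N. (norm (T *\<^sub>V e n))\<^sup>2) \<le> (\<Sum>n<N. (norm T * norm (e n))\<^sup>2)"
    by (intro sum_mono power_mono norm_cblinfun) simp
  also have "\<dots> = (norm T)\<^sup>2 * (\<Sum>n<N. (norm (e n))\<^sup>2)"
    by (simp add: power_mult_distrib sum_distrib_left)
  also have "\<dots> \<le> (norm T)\<^sup>2 * E\<^sup>2"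
    using assms by (intro mult_left_mono) (simp_all add: square_bounded_def)
  finally show "(\<Sum>n<N. (norm (T *\<^sub>V e n))\<^sup>2) \<le> (norm T * E)\<^sup>2"
    by (simp add: power_mult_distrib)
qed

lemma (in dichotomous_operator) square_bounded_R: "square_bounded (\<lambda>n. R (int n) *\<^sub>V x) (K * norm x)"
  using R_square_sum[of "int ` {..<N}" x for N] K_nonneg
  by (simp add: square_bounded_def sum.reindex)

text \<open>The symbol is \<open>F\<close> at \<open>cis (- t)\<close>, the parametrization in which
  \<open>R\<close> gives its Fourier coefficients; \<open>c\<close> is to be the maximum of the norm
  of \<open>F\<close> over the circle.\<close>

locale contractive_realization = dichotomous_operator A
  for A :: "'x::chilbert_space \<Rightarrow>\<^sub>C\<^sub>L 'x" +
  fixes B :: "'u::chilbert_space \<Rightarrow>\<^sub>C\<^sub>L 'x" and C :: "'x \<Rightarrow>\<^sub>C\<^sub>L 'u" and D :: "'u \<Rightarrow>\<^sub>C\<^sub>L 'u" and c :: real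
  assumes c_nonneg: "0 \<le> c" and c_less_1: "c < 1"
    and norm_symbol_le: "\<And>t. norm (D + cis (- t) *\<^sub>C (C o\<^sub>C\<^sub>L \<rho> t o\<^sub>C\<^sub>L B)) \<le> c"
    and invertible_ID: "invertible_cblinfun (id_cblinfun + D)"
begin

definition symbol :: "real \<Rightarrow> 'u \<Rightarrow>\<^sub>C\<^sub>L 'u"
  where "symbol t = D + cis (- t) *\<^sub>C (C o\<^sub>C\<^sub>L \<rho> t o\<^sub>C\<^sub>L B)"

definition \<Phi> :: "int \<Rightarrow> 'u \<Rightarrow>\<^sub>C\<^sub>L 'u"
  where "\<Phi> n = circle_mean (\<lambda>t. cis (of_int n * t) *\<^sub>C symbol t)"

text \<open>\<open>R\<close> is the Green kernel of the state equation
  \<open>h (n + 1) = A h n + B e n\<close>, and this is its bounded solution for bounded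
  \<open>e\<close>. The terms with \<open>j < n\<close> propagate past inputs through the stable
  part; those with \<open>j \<ge> n\<close> anticipate future inputs through the unstable
  part.\<close>

definition conv :: "(nat \<Rightarrow> 'u) \<Rightarrow> nat \<Rightarrow> 'x"
  where "conv e n = (\<Sum>j. R (int n - 1 - int j) *\<^sub>V (B *\<^sub>V e j))"

text \<open>The Toeplitz operator with symbol \<open>F\<close>, whose matrix is \<open>\<Phi> (n - j)\<close>.\<close>

definition toep :: "(nat \<Rightarrow> 'u) \<Rightarrow> nat \<Rightarrow> 'u"
  where "toep e n = D *\<^sub>V e n + C *\<^sub>V conv e n"

lemma continuous_on_symbol [continuous_intros]: "continuous_on S symbol"
proof -
  have "continuous_on S (\<lambda>t. cis (- t))"
    using continuous_on_cis_mult[of S "- 1"] by simp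
  then show ?thesis
    unfolding symbol_def by (intro continuous_intros)
qed

lemma \<Phi>_eq: "\<Phi> n = (if n = 0 then D else 0) + C o\<^sub>C\<^sub>L R (n - 1) o\<^sub>C\<^sub>L B"
proof -
  have "\<Phi> n = circle_mean (\<lambda>t. cis (of_int n * t) *\<^sub>C D
      + C o\<^sub>C\<^sub>L (cis (of_int (n - 1) * t) *\<^sub>C \<rho> t) o\<^sub>C\<^sub>L B)"
    unfolding \<Phi>_def symbol_def
    by (intro circle_mean_cong) (simp add: scaleC_add_right scaleC_scaleC cis_mult algebra_simps)
  also have "\<dots> = circle_mean (\<lambda>t. cis (of_int n * t) *\<^sub>C D)
      + circle_mean (\<lambda>t. C o\<^sub>C\<^sub>L (cis (of_int (n - 1) * t) *\<^sub>C \<rho> t) o\<^sub>C\<^sub>L B)"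
    by (intro circle_mean_add continuous_intros)
  also have "circle_mean (\<lambda>t. cis (of_int n * t) *\<^sub>C D) = circle_mean (\<lambda>t. cis (of_int n * t)) *\<^sub>C D"
    by (intro circle_mean_linear[OF bounded_bilinear.bounded_linear_left[OF bounded_bilinear_scaleC]]
        continuous_intros)
  also have "circle_mean (\<lambda>t. C o\<^sub>C\<^sub>L (cis (of_int (n - 1) * t) *\<^sub>C \<rho> t) o\<^sub>C\<^sub>L B) = C o\<^sub>C\<^sub>L R (n - 1) o\<^sub>C\<^sub>L B"
    unfolding R_def
    by (intro circle_mean_linear continuous_intros
        bounded_linear_compose[OF bounded_linear_compose_left bounded_linear_compose_right])
  finally show ?thesis
    by (simp add: circle_mean_cis scaleC_one)
qed

text \<open>A finite section of the Toeplitz matrix is multiplication by the symbol, followed by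
  taking Fourier coefficients. Bessel bounds the selected coefficients of the product by its mean
  square, the symbol costs a factor \<open>c\<close>, and Parseval evaluates the mean square of the
  input polynomial \<open>s\<close>.\<close>

lemma norm_toep_finite_le:
  "(\<Sum>n<N. (norm (\<Sum>j<M. \<Phi> (int n - int j) *\<^sub>V e j))\<^sup>2) \<le> c\<^sup>2 * (\<Sum>j<M. (norm (e j))\<^sup>2)"
proof -
  define s where "s t = (\<Sum>j<M. cis (- of_int (int j) * t) *\<^sub>C e j)" for t
  have s: "continuous_on X s" for X
    unfolding s_def by (intro continuous_intros)
  have mean: "circle_mean (\<lambda>t. cis (of_int n * t) *\<^sub>C (symbol t *\<^sub>V s t)) = (\<Sum>j<M. \<Phi> (n - int j) *\<^sub>V e j)" for n
  proof -
    have "circle_mean (\<lambda>t. cis (of_int n * t) *\<^sub>C (symbol t *\<^sub>V s t))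
        = circle_mean (\<lambda>t. \<Sum>j<M. (cis (of_int (n - int j) * t) *\<^sub>C symbol t) *\<^sub>V e j)"
      by (intro circle_mean_cong)
        (simp add: s_def cblinfun_sum_right scaleC_sum_right scaleC_scaleC cis_mult algebra_simps)
    also have "\<dots> = (\<Sum>j<M. circle_mean (\<lambda>t. (cis (of_int (n - int j) * t) *\<^sub>C symbol t) *\<^sub>V e j))"
      by (intro circle_mean_sum continuous_intros) simp
    also have "\<dots> = (\<Sum>j<M. \<Phi> (n - int j) *\<^sub>V e j)"
      unfolding \<Phi>_def
      by (intro sum.cong refl circle_mean_linear[OF bounded_linear_cblinfun_left] continuous_intros)
    finally show ?thesis .
  qed
  have "(\<Sum>n<N. (norm (\<Sum>j<M. \<Phi> (int n - int j) *\<^sub>V e j))\<^sup>2)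
      = (\<Sum>n\<in>int ` {..<N}. (norm (circle_mean (\<lambda>t. cis (of_int n * t) *\<^sub>C (symbol t *\<^sub>V s t))))\<^sup>2)"
    by (simp add: sum.reindex mean[symmetric])
  also have "\<dots> \<le> circle_mean (\<lambda>t. (norm (symbol t *\<^sub>V s t))\<^sup>2)"
    by (intro bessel continuous_intros s) simp
  also have "\<dots> \<le> circle_mean (\<lambda>t. c\<^sup>2 * (norm (s t))\<^sup>2)"
  proof (intro circle_mean_mono continuous_intros s)
    fix t
    have "norm (symbol t *\<^sub>V s t) \<le> c * norm (s t)"
      using norm_symbol_le[of t]
      by (intro order_trans[OF norm_cblinfun] mult_right_mono) (simp_all add: symbol_def)
    then show "(norm (symbol t *\<^sub>V s t))\<^sup>2 \<le> c\<^sup>2 * (norm (s t))\<^sup>2"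
      by (metis norm_ge_zero power_mono power_mult_distrib)
  qed
  also have "\<dots> = c\<^sup>2 * circle_mean (\<lambda>t. (norm (s t))\<^sup>2)"
    by (intro circle_mean_linear[OF bounded_linear_mult_right] continuous_intros s)
  also have "circle_mean (\<lambda>t. (norm (s t))\<^sup>2)
      = circle_mean (\<lambda>t. (norm (\<Sum>n\<in>int ` {..<M}. cis (- of_int n * t) *\<^sub>C e (nat n)))\<^sup>2)"
    by (intro circle_mean_cong) (simp add: s_def sum.reindex)
  also have "\<dots> = (\<Sum>n\<in>int ` {..<M}. (norm (e (nat n)))\<^sup>2)"
    by (rule parseval) simp
  also have "\<dots> = (\<Sum>j<M. (norm (e j))\<^sup>2)"
    by (simp add: sum.reindex)
  finally show ?thesis .
qed

section \<open>Bounded state responses to bounded inputs\<close>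

lemma norm_conv_term_le:
  assumes "\<And>j. norm (e j) \<le> M"
  shows "norm (R (int n - 1 - int j) *\<^sub>V (B *\<^sub>V e j)) \<le> norm (R (int n - 1 - int j)) * (norm B * M)"
  by (intro order_trans[OF norm_cblinfun] mult_left_mono assms) simp_all

lemma summable_norm_conv:
  assumes "\<And>j. norm (e j) \<le> M"
  shows "summable (\<lambda>j. norm (R (int n - 1 - int j) *\<^sub>V (B *\<^sub>V e j)))"
proof (rule summable_comparison_test')
  show "summable (\<lambda>j. norm (R (int n - 1 - int j)) * (norm B * M))"
    by (intro summable_mult2 summable_norm_R_row)
  show "norm (norm (R (int n - 1 - int j) *\<^sub>V (B *\<^sub>V e j))) \<le> norm (R (int n - 1 - int j)) * (norm B * M)" for j
    unfolding real_norm_def abs_norm_cancel by (rule norm_conv_term_le[of e, OF assms])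
qed

lemma sums_conv:
  assumes "\<And>j. norm (e j) \<le> M"
  shows "(\<lambda>j. R (int n - 1 - int j) *\<^sub>V (B *\<^sub>V e j)) sums conv e n"
  unfolding conv_def by (rule summable_sums[OF summable_norm_cancel[OF summable_norm_conv[of e, OF assms]]])

lemma norm_conv_le:
  assumes "\<And>j. norm (e j) \<le> M"
  shows "norm (conv e n) \<le> L * (norm B * M)"
proof -
  have M: "0 \<le> M"
    using assms[of 0] norm_ge_zero[of "e 0"] by linarith
  have "norm (conv e n) \<le> (\<Sum>j. norm (R (int n - 1 - int j) *\<^sub>V (B *\<^sub>V e j)))"
    unfolding conv_def by (rule summable_norm[OF summable_norm_conv[of e, OF assms]])
  also have "\<dots> \<le> L * (norm B * M)"
  proof (rule suminf_le_const[OF summable_norm_conv[of e, OF assms]])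
    fix N
    have "(\<Sum>j<N. norm (R (int n - 1 - int j) *\<^sub>V (B *\<^sub>V e j)))
        \<le> (\<Sum>j<N. norm (R (int n - 1 - int j)) * (norm B * M))"
      by (intro sum_mono norm_conv_term_le assms)
    also have "\<dots> \<le> L * (norm B * M)"
      unfolding sum_distrib_right[symmetric] using M by (intro mult_right_mono sum_norm_R_row_le) simp
    finally show "(\<Sum>j<N. norm (R (int n - 1 - int j) *\<^sub>V (B *\<^sub>V e j))) \<le> L * (norm B * M)" .
  qed
  finally show ?thesis .
qed

lemma conv_add:
  assumes "\<And>j. norm (e j) \<le> M" and "\<And>j. norm (f j) \<le> M'"
  shows "conv (\<lambda>j. e j + f j) n = conv e n + conv f n"
proof -
  have "(\<lambda>j. R (int n - 1 - int j) *\<^sub>V (B *\<^sub>V e j) + R (int n - 1 - int j) *\<^sub>V (B *\<^sub>V f j))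
      sums (conv e n + conv f n)"
    by (intro sums_add sums_conv[of e, OF assms(1)] sums_conv[of f, OF assms(2)])
  then show ?thesis
    unfolding conv_def[of "\<lambda>j. e j + f j"] by (simp add: cblinfun_add_right sums_unique[symmetric])
qed

lemma conv_Suc:
  assumes "\<And>j. norm (e j) \<le> M"
  shows "conv e (Suc n) = A *\<^sub>V conv e n + B *\<^sub>V e n"
proof -
  have "R (int n - int j) *\<^sub>V (B *\<^sub>V e j)
      = A *\<^sub>V (R (int n - 1 - int j) *\<^sub>V (B *\<^sub>V e j)) + (if j = n then B *\<^sub>V e j else 0)" for j
  proof -
    have "R (int n - int j) = A o\<^sub>C\<^sub>L R (int n - 1 - int j) + (if j = n then id_cblinfun else 0)"
      using R_rec[of "int n - int j"] by (auto simp: algebra_simps split: if_splits)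
    then show ?thesis by simp
  qed
  moreover have "(\<lambda>j. A *\<^sub>V (R (int n - 1 - int j) *\<^sub>V (B *\<^sub>V e j)) + (if j = n then B *\<^sub>V e j else 0))
      sums (A *\<^sub>V conv e n + B *\<^sub>V e n)"
    by (intro sums_add bounded_linear.sums[OF bounded_linear_cblinfun_right] sums_conv[of e, OF assms] sums_single)
  ultimately have "(\<lambda>j. R (int n - int j) *\<^sub>V (B *\<^sub>V e j)) sums (A *\<^sub>V conv e n + B *\<^sub>V e n)"
    by simp
  then show ?thesis
    by (simp add: conv_def sums_unique[symmetric])
qed

text \<open>At time 0 every index \<open>- 1 - j\<close> is negative, so only the unstable part
  responds. Subtracting \<open>conv e\<close> from an orbit therefore leaves the \<open>P\<close>
  component of its initial vector untouched.\<close>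

lemma P_conv_0:
  assumes "\<And>j. norm (e j) \<le> M"
  shows "P *\<^sub>V conv e 0 = 0"
proof -
  have "P *\<^sub>V (R (int 0 - 1 - int j) *\<^sub>V y) = 0" for j y
    using P_R_neg[of "int 0 - 1 - int j"] by (simp flip: cblinfun_apply_simps(7))
  moreover have "(\<lambda>j. P *\<^sub>V (R (int 0 - 1 - int j) *\<^sub>V (B *\<^sub>V e j))) sums (P *\<^sub>V conv e 0)"
    by (intro bounded_linear.sums[OF bounded_linear_cblinfun_right] sums_conv[of e, OF assms])
  ultimately have "(\<lambda>j. 0) sums (P *\<^sub>V conv e 0)"
    by (simp only:)
  then show ?thesis
    by (rule sums_unique2) (rule sums_zero)
qed

section \<open>The Toeplitz operator on square-summable and on bounded inputs\<close>

lemma sums_toep: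
  assumes "\<And>j. norm (e j) \<le> M"
  shows "(\<lambda>j. \<Phi> (int n - int j) *\<^sub>V e j) sums toep e n"
proof -
  have "(\<lambda>j. (if j = n then D *\<^sub>V e j else 0) + C *\<^sub>V (R (int n - 1 - int j) *\<^sub>V (B *\<^sub>V e j))) sums toep e n"
    unfolding toep_def
    by (intro sums_add bounded_linear.sums[OF bounded_linear_cblinfun_right] sums_conv[of e, OF assms] sums_single)
  moreover have "(if j = n then D *\<^sub>V e j else 0) + C *\<^sub>V (R (int n - 1 - int j) *\<^sub>V (B *\<^sub>V e j))
      = \<Phi> (int n - int j) *\<^sub>V e j" for j
    by (simp add: \<Phi>_eq algebra_simps)
  ultimately show ?thesis by simp
qed

text \<open>In the finite bound the number \<open>M\<close> of inputs tends to infinity while the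
  number \<open>N\<close> of outputs stays fixed, so only finitely many limits are taken at
  once.\<close>

lemma square_bounded_toep:
  assumes e: "square_bounded e E"
  shows "square_bounded (toep e) (c * E)"
  unfolding square_bounded_def
proof (intro conjI allI)
  show "0 \<le> c * E"
    using e c_nonneg by (simp add: square_bounded_def)
  fix N
  have "(\<lambda>M. \<Sum>j<M. \<Phi> (int n - int j) *\<^sub>V e j) \<longlonglongrightarrow> toep e n" for n
    using sums_toep[of e, OF square_bounded_norm_le[OF e]] by (simp add: sums_def)
  then have "(\<lambda>M. \<Sum>n<N. (norm (\<Sum>j<M. \<Phi> (int n - int j) *\<^sub>V e j))\<^sup>2) \<longlonglongrightarrow> (\<Sum>n<N. (norm (toep e n))\<^sup>2)"
    by (intro tendsto_sum tendsto_power tendsto_norm)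
  moreover have "(\<Sum>n<N. (norm (\<Sum>j<M. \<Phi> (int n - int j) *\<^sub>V e j))\<^sup>2) \<le> (c * E)\<^sup>2" for M
  proof -
    have "c\<^sup>2 * (\<Sum>j<M. (norm (e j))\<^sup>2) \<le> c\<^sup>2 * E\<^sup>2"
      using e by (intro mult_left_mono) (simp_all add: square_bounded_def)
    then show ?thesis
      using norm_toep_finite_le[where N = N and M = M and e = e] by (simp add: power_mult_distrib)
  qed
  ultimately show "(\<Sum>n<N. (norm (toep e n))\<^sup>2) \<le> (c * E)\<^sup>2"
    by (intro LIMSEQ_le_const2) auto
qed

text \<open>The gain on bounded sequences, which may well exceed one. It controls the operator on
  the tails of the Neumann series, which are already small.\<close>

lemma norm_toep_le:
  assumes "\<And>j. norm (e j) \<le> M"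
  shows "norm (toep e n) \<le> (norm D + norm C * (L * norm B)) * M"
proof -
  have "norm (D *\<^sub>V e n) \<le> norm D * M"
    by (intro order_trans[OF norm_cblinfun] mult_left_mono assms) simp
  moreover have "norm (C *\<^sub>V conv e n) \<le> norm C * (L * (norm B * M))"
    by (intro order_trans[OF norm_cblinfun] mult_left_mono norm_conv_le assms) simp
  ultimately show ?thesis
    unfolding toep_def using norm_triangle_ineq[of "D *\<^sub>V e n" "C *\<^sub>V conv e n"]
    by (simp add: algebra_simps)
qed

lemma toep_add:
  assumes "\<And>j. norm (e j) \<le> M" and "\<And>j. norm (f j) \<le> M'"
  shows "toep (\<lambda>j. e j + f j) n = toep e n + toep f n"
proof -
  have "conv (\<lambda>j. e j + f j) n = conv e n + conv f n"
    using assms by (rule conv_add)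
  then show ?thesis
    by (simp only: toep_def cblinfun_add_right add_ac)
qed

lemma toep_zero: "toep (\<lambda>_. 0) n = 0"
  by (simp add: toep_def conv_def)

text \<open>The Neumann series for \<open>I + T\<^sub>F\<close> is summed pointwise, which avoids setting up the space
  \<open>\<ell>\<^sup>2\<close>: all partial sums are uniformly bounded since \<open>T\<^sub>F\<close> contracts square sums.\<close>

lemma toeplitz_solvable:
  assumes \<phi>: "square_bounded \<phi> E"
  obtains g where "\<And>n. norm (g n) \<le> E / (1 - c)" and "\<And>n. g n + toep g n = \<phi> n"
proof
  \<comment> \<open>The terms of the Neumann series: \<open>d i\<close> is the \<open>i\<close>-th
    power of minus the Toeplitz operator, applied to \<open>\<phi>\<close>.\<close>
  define d where "d i = ((\<lambda>e n. - toep e n) ^^ i) \<phi>" for i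
  have d_Suc: "d (Suc i) n = - toep (d i) n" and d_0: "d 0 = \<phi>" for i n
    by (simp_all add: d_def)
  have sq: "square_bounded (d i) (c ^ i * E)" for i
  proof (induction i)
    case (Suc i)
    then have "square_bounded (toep (d i)) (c * (c ^ i * E))"
      by (rule square_bounded_toep)
    then show ?case
      by (simp add: square_bounded_def d_Suc mult.assoc)
  qed (simp add: d_0 \<phi>)
  then have d_le: "norm (d i n) \<le> c ^ i * E" for i n
    by (rule square_bounded_norm_le)
  have geom: "summable (\<lambda>i. c ^ (i + m) * E)" "(\<Sum>i. c ^ (i + m) * E) = c ^ m * (E / (1 - c))" for m
  proof -
    have "(\<lambda>i. c ^ i * (c ^ m * E)) sums (1 / (1 - c) * (c ^ m * E))"
      using c_nonneg c_less_1 by (intro sums_mult2 geometric_sums) simp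
    then show "summable (\<lambda>i. c ^ (i + m) * E)" "(\<Sum>i. c ^ (i + m) * E) = c ^ m * (E / (1 - c))"
      by (simp_all add: power_add mult_ac sums_iff)
  qed
  define g where "g n = (\<Sum>i. d i n)" for n
  have sum_norm: "summable (\<lambda>i. norm (d (i + m) n))" for m n
    by (rule summable_comparison_test'[OF geom(1)[of m]]) (simp add: d_le)
  have tail: "norm (\<Sum>i. d (i + m) n) \<le> c ^ m * (E / (1 - c))" for m n
  proof -
    have "norm (\<Sum>i. d (i + m) n) \<le> (\<Sum>i. norm (d (i + m) n))"
      by (rule summable_norm[OF sum_norm])
    also have "\<dots> \<le> (\<Sum>i. c ^ (i + m) * E)"
      by (intro suminf_le d_le sum_norm geom)
    finally show ?thesis by (simp only: geom)
  qed
  have summ: "summable (\<lambda>i. d i n)" for n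
    using summable_norm_cancel[OF sum_norm[of 0 n]] by simp
  show g_le: "norm (g n) \<le> E / (1 - c)" for n
    using tail[of 0 n] by (simp add: g_def)
  define s where "s m n = (\<Sum>i<m. d i n)" for m n
  have s_le: "norm (s m j) \<le> (\<Sum>i<m. c ^ i * E)" for m j
    unfolding s_def by (intro order_trans[OF norm_sum] sum_mono d_le)
  have toep_s: "toep (s m) n = - (\<Sum>i<m. d (Suc i) n)" for m n
  proof (induction m)
    case (Suc m)
    have "s (Suc m) = (\<lambda>j. s m j + d m j)"
      by (rule ext) (simp add: s_def)
    then have "toep (s (Suc m)) n = toep (\<lambda>j. s m j + d m j) n"
      by simp
    also have "\<dots> = toep (s m) n + toep (d m) n"
      by (rule toep_add[of "s m", OF s_le d_le])
    finally show ?case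
      using Suc by (simp add: d_Suc)
  next
    case 0
    have "s 0 = (\<lambda>_. 0)"
      by (rule ext) (simp add: s_def)
    then show ?case
      by (simp add: toep_zero)
  qed
  have g_split: "g j = s m j + (\<Sum>i. d (i + m) j)" for m j
    unfolding g_def s_def using suminf_split_initial_segment[OF summ, of j m] by simp
  show "g n + toep g n = \<phi> n" for n
  proof -
    let ?\<Theta> = "norm D + norm C * (L * norm B)"
    \<comment> \<open>Split \<open>g\<close> after \<open>m\<close> terms. The partial sums
      telescope, leaving the tail after \<open>m + 1\<close> terms plus the Toeplitz operator on the
      tail after \<open>m\<close> terms; these account for \<open>c\<close> and for the gain
      \<open>?\<Theta>\<close>.\<close>
    have "norm (g n + toep g n - \<phi> n) \<le> c ^ m * ((c + ?\<Theta>) * (E / (1 - c)))" for m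
    proof -
      have "toep g n = toep (\<lambda>j. s m j + (\<Sum>i. d (i + m) j)) n"
        using g_split[of _ m] by presburger
      also have "\<dots> = toep (s m) n + toep (\<lambda>j. \<Sum>i. d (i + m) j) n"
        by (rule toep_add[of "s m", OF s_le tail])
      also have "toep (s m) n = \<phi> n - s (Suc m) n"
        unfolding toep_s s_def by (simp add: sum.lessThan_Suc_shift d_0 del: sum.lessThan_Suc)
      finally have "g n + toep g n - \<phi> n = (\<Sum>i. d (i + Suc m) n) + toep (\<lambda>j. \<Sum>i. d (i + m) j) n"
        using g_split[of n "Suc m"] by simp
      then have "norm (g n + toep g n - \<phi> n) \<le> c ^ Suc m * (E / (1 - c)) + ?\<Theta> * (c ^ m * (E / (1 - c)))"
        using norm_triangle_mono[OF tail[of "Suc m" n] norm_toep_le[of "\<lambda>j. \<Sum>i. d (i + m) j", OF tail, of n]]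
        by simp
      then show ?thesis
        by (simp add: algebra_simps)
    qed
    moreover have "(\<lambda>m. c ^ m * ((c + ?\<Theta>) * (E / (1 - c)))) \<longlonglongrightarrow> 0"
      using c_nonneg c_less_1 by (intro tendsto_mult_left_zero LIMSEQ_power_zero) simp
    ultimately have "norm (g n + toep g n - \<phi> n) \<le> 0"
      by (intro LIMSEQ_le_const) auto
    then show ?thesis by simp
  qed
qed

text \<open>A solution satisfies \<open>toep g = - g\<close>, so every square bound of
  \<open>g\<close> may be multiplied by \<open>c\<close> again and again.\<close>

lemma toeplitz_injective:
  assumes g: "square_bounded g E" and eq: "\<And>n. g n + toep g n = 0"
  shows "g n = 0"
proof -
  have "square_bounded g (c ^ m * E)" for m
  proof (induction m)
    case (Suc m)
    then have "square_bounded (toep g) (c * (c ^ m * E))"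
      by (rule square_bounded_toep)
    moreover have "norm (toep g n) = norm (g n)" for n
      using eq[of n] by (metis add.commute minus_unique norm_minus_cancel)
    ultimately show ?case
      by (simp add: square_bounded_def mult.assoc)
  qed (simp add: g)
  then have "norm (g n) \<le> c ^ m * E" for m
    by (rule square_bounded_norm_le)
  moreover have "(\<lambda>m. c ^ m * E) \<longlonglongrightarrow> 0"
    using c_nonneg c_less_1 by (intro tendsto_mult_left_zero LIMSEQ_power_zero) simp
  ultimately have "norm (g n) \<le> 0"
    by (intro LIMSEQ_le_const) auto
  then show ?thesis by simp
qed

end

section \<open>The associate operator\<close>

lemma dichotomousI:
  assumes "\<And>t. invertible_cblinfun (id_cblinfun - cis t *\<^sub>C A)"
  shows "dichotomous A"
proof -
  have "invertible_cblinfun (z *\<^sub>C id_cblinfun - A)" if "cmod z = 1" for z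
  proof -
    have "z \<noteq> 0" using that by auto
    have "inverse z = cis (Arg (inverse z))"
      using cis_Arg[of "inverse z"] that \<open>z \<noteq> 0\<close> by (simp add: sgn_div_norm norm_inverse)
    then have "invertible_cblinfun (z *\<^sub>C (id_cblinfun - inverse z *\<^sub>C A))"
      using assms[of "Arg (inverse z)"] \<open>z \<noteq> 0\<close> by (simp add: invertible_scaleC)
    then show ?thesis
      using \<open>z \<noteq> 0\<close> by (simp add: scaleC_diff_right scaleC_scaleC scaleC_one)
  qed
  then show ?thesis
    by (auto simp: dichotomous_def spectrum_def)
qed

context contractive_realization
begin

definition Ax :: "'x \<Rightarrow>\<^sub>C\<^sub>L 'x"
  where "Ax = A - B o\<^sub>C\<^sub>L inverse_cblinfun (id_cblinfun + D) o\<^sub>C\<^sub>L C"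

text \<open>With \<open>X = I - z A\<close>, factor
  \<open>I - z Ax = X (I + X^-1 B z (I + D)^-1 C)\<close>. Swapping the operators in the second
  factor leads to \<open>I + z (I + D)^-1 C X^-1 B = (I + D)^-1 (I + F z)\<close>, and
  \<open>I + F z\<close> is invertible because \<open>F z\<close> is a strict contraction.\<close>

lemma dichotomous_Ax: "dichotomous Ax"
proof (rule dichotomousI)
  fix t
  let ?E = "inverse_cblinfun (id_cblinfun + D)" and ?z = "cis t"
  let ?X = "id_cblinfun - ?z *\<^sub>C A"
  note \<rho> = \<rho>_def[of "- t", simplified]
  have X: "invertible_cblinfun ?X"
    by (rule invertible_cis)
  define F where "F = D + ?z *\<^sub>C (C o\<^sub>C\<^sub>L \<rho> (- t) o\<^sub>C\<^sub>L B)"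
  have "norm (- F) < 1"
    using norm_symbol_le[of "- t"] c_less_1 unfolding norm_minus_cancel F_def by simp
  then have "invertible_cblinfun (id_cblinfun - (- F))"
    by (rule invertible_id_minus)
  moreover have "invertible_cblinfun ?E"
    using inverse_cblinfun[OF invertible_ID] by (auto intro: invertible_cblinfunI)
  ultimately have "invertible_cblinfun (?E o\<^sub>C\<^sub>L (id_cblinfun - (- F)))"
    by (intro invertible_compose(1))
  also have "?E o\<^sub>C\<^sub>L (id_cblinfun - (- F)) = ?E o\<^sub>C\<^sub>L (id_cblinfun + D) + ?z *\<^sub>C (?E o\<^sub>C\<^sub>L C o\<^sub>C\<^sub>L \<rho> (- t) o\<^sub>C\<^sub>L B)"
    unfolding diff_minus_eq_add by (simp add: F_def compose_add_right compose_assoc add.assoc)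
  also have "\<dots> = id_cblinfun + (?z *\<^sub>C (?E o\<^sub>C\<^sub>L C)) o\<^sub>C\<^sub>L (\<rho> (- t) o\<^sub>C\<^sub>L B)"
    by (simp add: inverse_cblinfun(1)[OF invertible_ID] compose_assoc)
  finally have "invertible_cblinfun (?X o\<^sub>C\<^sub>L (id_cblinfun + (\<rho> (- t) o\<^sub>C\<^sub>L B) o\<^sub>C\<^sub>L (?z *\<^sub>C (?E o\<^sub>C\<^sub>L C))))"
    by (rule invertible_compose(1)[OF X invertible_id_plus_swap])
  also have "?X o\<^sub>C\<^sub>L (id_cblinfun + (\<rho> (- t) o\<^sub>C\<^sub>L B) o\<^sub>C\<^sub>L (?z *\<^sub>C (?E o\<^sub>C\<^sub>L C)))
      = ?X + ?z *\<^sub>C (?X o\<^sub>C\<^sub>L (\<rho> (- t) o\<^sub>C\<^sub>L (B o\<^sub>C\<^sub>L (?E o\<^sub>C\<^sub>L C))))"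
    by (simp only: compose_add_right compose_id_right compose_scaleC_right compose_assoc)
  also have "\<dots> = id_cblinfun - ?z *\<^sub>C Ax"
    unfolding \<rho> inverse_cancel(2)[OF X]
    by (simp add: Ax_def scaleC_diff_right compose_assoc)
  finally show "invertible_cblinfun (id_cblinfun - ?z *\<^sub>C Ax)" .
qed

sublocale assoc: dichotomous_operator Ax
  by unfold_locales (rule dichotomous_Ax)

text \<open>Solve the Toeplitz equation for the input \<open>g\<close> whose orbit \<open>h\<close> under \<open>A\<close> starts at the prescribed
  component in \<open>dich_plus A\<close> and stays bounded; that orbit is an orbit of \<open>Ax\<close>, so it starts
  in \<open>dich_plus Ax\<close>.\<close>

lemma decomposition_exists:
  obtains M where "\<And>x. \<exists>y. y \<in> dich_plus Ax \<and> x - y \<in> dich_minus A \<and> norm y \<le> M * norm x"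
proof
  fix x
  define \<phi> where "\<phi> n = C *\<^sub>V (R (int n) *\<^sub>V x)" for n
  define E where "E = norm C * (K * norm x) / (1 - c)"
  have "square_bounded \<phi> (norm C * (K * norm x))"
    unfolding \<phi>_def by (intro square_bounded_cblinfun square_bounded_R)
  then obtain g where g_le: "\<And>n. norm (g n) \<le> E" and g: "\<And>n. g n + toep g n = \<phi> n"
    using toeplitz_solvable unfolding E_def by blast
  define h where "h n = R (int n) *\<^sub>V x - conv g n" for n
  \<comment> \<open>The Toeplitz equation reads
    \<open>g n + D g n + C (conv g n) = C (R n x)\<close>; moving the convolution term to the right
    produces \<open>C h n\<close>.\<close>
  have "C *\<^sub>V h n = (id_cblinfun + D) *\<^sub>V g n" for n
    using g[of n] by (simp add: h_def cblinfun_diff_right \<phi>_def toep_def algebra_simps)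
  then have feedback: "inverse_cblinfun (id_cblinfun + D) *\<^sub>V (C *\<^sub>V h n) = g n" for n
    by (simp only: inverse_cancel(3)[OF invertible_ID])
  have h_Suc: "h (Suc n) = Ax *\<^sub>V h n" for n
  proof -
    have "R (int (Suc n)) = A o\<^sub>C\<^sub>L R (int n)"
      by (subst A_R) (auto simp: add.commute)
    then have "h (Suc n) = A *\<^sub>V h n - B *\<^sub>V g n"
      unfolding h_def conv_Suc[of g, OF g_le] by (simp add: cblinfun_diff_right)
    then show ?thesis
      by (simp add: Ax_def feedback)
  qed
  \<comment> \<open>The constant must not depend on \<open>x\<close>: \<open>K\<close> bounds the
    free response, and the second summand is the gain of \<open>conv\<close> on an input bounded by
    \<open>E\<close>, which is linear in \<open>norm x\<close>.\<close>
  define M where "M = K + L * (norm B * (norm C * K / (1 - c)))"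
  have h_le: "norm (h n) \<le> M * norm x" for n
  proof -
    have "norm (R (int n) *\<^sub>V x) \<le> K * norm x"
      by (intro order_trans[OF norm_cblinfun] mult_right_mono norm_R_le) simp
    moreover have "norm (conv g n) \<le> L * (norm B * E)"
      by (rule norm_conv_le) (rule g_le)
    ultimately have "norm (h n) \<le> K * norm x + L * (norm B * E)"
      unfolding h_def using norm_triangle_ineq4[of "R (int n) *\<^sub>V x" "conv g n"] by linarith
    then show ?thesis
      by (simp add: M_def E_def algebra_simps)
  qed
  have "assoc.P *\<^sub>V h 0 = h 0"
    using h_Suc h_le by (rule assoc.bounded_orbit_in_dich_plus)
  moreover have "P *\<^sub>V (x - h 0) = 0"
    using P_conv_0[of g, OF g_le]
    by (simp add: h_def cblinfun_diff_right spectral_projection_eq[symmetric])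
  ultimately show "\<exists>y. y \<in> dich_plus Ax \<and> x - y \<in> dich_minus A \<and>
      norm y \<le> (K + L * (norm B * (norm C * K / (1 - c)))) * norm x"
    using h_le[of 0] by (intro exI[of _ "h 0"]) (simp add: assoc.mem_dich_plus mem_dich_minus M_def)
qed

text \<open>The \<open>Ax\<close> orbit of a common vector is an \<open>A\<close> orbit driven by
  \<open>- B g\<close>, and Bessel for \<open>Ax\<close> makes \<open>g\<close> square summable.
  Adding \<open>conv g\<close> cancels the drive and leaves a bounded \<open>A\<close> orbit whose
  initial vector lies in both members of the pair of \<open>A\<close>, hence vanishes. Thus
  \<open>h = - conv g\<close>, and \<open>g\<close> solves the homogeneous Toeplitz
  equation.\<close>

lemma dich_minus_Int_dich_plus: "dich_minus A \<inter> dich_plus Ax = {0}"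
proof -
  have "x = 0" if "P *\<^sub>V x = 0" and "assoc.P *\<^sub>V x = x" for x
  proof -
    define T where "T = inverse_cblinfun (id_cblinfun + D) o\<^sub>C\<^sub>L C"
    define h where "h n = assoc.R (int n) *\<^sub>V x" for n
    define g where "g n = T *\<^sub>V h n" for n
    have g_sq: "square_bounded g (norm T * (assoc.K * norm x))"
      unfolding g_def h_def by (intro square_bounded_cblinfun assoc.square_bounded_R)
    note g_le = square_bounded_norm_le[OF g_sq]
    have h_0: "h 0 = x"
      using that by (simp add: h_def assoc.spectral_projection_eq)
    have h_Suc: "h (Suc n) = A *\<^sub>V h n - B *\<^sub>V g n" for n
    proof -
      have "assoc.R (int (Suc n)) = Ax o\<^sub>C\<^sub>L assoc.R (int n)"
        by (subst assoc.A_R) (auto simp: add.commute)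
      then show ?thesis
        by (simp add: h_def g_def T_def Ax_def)
    qed
    define d where "d n = h n + conv g n" for n
    have d_Suc: "d (Suc n) = A *\<^sub>V d n" for n
      unfolding d_def h_Suc conv_Suc[of g, OF g_le] by (simp add: cblinfun_add_right)
    have "norm (d n) \<le> assoc.K * norm x + L * (norm B * (norm T * (assoc.K * norm x)))" for n
      unfolding d_def h_def
      by (intro norm_triangle_mono norm_conv_le[of g, OF g_le] order_trans[OF norm_cblinfun]
          mult_right_mono assoc.norm_R_le) simp
    with d_Suc have "P *\<^sub>V d 0 = d 0"
      by (rule bounded_orbit_in_dich_plus)
    moreover have "P *\<^sub>V d 0 = 0"
      using P_conv_0[of g, OF g_le] that by (simp add: d_def h_0 cblinfun_add_right)
    ultimately have "d n = 0" for n
      by (induction n) (simp_all add: d_Suc)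
    then have h_eq: "h n = - conv g n" for n
      unfolding d_def by (simp add: eq_neg_iff_add_eq_0)
    have "g n + toep g n = 0" for n
    proof -
      have "(id_cblinfun + D) *\<^sub>V g n = C *\<^sub>V h n"
        unfolding g_def T_def cblinfun_apply_simps(7) by (rule inverse_cancel(4)[OF invertible_ID])
      then show ?thesis
        by (simp add: toep_def h_eq cblinfun_minus_right add.assoc[symmetric])
    qed
    then have "g = (\<lambda>_. 0)"
      using toeplitz_injective[OF g_sq] by blast
    then show "x = 0"
      using h_eq[of 0] by (simp add: h_0 conv_def)
  qed
  then show ?thesis
    by (auto simp: mem_dich_minus assoc.mem_dich_plus)
qed

end

section \<open>Projections\<close>

lemma cblinfun_exists:
  fixes f :: "'a::complex_normed_vector \<Rightarrow> 'b::complex_normed_vector"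
  assumes "\<And>x y. f (x + y) = f x + f y" and "\<And>a x. f (a *\<^sub>C x) = a *\<^sub>C f x"
    and "\<And>x. norm (f x) \<le> M * norm x"
  obtains T where "\<And>x. T *\<^sub>V x = f x"
proof
  have "bounded_linear f"
    using assms by (intro bounded_linear_intro[where K = M]) (simp_all add: scaleR_scaleC mult.commute)
  then have f: "blinfun_apply (Blinfun f) = f"
    by (rule bounded_linear_Blinfun_apply)
  show "CBlinfun (Blinfun f) *\<^sub>V x = f x" for x
    by (simp add: cblinfun_apply.rep_eq CBlinfun_inverse f assms)
qed

text \<open>Uniqueness of the decomposition makes the chosen component additive and homogeneous; the
  assumed estimate makes it bounded.\<close>

lemma projection_exists:
  assumes M: "closed_csubspace M" and N: "closed_csubspace N" and int: "N \<inter> M = {0}"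
    and ex: "\<And>x. \<exists>y. y \<in> M \<and> x - y \<in> N \<and> norm y \<le> b * norm x"
  obtains Q where "is_projection_onto_along Q M N"
proof -
  obtain f where f: "\<And>x. f x \<in> M" "\<And>x. x - f x \<in> N" "\<And>x. norm (f x) \<le> b * norm x"
    using ex by metis
  have sub: "x + y \<in> V" "a *\<^sub>C x \<in> V" "0 \<in> V"
    if "closed_csubspace V" "x \<in> V" "y \<in> V" for V :: "'a set" and x y a
    using that by (auto simp: closed_csubspace_def)
  have diff: "x - y \<in> V" if "closed_csubspace V" "x \<in> V" "y \<in> V" for V :: "'a set" and x y
    using sub(1)[OF that(1,2), of "(-1) *\<^sub>C y"] sub(2)[OF that(1,3,3), of "- 1"]
    by (simp add: scaleC_minus_left scaleC_one)
  have unique: "f x = y" if "y \<in> M" "x - y \<in> N" for x y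
  proof -
    have "(x - y) - (x - f x) \<in> N"
      by (rule diff[OF N that(2) f(2)])
    moreover have "f x - y \<in> M"
      by (rule diff[OF M f(1) that(1)])
    ultimately have "f x - y \<in> N \<inter> M"
      by simp
    then show ?thesis
      unfolding int by simp
  qed
  have "f (x + y) = f x + f y" for x y
  proof (rule unique)
    have "(x - f x) + (y - f y) \<in> N"
      by (rule sub(1)[OF N f(2) f(2)])
    then show "x + y - (f x + f y) \<in> N"
      by (simp add: algebra_simps)
    show "f x + f y \<in> M"
      by (rule sub(1)[OF M f(1) f(1)])
  qed
  moreover have "f (a *\<^sub>C x) = a *\<^sub>C f x" for a x
  proof (rule unique)
    show "a *\<^sub>C x - a *\<^sub>C f x \<in> N"
      unfolding scaleC_diff_right[symmetric] by (rule sub(2)[OF N f(2) f(2)])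
    show "a *\<^sub>C f x \<in> M"
      by (rule sub(2)[OF M f(1) f(1)])
  qed
  ultimately obtain Q where Q: "\<And>x. Q *\<^sub>V x = f x"
    using cblinfun_exists[of f b] f(3) by blast
  have f_fix: "f y = y" if "y \<in> M" for y
    using that sub(3)[OF N f(2) f(2)] by (intro unique) simp_all
  have "f x = 0 \<longleftrightarrow> x \<in> N" for x
    using unique[of 0 x] sub(3)[OF M f(1) f(1)] f(2)[of x] by auto
  moreover have "range f = M"
  proof
    show "range f \<subseteq> M"
      using f(1) by blast
    show "M \<subseteq> range f"
    proof
      fix y assume "y \<in> M"
      then show "y \<in> range f"
        by (intro range_eqI[of _ f y]) (simp add: f_fix)
    qed
  qed
  moreover have "Q o\<^sub>C\<^sub>L Q = Q"
    by (rule cblinfun_eqI) (simp add: Q f_fix f(1))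
  ultimately have "is_projection_onto_along Q M N"
    by (simp add: is_projection_onto_along_def Q)
  then show ?thesis ..
qed

section \<open>Algebra of the factorization\<close>

text \<open>The quadratic term \<open>z^2 C S B C T B\<close> contains the sandwich
  \<open>S (z B C) T\<close>, which the hypothesis replaces by \<open>S - T\<close>; it then cancels
  the linear terms. In the applications, \<open>S\<close> and \<open>T\<close> are resolvents of
  \<open>A\<close> and \<open>Ax\<close> cut by the projection, and \<open>E = (I + D)^-1\<close> is
  merged into \<open>B\<close> or \<open>C\<close>.\<close>

lemma perturbed_identity_inverse:
  fixes S T :: "'x::complex_normed_vector \<Rightarrow>\<^sub>C\<^sub>L 'x"
  assumes "S o\<^sub>C\<^sub>L (z *\<^sub>C (B o\<^sub>C\<^sub>L C)) o\<^sub>C\<^sub>L T = S - T" and "T o\<^sub>C\<^sub>L (z *\<^sub>C (B o\<^sub>C\<^sub>L C)) o\<^sub>C\<^sub>L S = S - T"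
  shows "(id_cblinfun + z *\<^sub>C (C o\<^sub>C\<^sub>L S o\<^sub>C\<^sub>L B)) o\<^sub>C\<^sub>L (id_cblinfun - z *\<^sub>C (C o\<^sub>C\<^sub>L T o\<^sub>C\<^sub>L B)) = id_cblinfun"
    and "(id_cblinfun - z *\<^sub>C (C o\<^sub>C\<^sub>L T o\<^sub>C\<^sub>L B)) o\<^sub>C\<^sub>L (id_cblinfun + z *\<^sub>C (C o\<^sub>C\<^sub>L S o\<^sub>C\<^sub>L B)) = id_cblinfun"
proof -
  have expand: "(z *\<^sub>C (C o\<^sub>C\<^sub>L V o\<^sub>C\<^sub>L B)) o\<^sub>C\<^sub>L (z *\<^sub>C (C o\<^sub>C\<^sub>L W o\<^sub>C\<^sub>L B))
      = z *\<^sub>C (C o\<^sub>C\<^sub>L (V o\<^sub>C\<^sub>L (z *\<^sub>C (B o\<^sub>C\<^sub>L C)) o\<^sub>C\<^sub>L W) o\<^sub>C\<^sub>L B)" for V W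
    by (simp add: compose_assoc)
  show "(id_cblinfun + z *\<^sub>C (C o\<^sub>C\<^sub>L S o\<^sub>C\<^sub>L B)) o\<^sub>C\<^sub>L (id_cblinfun - z *\<^sub>C (C o\<^sub>C\<^sub>L T o\<^sub>C\<^sub>L B)) = id_cblinfun"
    "(id_cblinfun - z *\<^sub>C (C o\<^sub>C\<^sub>L T o\<^sub>C\<^sub>L B)) o\<^sub>C\<^sub>L (id_cblinfun + z *\<^sub>C (C o\<^sub>C\<^sub>L S o\<^sub>C\<^sub>L B)) = id_cblinfun"
    unfolding compose_diff_left compose_diff_right compose_add_left compose_add_right
      compose_id_left compose_id_right expand assms
    by (simp_all add: compose_distribs scaleC_diff_right)
qed

lemma extends_analyticallyI:
  assumes "open S" "K \<subseteq> S" "vanalytic_on H S"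
    and "\<And>z. z \<in> S \<Longrightarrow> z \<in> W \<Longrightarrow> f z = T + z *\<^sub>C (U o\<^sub>C\<^sub>L H z o\<^sub>C\<^sub>L V)"
  shows "extends_analytically f W K"
  unfolding extends_analytically_def
proof (intro exI conjI ballI)
  show "vanalytic_on (\<lambda>z. T + z *\<^sub>C (U o\<^sub>C\<^sub>L H z o\<^sub>C\<^sub>L V)) S"
    by (intro vanalytic_on_const_add vanalytic_on_scaleC_ident vanalytic_on_compose assms)
qed (use assms in auto)

text \<open>Writing \<open>X = I - z A\<close> and \<open>Y = I - z Ax\<close>, the coupling term \<open>z B (I + D)\<^sup>-\<^sup>1 C\<close> equals \<open>Y - X\<close>.\<close>

lemma coupling_identities:
  fixes X Y Q :: "'x::complex_normed_vector \<Rightarrow>\<^sub>C\<^sub>L 'x"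
  defines "Q' \<equiv> id_cblinfun - Q" and "X' \<equiv> inverse_cblinfun X" and "Y' \<equiv> inverse_cblinfun Y"
  assumes X: "invertible_cblinfun X" and Q: "Q o\<^sub>C\<^sub>L Q = Q"
    and QX: "Q o\<^sub>C\<^sub>L (X o\<^sub>C\<^sub>L Q') = 0" and QY: "Q' o\<^sub>C\<^sub>L (Y o\<^sub>C\<^sub>L Q) = 0"
  shows coupling_factor: "X' o\<^sub>C\<^sub>L Q' o\<^sub>C\<^sub>L (Y - X) o\<^sub>C\<^sub>L Q o\<^sub>C\<^sub>L X' = Q' o\<^sub>C\<^sub>L X' - X' o\<^sub>C\<^sub>L Q'"
    and coupling_minus: "invertible_cblinfun Y \<Longrightarrow>
      X' o\<^sub>C\<^sub>L Q' o\<^sub>C\<^sub>L (Y - X) o\<^sub>C\<^sub>L (Q' o\<^sub>C\<^sub>L Y') = X' o\<^sub>C\<^sub>L Q' - Q' o\<^sub>C\<^sub>L Y'"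
      "invertible_cblinfun Y \<Longrightarrow> Q o\<^sub>C\<^sub>L (X' o\<^sub>C\<^sub>L Q') = 0 \<Longrightarrow> Q' o\<^sub>C\<^sub>L (Y' o\<^sub>C\<^sub>L Q) = 0 \<Longrightarrow>
      Q' o\<^sub>C\<^sub>L Y' o\<^sub>C\<^sub>L (Y - X) o\<^sub>C\<^sub>L (X' o\<^sub>C\<^sub>L Q') = X' o\<^sub>C\<^sub>L Q' - Q' o\<^sub>C\<^sub>L Y'"
    and coupling_plus: "invertible_cblinfun Y \<Longrightarrow> Q o\<^sub>C\<^sub>L (X' o\<^sub>C\<^sub>L Q') = 0 \<Longrightarrow> Q' o\<^sub>C\<^sub>L (Y' o\<^sub>C\<^sub>L Q) = 0 \<Longrightarrow>
      Q o\<^sub>C\<^sub>L X' o\<^sub>C\<^sub>L (Y - X) o\<^sub>C\<^sub>L (Y' o\<^sub>C\<^sub>L Q) = Q o\<^sub>C\<^sub>L X' - Y' o\<^sub>C\<^sub>L Q"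
      "invertible_cblinfun Y \<Longrightarrow>
      Y' o\<^sub>C\<^sub>L Q o\<^sub>C\<^sub>L (Y - X) o\<^sub>C\<^sub>L (Q o\<^sub>C\<^sub>L X') = Q o\<^sub>C\<^sub>L X' - Y' o\<^sub>C\<^sub>L Q"
proof -
  \<comment> \<open>\<open>X\<close> preserves the kernel of \<open>Q\<close> and \<open>Y\<close>
    its range. For instance \<open>Q' (Y - X) Q = - Q' X Q = Q X - X Q = X Q' - Q' X\<close>, and
    multiplying by \<open>X'\<close> on both sides gives the first identity; the others are similar
    rewritings on vectors.\<close>
  have Q_apply: "Q *\<^sub>V (Q *\<^sub>V v) = Q *\<^sub>V v" for v
    using Q by (metis cblinfun_apply_simps(7))
  have QX_apply: "Q *\<^sub>V (X *\<^sub>V (Q *\<^sub>V v)) = Q *\<^sub>V (X *\<^sub>V v)" for v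
    using arg_cong[OF QX, of "\<lambda>T. T *\<^sub>V v"] by (simp add: Q'_def cblinfun_diff_right)
  have QY_apply: "Q *\<^sub>V (Y *\<^sub>V (Q *\<^sub>V v)) = Y *\<^sub>V (Q *\<^sub>V v)" for v
    using arg_cong[OF QY, of "\<lambda>T. T *\<^sub>V v"] by (simp add: Q'_def cblinfun_diff_right)
  note X_cancel = inverse_cancel(3,4)[OF X, folded X'_def]
  show "X' o\<^sub>C\<^sub>L Q' o\<^sub>C\<^sub>L (Y - X) o\<^sub>C\<^sub>L Q o\<^sub>C\<^sub>L X' = Q' o\<^sub>C\<^sub>L X' - X' o\<^sub>C\<^sub>L Q'"
    by (rule cblinfun_eqI)
      (simp add: Q'_def cblinfun_diff_right Q_apply QX_apply QY_apply X_cancel)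
  assume Y: "invertible_cblinfun Y"
  note Y_cancel = inverse_cancel(3,4)[OF Y, folded Y'_def]
  show "X' o\<^sub>C\<^sub>L Q' o\<^sub>C\<^sub>L (Y - X) o\<^sub>C\<^sub>L (Q' o\<^sub>C\<^sub>L Y') = X' o\<^sub>C\<^sub>L Q' - Q' o\<^sub>C\<^sub>L Y'"
    "Y' o\<^sub>C\<^sub>L Q o\<^sub>C\<^sub>L (Y - X) o\<^sub>C\<^sub>L (Q o\<^sub>C\<^sub>L X') = Q o\<^sub>C\<^sub>L X' - Y' o\<^sub>C\<^sub>L Q"
    by (rule cblinfun_eqI,
      simp add: Q'_def cblinfun_diff_right Q_apply QX_apply QY_apply X_cancel Y_cancel)+
  \<comment> \<open>Invariance under an invertible operator need not pass to its inverse in infinite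
    dimension, so it enters as a separate assumption.\<close>
  assume "Q o\<^sub>C\<^sub>L (X' o\<^sub>C\<^sub>L Q') = 0" and "Q' o\<^sub>C\<^sub>L (Y' o\<^sub>C\<^sub>L Q) = 0"
  then have inv_apply: "Q *\<^sub>V (X' *\<^sub>V (Q *\<^sub>V v)) = Q *\<^sub>V (X' *\<^sub>V v)"
    "Q *\<^sub>V (Y' *\<^sub>V (Q *\<^sub>V v)) = Y' *\<^sub>V (Q *\<^sub>V v)" for v
    by (auto dest!: arg_cong[where f = "\<lambda>T. T *\<^sub>V v"] simp: Q'_def cblinfun_diff_right)
  show "Q' o\<^sub>C\<^sub>L Y' o\<^sub>C\<^sub>L (Y - X) o\<^sub>C\<^sub>L (X' o\<^sub>C\<^sub>L Q') = X' o\<^sub>C\<^sub>L Q' - Q' o\<^sub>C\<^sub>L Y'"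
    "Q o\<^sub>C\<^sub>L X' o\<^sub>C\<^sub>L (Y - X) o\<^sub>C\<^sub>L (Y' o\<^sub>C\<^sub>L Q) = Q o\<^sub>C\<^sub>L X' - Y' o\<^sub>C\<^sub>L Q"
    by (rule cblinfun_eqI,
      simp add: Q'_def cblinfun_diff_right Q_apply inv_apply X_cancel Y_cancel)+
qed

section \<open>Canonical factorization\<close>

theorem theorem3p1:
  fixes A :: "'x::chilbert_space \<Rightarrow>\<^sub>C\<^sub>L 'x"
    and B :: "'u::chilbert_space \<Rightarrow>\<^sub>C\<^sub>L 'x"
    and C :: "'x \<Rightarrow>\<^sub>C\<^sub>L 'u"
    and D :: "'u \<Rightarrow>\<^sub>C\<^sub>L 'u"
    and F G :: "complex \<Rightarrow> 'u \<Rightarrow>\<^sub>C\<^sub>L 'u"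
  assumes F: "\<And>z. z \<in> inv_resolvent_set0 A \<Longrightarrow>
      F z = D + z *\<^sub>C (C o\<^sub>C\<^sub>L inverse_cblinfun (id_cblinfun - z *\<^sub>C A) o\<^sub>C\<^sub>L B)"
    and G: "\<And>z. z \<in> inv_resolvent_set0 A \<Longrightarrow> G z = id_cblinfun + F z"
    and F_lt_1: "circle_norm F < 1"
    and A_dich: "dichotomous A"
    and ID_inv: "invertible_cblinfun (id_cblinfun + D)"
  shows
    "let Ax = A - B o\<^sub>C\<^sub>L inverse_cblinfun (id_cblinfun + D) o\<^sub>C\<^sub>L C in
      dichotomous Ax \<and>
      direct_sum_decomp (dich_minus A) (dich_plus Ax) \<and>
      (\<exists>\<Pi>r. is_projection_onto_along \<Pi>r (dich_plus Ax) (dich_minus A) \<and>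
        (\<forall>D1 D2 :: 'u \<Rightarrow>\<^sub>C\<^sub>L 'u.
          invertible_cblinfun D1 \<and> invertible_cblinfun D2 \<and> id_cblinfun + D = D1 o\<^sub>C\<^sub>L D2 \<longrightarrow>
          (let R = (\<lambda>z. inverse_cblinfun (id_cblinfun - z *\<^sub>C A));
               Rx = (\<lambda>z. inverse_cblinfun (id_cblinfun - z *\<^sub>C Ax));
               D1' = inverse_cblinfun D1;
               D2' = inverse_cblinfun D2;
               Vm = (\<lambda>z. D1 + z *\<^sub>C (C o\<^sub>C\<^sub>L R z o\<^sub>C\<^sub>L (id_cblinfun - \<Pi>r) o\<^sub>C\<^sub>L B o\<^sub>C\<^sub>L D2'));
               Vp = (\<lambda>z. D2 + z *\<^sub>C (D1' o\<^sub>C\<^sub>L C o\<^sub>C\<^sub>L \<Pi>r o\<^sub>C\<^sub>L R z o\<^sub>C\<^sub>L B));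
               Vm_inv = (\<lambda>z. D1' - z *\<^sub>C (D1' o\<^sub>C\<^sub>L C o\<^sub>C\<^sub>L (id_cblinfun - \<Pi>r) o\<^sub>C\<^sub>L Rx z
                                          o\<^sub>C\<^sub>L B o\<^sub>C\<^sub>L D2' o\<^sub>C\<^sub>L D1'));
               Vp_inv = (\<lambda>z. D2' - z *\<^sub>C (D2' o\<^sub>C\<^sub>L D1' o\<^sub>C\<^sub>L C o\<^sub>C\<^sub>L Rx z
                                          o\<^sub>C\<^sub>L \<Pi>r o\<^sub>C\<^sub>L B o\<^sub>C\<^sub>L D2'))
           in
             (\<forall>z\<in>inv_resolvent_set0 A. G z = Vm z o\<^sub>C\<^sub>L Vp z) \<and>
             (\<forall>z\<in>inv_resolvent_set0 A \<inter> inv_resolvent_set0 Ax.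
               invertible_cblinfun (Vm z) \<and> inverse_cblinfun (Vm z) = Vm_inv z \<and>
               invertible_cblinfun (Vp z) \<and> inverse_cblinfun (Vp z) = Vp_inv z) \<and>
             extends_analytically Vp (inv_resolvent_set0 A) (cball 0 1) \<and>
             extends_analytically Vp_inv (inv_resolvent_set0 Ax) (cball 0 1) \<and>
             extends_analytically Vm (inv_resolvent_set0 A) (closure (- cball 0 1)) \<and>
             extends_analytically Vm_inv (inv_resolvent_set0 Ax) (closure (- cball 0 1)))))"
proof -
  interpret A: dichotomous_operator A
    by unfold_locales (rule A_dich)
  have circle: "z \<in> inv_resolvent_set0 A" if "cmod z = 1" for z
    using A.invertible_on_circle[OF that] by (simp add: inv_resolvent_set0_def)
  \<comment> \<open>Continuity bounds the norms on the compact circle; without a bound their real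
    supremum would say nothing about the individual values.\<close>
  have "continuous_on (sphere 0 1) (\<lambda>z. D + z *\<^sub>C (C o\<^sub>C\<^sub>L inverse_cblinfun (id_cblinfun - z *\<^sub>C A) o\<^sub>C\<^sub>L B))"
    by (intro continuous_intros) (auto intro: A.invertible_on_circle)
  then have "continuous_on (sphere 0 1) F"
    by (rule continuous_on_eq) (simp add: F circle)
  then have "bdd_above ((\<lambda>z. norm (F z)) ` sphere 0 1)"
    by (intro bounded_imp_bdd_above compact_imp_bounded compact_continuous_image compact_sphere continuous_intros)
  then have F_le: "norm (F z) \<le> circle_norm F" if "cmod z = 1" for z
    unfolding circle_norm_def using that by (intro cSUP_upper) auto
  interpret contractive_realization A B C D "circle_norm F"
  proof
    show "0 \<le> circle_norm F"
      by (rule order_trans[OF norm_ge_zero F_le[of 1]]) simp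
    show "norm (D + cis (- t) *\<^sub>C (C o\<^sub>C\<^sub>L A.\<rho> t o\<^sub>C\<^sub>L B)) \<le> circle_norm F" for t
      using F_le[of "cis (- t)"] F[of "cis (- t)"] circle[of "cis (- t)"] by (simp add: A.\<rho>_def)
  qed (fact F_lt_1 ID_inv)+
  obtain b where ex: "\<And>x. \<exists>y. y \<in> dich_plus Ax \<and> x - y \<in> dich_minus A \<and> norm y \<le> b * norm x"
    using decomposition_exists by blast
  have "x = (x - y) + y" for x y :: 'x
    by simp
  then have decomp: "direct_sum_decomp (dich_minus A) (dich_plus Ax)"
    unfolding direct_sum_decomp_def
    using A.closed_csubspace_dich_minus assoc.closed_csubspace_dich_plus dich_minus_Int_dich_plus ex by metis
  obtain Q where Q: "is_projection_onto_along Q (dich_plus Ax) (dich_minus A)"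
    using projection_exists[OF assoc.closed_csubspace_dich_plus A.closed_csubspace_dich_minus
        dich_minus_Int_dich_plus ex] .
  define Q' where "Q' = id_cblinfun - Q"
  have Q_idem: "Q o\<^sub>C\<^sub>L Q = Q" and Q_ker: "Q *\<^sub>V x = 0 \<longleftrightarrow> A.P *\<^sub>V x = 0"
    and Q_ran: "assoc.P *\<^sub>V (Q *\<^sub>V x) = Q *\<^sub>V x" and Q_fix: "assoc.P *\<^sub>V x = x \<Longrightarrow> Q *\<^sub>V x = x" for x
  proof -
    show "Q o\<^sub>C\<^sub>L Q = Q"
      using Q by (simp add: is_projection_onto_along_def)
    then have idem: "Q *\<^sub>V (Q *\<^sub>V y) = Q *\<^sub>V y" for y
      by (metis cblinfun_apply_simps(7))
    have ran: "range (\<lambda>x. Q *\<^sub>V x) = dich_plus Ax" and ker: "{x. Q *\<^sub>V x = 0} = dich_minus A"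
      using Q by (simp_all add: is_projection_onto_along_def)
    show "Q *\<^sub>V x = 0 \<longleftrightarrow> A.P *\<^sub>V x = 0"
      using ker A.mem_dich_minus by blast
    show "assoc.P *\<^sub>V (Q *\<^sub>V x) = Q *\<^sub>V x"
      using ran assoc.mem_dich_plus by blast
    assume "assoc.P *\<^sub>V x = x"
    then have "x \<in> range (\<lambda>x. Q *\<^sub>V x)"
      unfolding ran by (simp add: assoc.mem_dich_plus)
    then show "Q *\<^sub>V x = x"
      using idem by auto
  qed
  have P_Q': "A.P o\<^sub>C\<^sub>L Q' = 0"
  proof (rule cblinfun_eqI)
    fix x
    have "Q *\<^sub>V (x - Q *\<^sub>V x) = 0"
      using Q_idem by (simp add: cblinfun_diff_right flip: cblinfun_apply_simps(7))
    then show "(A.P o\<^sub>C\<^sub>L Q') *\<^sub>V x = 0 *\<^sub>V x"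
      by (simp add: Q_ker Q'_def)
  qed
  have Q_P: "Q o\<^sub>C\<^sub>L (id_cblinfun - A.P) = 0"
    by (rule cblinfun_eqI) (simp add: Q_ker cblinfun_diff_right[of A.P])
  have Px_Q: "assoc.P o\<^sub>C\<^sub>L Q = Q"
    by (rule cblinfun_eqI) (simp add: Q_ran)
  have Q'_Px: "Q' o\<^sub>C\<^sub>L assoc.P = 0"
    by (rule cblinfun_eqI) (simp add: Q'_def Q_fix)
  \<comment> \<open>The kernel of \<open>Q\<close> is that of \<open>A.P\<close>, so everything
    commuting with \<open>A.P\<close> preserves it. This covers \<open>I - z A\<close> and also its
    inverse; \<open>range_invariant\<close> does the same for the range and
    \<open>assoc.P\<close>.\<close>
  have kernel_invariant: "Q o\<^sub>C\<^sub>L (T o\<^sub>C\<^sub>L Q') = 0" if "T o\<^sub>C\<^sub>L A.P = A.P o\<^sub>C\<^sub>L T" for T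
  proof -
    have "A.P o\<^sub>C\<^sub>L (T o\<^sub>C\<^sub>L Q') = 0"
      unfolding compose_assoc[symmetric] that[symmetric] by (simp add: compose_assoc P_Q')
    then have "T o\<^sub>C\<^sub>L Q' = (id_cblinfun - A.P) o\<^sub>C\<^sub>L (T o\<^sub>C\<^sub>L Q')"
      by (simp add: compose_diff_left)
    then have "Q o\<^sub>C\<^sub>L (T o\<^sub>C\<^sub>L Q') = Q o\<^sub>C\<^sub>L (id_cblinfun - A.P) o\<^sub>C\<^sub>L (T o\<^sub>C\<^sub>L Q')"
      by (simp add: compose_assoc)
    then show ?thesis
      by (simp add: Q_P)
  qed
  have range_invariant: "Q' o\<^sub>C\<^sub>L (T o\<^sub>C\<^sub>L Q) = 0" if "T o\<^sub>C\<^sub>L assoc.P = assoc.P o\<^sub>C\<^sub>L T" for T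
  proof -
    have "T o\<^sub>C\<^sub>L Q = T o\<^sub>C\<^sub>L assoc.P o\<^sub>C\<^sub>L Q"
      by (simp add: compose_assoc Px_Q)
    then have "Q' o\<^sub>C\<^sub>L (T o\<^sub>C\<^sub>L Q) = Q' o\<^sub>C\<^sub>L assoc.P o\<^sub>C\<^sub>L (T o\<^sub>C\<^sub>L Q)"
      unfolding that by (simp add: compose_assoc)
    then show ?thesis
      by (simp add: Q'_Px)
  qed
  define E where "E = inverse_cblinfun (id_cblinfun + D)"
  have coupling: "z *\<^sub>C (B o\<^sub>C\<^sub>L (E o\<^sub>C\<^sub>L C)) = (id_cblinfun - z *\<^sub>C Ax) - (id_cblinfun - z *\<^sub>C A)" for z
    by (simp add: Ax_def E_def scaleC_diff_right compose_assoc)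
  have P_X: "(id_cblinfun - z *\<^sub>C A) o\<^sub>C\<^sub>L A.P = A.P o\<^sub>C\<^sub>L (id_cblinfun - z *\<^sub>C A)" for z
    using A.P_commute[of A] by (simp add: compose_distribs)
  have P_Y: "(id_cblinfun - z *\<^sub>C Ax) o\<^sub>C\<^sub>L assoc.P = assoc.P o\<^sub>C\<^sub>L (id_cblinfun - z *\<^sub>C Ax)" for z
    using assoc.P_commute[of Ax] by (simp add: compose_distribs)
  define R where "R z = inverse_cblinfun (id_cblinfun - z *\<^sub>C A)" for z
  define Rx where "Rx z = inverse_cblinfun (id_cblinfun - z *\<^sub>C Ax)" for z
  note coupling_hyps = Q_idem kernel_invariant[OF P_X, unfolded Q'_def] range_invariant[OF P_Y, unfolded Q'_def]
  note fold = R_def[symmetric] Rx_def[symmetric] Q'_def[symmetric] coupling[symmetric]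

  have main: "(\<forall>z\<in>inv_resolvent_set0 A. G z =
        (D1 + z *\<^sub>C (C o\<^sub>C\<^sub>L R z o\<^sub>C\<^sub>L Q' o\<^sub>C\<^sub>L B o\<^sub>C\<^sub>L D2')) o\<^sub>C\<^sub>L (D2 + z *\<^sub>C (D1' o\<^sub>C\<^sub>L C o\<^sub>C\<^sub>L Q o\<^sub>C\<^sub>L R z o\<^sub>C\<^sub>L B))) \<and>
      (\<forall>z\<in>inv_resolvent_set0 A \<inter> inv_resolvent_set0 Ax.
        invertible_cblinfun (D1 + z *\<^sub>C (C o\<^sub>C\<^sub>L R z o\<^sub>C\<^sub>L Q' o\<^sub>C\<^sub>L B o\<^sub>C\<^sub>L D2')) \<and>
        inverse_cblinfun (D1 + z *\<^sub>C (C o\<^sub>C\<^sub>L R z o\<^sub>C\<^sub>L Q' o\<^sub>C\<^sub>L B o\<^sub>C\<^sub>L D2'))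
          = D1' - z *\<^sub>C (D1' o\<^sub>C\<^sub>L C o\<^sub>C\<^sub>L Q' o\<^sub>C\<^sub>L Rx z o\<^sub>C\<^sub>L B o\<^sub>C\<^sub>L D2' o\<^sub>C\<^sub>L D1') \<and>
        invertible_cblinfun (D2 + z *\<^sub>C (D1' o\<^sub>C\<^sub>L C o\<^sub>C\<^sub>L Q o\<^sub>C\<^sub>L R z o\<^sub>C\<^sub>L B)) \<and>
        inverse_cblinfun (D2 + z *\<^sub>C (D1' o\<^sub>C\<^sub>L C o\<^sub>C\<^sub>L Q o\<^sub>C\<^sub>L R z o\<^sub>C\<^sub>L B))
          = D2' - z *\<^sub>C (D2' o\<^sub>C\<^sub>L D1' o\<^sub>C\<^sub>L C o\<^sub>C\<^sub>L Rx z o\<^sub>C\<^sub>L Q o\<^sub>C\<^sub>L B o\<^sub>C\<^sub>L D2')) \<and>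
      extends_analytically (\<lambda>z. D2 + z *\<^sub>C (D1' o\<^sub>C\<^sub>L C o\<^sub>C\<^sub>L Q o\<^sub>C\<^sub>L R z o\<^sub>C\<^sub>L B))
        (inv_resolvent_set0 A) (cball 0 1) \<and>
      extends_analytically (\<lambda>z. D2' - z *\<^sub>C (D2' o\<^sub>C\<^sub>L D1' o\<^sub>C\<^sub>L C o\<^sub>C\<^sub>L Rx z o\<^sub>C\<^sub>L Q o\<^sub>C\<^sub>L B o\<^sub>C\<^sub>L D2'))
        (inv_resolvent_set0 Ax) (cball 0 1) \<and>
      extends_analytically (\<lambda>z. D1 + z *\<^sub>C (C o\<^sub>C\<^sub>L R z o\<^sub>C\<^sub>L Q' o\<^sub>C\<^sub>L B o\<^sub>C\<^sub>L D2'))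
        (inv_resolvent_set0 A) (closure (- cball 0 1)) \<and>
      extends_analytically (\<lambda>z. D1' - z *\<^sub>C (D1' o\<^sub>C\<^sub>L C o\<^sub>C\<^sub>L Q' o\<^sub>C\<^sub>L Rx z o\<^sub>C\<^sub>L B o\<^sub>C\<^sub>L D2' o\<^sub>C\<^sub>L D1'))
        (inv_resolvent_set0 Ax) (closure (- cball 0 1))"
    (is "?factor \<and> ?inverses \<and> ?ext1 \<and> ?ext2 \<and> ?ext3 \<and> ?ext4")
    if D1: "invertible_cblinfun D1" and D2: "invertible_cblinfun D2" and D12: "id_cblinfun + D = D1 o\<^sub>C\<^sub>L D2"
      and D1': "D1' = inverse_cblinfun D1" and D2': "D2' = inverse_cblinfun D2" for D1 D2 D1' D2' :: "'u \<Rightarrow>\<^sub>C\<^sub>L 'u"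
  proof (intro conjI)
    have E: "E = D2' o\<^sub>C\<^sub>L D1'"
      unfolding E_def D12 D1' D2' by (rule invertible_compose(2)[OF D1 D2])
    note cancel = inverse_cblinfun[OF D1, folded D1'] inverse_cblinfun[OF D2, folded D2']
      inverse_cancel(1,2)[OF D1, folded D1'] inverse_cancel(1,2)[OF D2, folded D2']
    show ?factor
    proof
      fix z assume z: "z \<in> inv_resolvent_set0 A"
      then have X: "invertible_cblinfun (id_cblinfun - z *\<^sub>C A)"
        by (simp add: inv_resolvent_set0_def)
      \<comment> \<open>This is the core of the quadratic term of the product. It contributes
        \<open>Q' R - R Q'\<close>, which together with the linear terms \<open>R Q'\<close> and
        \<open>Q R\<close> leaves \<open>(Q + Q') R = R\<close>.\<close>
      have "z *\<^sub>C (R z o\<^sub>C\<^sub>L (Q' o\<^sub>C\<^sub>L (B o\<^sub>C\<^sub>L (E o\<^sub>C\<^sub>L (C o\<^sub>C\<^sub>L (Q o\<^sub>C\<^sub>L R z)))))) = Q' o\<^sub>C\<^sub>L R z - R z o\<^sub>C\<^sub>L Q'"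
        using coupling_factor[where Y = "id_cblinfun - z *\<^sub>C Ax", OF X coupling_hyps, unfolded fold] by (simp add: compose_assoc)
      then have "z *\<^sub>C (C o\<^sub>C\<^sub>L (z *\<^sub>C (R z o\<^sub>C\<^sub>L (Q' o\<^sub>C\<^sub>L (B o\<^sub>C\<^sub>L (E o\<^sub>C\<^sub>L (C o\<^sub>C\<^sub>L (Q o\<^sub>C\<^sub>L R z)))))) o\<^sub>C\<^sub>L B))
          = z *\<^sub>C (C o\<^sub>C\<^sub>L ((Q' o\<^sub>C\<^sub>L R z - R z o\<^sub>C\<^sub>L Q') o\<^sub>C\<^sub>L B))"
        by (simp only:)
      then have quadratic: "(z * z) *\<^sub>C (C o\<^sub>C\<^sub>L (R z o\<^sub>C\<^sub>L (Q' o\<^sub>C\<^sub>L (B o\<^sub>C\<^sub>L (D2' o\<^sub>C\<^sub>L (D1' o\<^sub>C\<^sub>L (C o\<^sub>C\<^sub>L (Q o\<^sub>C\<^sub>L (R z o\<^sub>C\<^sub>L B)))))))))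
          = z *\<^sub>C (C o\<^sub>C\<^sub>L (Q' o\<^sub>C\<^sub>L (R z o\<^sub>C\<^sub>L B)) - C o\<^sub>C\<^sub>L (R z o\<^sub>C\<^sub>L (Q' o\<^sub>C\<^sub>L B)))"
        by (simp add: E compose_assoc compose_diff_left compose_diff_right scaleC_scaleC)
      have "G z = D1 o\<^sub>C\<^sub>L D2 + z *\<^sub>C (C o\<^sub>C\<^sub>L (R z o\<^sub>C\<^sub>L B))"
        using G[OF z] F[OF z] by (simp add: R_def D12[symmetric] compose_assoc add.assoc)
      also have "\<dots> = (D1 + z *\<^sub>C (C o\<^sub>C\<^sub>L R z o\<^sub>C\<^sub>L Q' o\<^sub>C\<^sub>L B o\<^sub>C\<^sub>L D2')) o\<^sub>C\<^sub>L (D2 + z *\<^sub>C (D1' o\<^sub>C\<^sub>L C o\<^sub>C\<^sub>L Q o\<^sub>C\<^sub>L R z o\<^sub>C\<^sub>L B))"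
        by (simp add: compose_add_left compose_add_right compose_assoc cancel scaleC_add_right scaleC_scaleC quadratic)
          (simp add: Q'_def compose_distribs scaleC_simps)
      finally show "G z = (D1 + z *\<^sub>C (C o\<^sub>C\<^sub>L R z o\<^sub>C\<^sub>L Q' o\<^sub>C\<^sub>L B o\<^sub>C\<^sub>L D2')) o\<^sub>C\<^sub>L (D2 + z *\<^sub>C (D1' o\<^sub>C\<^sub>L C o\<^sub>C\<^sub>L Q o\<^sub>C\<^sub>L R z o\<^sub>C\<^sub>L B))" .
    qed
    show ?inverses
    proof
      fix z assume "z \<in> inv_resolvent_set0 A \<inter> inv_resolvent_set0 Ax"
      then have X: "invertible_cblinfun (id_cblinfun - z *\<^sub>C A)" and Y: "invertible_cblinfun (id_cblinfun - z *\<^sub>C Ax)"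
        and z: "z \<in> inv_resolvent_set0 A" "z \<in> inv_resolvent_set0 Ax"
        by (simp_all add: inv_resolvent_set0_def)
      note hyps = kernel_invariant[OF A.resolvent_commute_P[OF z(1)], unfolded Q'_def]
        range_invariant[OF assoc.resolvent_commute_P[OF z(2)], unfolded Q'_def]
      let ?Vm = "D1 + z *\<^sub>C (C o\<^sub>C\<^sub>L R z o\<^sub>C\<^sub>L Q' o\<^sub>C\<^sub>L B o\<^sub>C\<^sub>L D2')"
        and ?Vp = "D2 + z *\<^sub>C (D1' o\<^sub>C\<^sub>L C o\<^sub>C\<^sub>L Q o\<^sub>C\<^sub>L R z o\<^sub>C\<^sub>L B)"
        and ?Wm = "D1' - z *\<^sub>C (D1' o\<^sub>C\<^sub>L C o\<^sub>C\<^sub>L Q' o\<^sub>C\<^sub>L Rx z o\<^sub>C\<^sub>L B o\<^sub>C\<^sub>L D2' o\<^sub>C\<^sub>L D1')"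
        and ?Wp = "D2' - z *\<^sub>C (D2' o\<^sub>C\<^sub>L D1' o\<^sub>C\<^sub>L C o\<^sub>C\<^sub>L Rx z o\<^sub>C\<^sub>L Q o\<^sub>C\<^sub>L B o\<^sub>C\<^sub>L D2')"
      \<comment> \<open>Removing the outer factor \<open>D1\<close> normalises the value at 0 to the
        identity and turns \<open>D2' D1'\<close> into \<open>E\<close>, as the coupling identities
        require; \<open>Ip\<close> below does the same with \<open>D2\<close>.\<close>
      define Im where "Im = id_cblinfun + z *\<^sub>C (C o\<^sub>C\<^sub>L (R z o\<^sub>C\<^sub>L Q') o\<^sub>C\<^sub>L (B o\<^sub>C\<^sub>L E))"
      define Jm where "Jm = id_cblinfun - z *\<^sub>C (C o\<^sub>C\<^sub>L (Q' o\<^sub>C\<^sub>L Rx z) o\<^sub>C\<^sub>L (B o\<^sub>C\<^sub>L E))"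
      have m: "Im o\<^sub>C\<^sub>L Jm = id_cblinfun" "Jm o\<^sub>C\<^sub>L Im = id_cblinfun"
        using coupling_minus(1)[OF X coupling_hyps Y, unfolded fold]
          coupling_minus(2)[OF X coupling_hyps Y hyps, unfolded fold]
        unfolding Im_def Jm_def
        by (intro perturbed_identity_inverse; simp add: compose_assoc)+
      have Vm: "?Vm = Im o\<^sub>C\<^sub>L D1" "?Wm = D1' o\<^sub>C\<^sub>L Jm"
        by (simp_all add: Im_def Jm_def E compose_distribs compose_assoc cancel)
      have "?Wm o\<^sub>C\<^sub>L ?Vm = id_cblinfun" "?Vm o\<^sub>C\<^sub>L ?Wm = id_cblinfun"
        unfolding Vm using m by (simp_all add: compose_assoc cancel) (simp_all add: compose_assoc[symmetric] cancel)
      moreover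
      define Ip where "Ip = id_cblinfun + z *\<^sub>C ((E o\<^sub>C\<^sub>L C) o\<^sub>C\<^sub>L (Q o\<^sub>C\<^sub>L R z) o\<^sub>C\<^sub>L B)"
      define Jp where "Jp = id_cblinfun - z *\<^sub>C ((E o\<^sub>C\<^sub>L C) o\<^sub>C\<^sub>L (Rx z o\<^sub>C\<^sub>L Q) o\<^sub>C\<^sub>L B)"
      have p: "Ip o\<^sub>C\<^sub>L Jp = id_cblinfun" "Jp o\<^sub>C\<^sub>L Ip = id_cblinfun"
        using coupling_plus(1)[OF X coupling_hyps Y hyps, unfolded fold]
          coupling_plus(2)[OF X coupling_hyps Y, unfolded fold]
        unfolding Ip_def Jp_def
        by (intro perturbed_identity_inverse; simp add: compose_assoc)+
      have Vp: "?Vp = D2 o\<^sub>C\<^sub>L Ip" "?Wp = Jp o\<^sub>C\<^sub>L D2'"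
        by (simp_all add: Ip_def Jp_def E compose_distribs compose_assoc cancel)
      have "?Wp o\<^sub>C\<^sub>L ?Vp = id_cblinfun" "?Vp o\<^sub>C\<^sub>L ?Wp = id_cblinfun"
        unfolding Vp using p by (simp_all add: compose_assoc cancel) (simp_all add: compose_assoc[symmetric] cancel)
      ultimately show "invertible_cblinfun ?Vm \<and> inverse_cblinfun ?Vm = ?Wm \<and>
          invertible_cblinfun ?Vp \<and> inverse_cblinfun ?Vp = ?Wp"
        by (blast intro: invertible_cblinfunI inverse_cblinfun_eqI)
    qed
    \<comment> \<open>Since \<open>Q\<close> annihilates the kernel of \<open>A.P\<close>,
      \<open>Q R z\<close> equals \<open>Q R z P\<close>, and the stable half of the resolvent
      extends over the closed disc.\<close>
    show ?ext1
    proof (rule A.resolvent_plus_extends)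
      fix S H
      assume S: "open S" "cball 0 1 \<subseteq> S" "vanalytic_on H S"
        and H: "\<And>z. z \<in> S \<Longrightarrow> z \<in> inv_resolvent_set0 A \<Longrightarrow> inverse_cblinfun (id_cblinfun - z *\<^sub>C A) o\<^sub>C\<^sub>L A.P = H z"
      show ?ext1
      proof (rule extends_analyticallyI[OF S])
        fix z assume z: "z \<in> S" "z \<in> inv_resolvent_set0 A"
        have "Q o\<^sub>C\<^sub>L R z = Q o\<^sub>C\<^sub>L H z + Q o\<^sub>C\<^sub>L (id_cblinfun - A.P) o\<^sub>C\<^sub>L R z"
          using A.resolvent_commute_P[OF z(2)]
          by (simp add: H[OF z, symmetric] R_def compose_assoc compose_diff_left compose_diff_right)
        then have "Q o\<^sub>C\<^sub>L R z = Q o\<^sub>C\<^sub>L H z"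
          by (simp add: Q_P)
        then show "D2 + z *\<^sub>C (D1' o\<^sub>C\<^sub>L C o\<^sub>C\<^sub>L Q o\<^sub>C\<^sub>L R z o\<^sub>C\<^sub>L B) = D2 + z *\<^sub>C ((D1' o\<^sub>C\<^sub>L C o\<^sub>C\<^sub>L Q) o\<^sub>C\<^sub>L H z o\<^sub>C\<^sub>L B)"
          by (simp add: compose_assoc[of _ Q])
      qed
    qed
    \<comment> \<open>Here \<open>Q\<close> stands on the right and its range is that of
      \<open>assoc.P\<close>, so \<open>Rx z\<close> is met only on the stable subspace of
      \<open>Ax\<close>.\<close>
    show ?ext2
    proof (rule assoc.resolvent_plus_extends)
      fix S H
      assume S: "open S" "cball 0 1 \<subseteq> S" "vanalytic_on H S"
        and H: "\<And>z. z \<in> S \<Longrightarrow> z \<in> inv_resolvent_set0 Ax \<Longrightarrow> inverse_cblinfun (id_cblinfun - z *\<^sub>C Ax) o\<^sub>C\<^sub>L assoc.P = H z"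
      show ?ext2
      proof (rule extends_analyticallyI[OF S])
        fix z assume z: "z \<in> S" "z \<in> inv_resolvent_set0 Ax"
        have "Rx z o\<^sub>C\<^sub>L Q = H z o\<^sub>C\<^sub>L Q"
          by (simp add: H[OF z, symmetric] Rx_def compose_assoc Px_Q)
        then show "D2' - z *\<^sub>C (D2' o\<^sub>C\<^sub>L D1' o\<^sub>C\<^sub>L C o\<^sub>C\<^sub>L Rx z o\<^sub>C\<^sub>L Q o\<^sub>C\<^sub>L B o\<^sub>C\<^sub>L D2')
            = D2' + z *\<^sub>C ((- (D2' o\<^sub>C\<^sub>L D1' o\<^sub>C\<^sub>L C)) o\<^sub>C\<^sub>L H z o\<^sub>C\<^sub>L (Q o\<^sub>C\<^sub>L B o\<^sub>C\<^sub>L D2'))"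
          by (simp add: compose_assoc[of _ "Rx z"] compose_minus_left scaleC_minus_right)
            (simp add: compose_assoc)
      qed
    qed
    \<comment> \<open>The range of \<open>Q'\<close> is the kernel of \<open>A.P\<close>, so
      \<open>R z\<close> acts only on the unstable subspace.\<close>
    show ?ext3
    proof (rule A.resolvent_minus_extends)
      fix S H
      assume S: "open S" "closure (- cball 0 1) \<subseteq> S" "vanalytic_on H S"
        and H: "\<And>z. z \<in> S \<Longrightarrow> z \<in> inv_resolvent_set0 A \<Longrightarrow>
          inverse_cblinfun (id_cblinfun - z *\<^sub>C A) o\<^sub>C\<^sub>L (id_cblinfun - A.P) = H z"
      show ?ext3
      proof (rule extends_analyticallyI[OF S])
        fix z assume z: "z \<in> S" "z \<in> inv_resolvent_set0 A"
        have "R z o\<^sub>C\<^sub>L Q' = H z o\<^sub>C\<^sub>L Q'"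
          by (simp add: H[OF z, symmetric] R_def compose_assoc compose_diff_left P_Q')
        then show "D1 + z *\<^sub>C (C o\<^sub>C\<^sub>L R z o\<^sub>C\<^sub>L Q' o\<^sub>C\<^sub>L B o\<^sub>C\<^sub>L D2') = D1 + z *\<^sub>C (C o\<^sub>C\<^sub>L H z o\<^sub>C\<^sub>L (Q' o\<^sub>C\<^sub>L B o\<^sub>C\<^sub>L D2'))"
          by (simp add: compose_assoc[of C "R z"]) (simp add: compose_assoc)
      qed
    qed
    \<comment> \<open>\<open>Q'\<close> annihilates the range of \<open>assoc.P\<close>; it removes
      the stable half of \<open>Rx z\<close> from the left.\<close>
    show ?ext4
    proof (rule assoc.resolvent_minus_extends)
      fix S H
      assume S: "open S" "closure (- cball 0 1) \<subseteq> S" "vanalytic_on H S"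
        and H: "\<And>z. z \<in> S \<Longrightarrow> z \<in> inv_resolvent_set0 Ax \<Longrightarrow>
          inverse_cblinfun (id_cblinfun - z *\<^sub>C Ax) o\<^sub>C\<^sub>L (id_cblinfun - assoc.P) = H z"
      show ?ext4
      proof (rule extends_analyticallyI[OF S])
        fix z assume z: "z \<in> S" "z \<in> inv_resolvent_set0 Ax"
        have "Q' o\<^sub>C\<^sub>L Rx z = Q' o\<^sub>C\<^sub>L H z + Q' o\<^sub>C\<^sub>L assoc.P o\<^sub>C\<^sub>L Rx z"
          using assoc.resolvent_commute_P[OF z(2)]
          by (simp add: H[OF z, symmetric] Rx_def compose_assoc compose_diff_right)
        then have "Q' o\<^sub>C\<^sub>L Rx z = Q' o\<^sub>C\<^sub>L H z"
          by (simp add: Q'_Px)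
        then show "D1' - z *\<^sub>C (D1' o\<^sub>C\<^sub>L C o\<^sub>C\<^sub>L Q' o\<^sub>C\<^sub>L Rx z o\<^sub>C\<^sub>L B o\<^sub>C\<^sub>L D2' o\<^sub>C\<^sub>L D1')
            = D1' + z *\<^sub>C ((- (D1' o\<^sub>C\<^sub>L C o\<^sub>C\<^sub>L Q')) o\<^sub>C\<^sub>L H z o\<^sub>C\<^sub>L (B o\<^sub>C\<^sub>L D2' o\<^sub>C\<^sub>L D1'))"
          by (simp add: compose_assoc[of _ Q'] compose_minus_left scaleC_minus_right)
            (simp add: compose_assoc)
      qed
    qed
  qed
  show ?thesis
    unfolding Ax_def[symmetric] Let_def
    by (rule conjI[OF dichotomous_Ax conjI[OF decomp exI[of _ Q]]], rule conjI[OF Q],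
        intro allI impI, elim conjE)
      (rule main[OF _ _ _ refl refl, unfolded R_def Rx_def Q'_def])
qed

end
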